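(* Let $\mathcal{S}$ be any one of the four $k$-signaletic operads (messy parallel, tidy parallel, messy series, or tidy series) defined in the context, for any integer $k \ge 0$. Then $\mathcal{S}$ is quadratic (its ideal of relations is generated by its arity-$3$ relations, i.e. by the relations between syntax trees with two internal nodes) and Koszul. More precisely, these quadratic relations can be oriented into a convergent quadratic rewriting system whose normal forms (which thus form a Poincaré–Birkhoff–Witt basis of $\mathcal{S}$) are exactly the right $k$-signaletic combs for the corresponding circulation rule.
   Context: Let $\mathbb{K}$ be a field, $k\ge 0$ an integer, and $\mathcal{O}_k=\{\prec,\succ\}^k$ the set of words of length $k$ in the two letters $\prec$ ("left") and $\succ$ ("right"), viewed as binary operation symbols. A syntax tree on $\mathcal{O}_k$ is a rooted planar binary tree whose internal nodes are labeled by elements of $\mathcal{O}_k$; its arity $n$ is its number of leaves, numbered $1,\dots,n$ from left to right. The free non-symmetric operad $\mathcal{F}(\mathcal{O}_k)$ has in arity $n$ the $\mathbb{K}$-vector space with basis the syntax trees of arity $n$, with partial composition $s\circ_i t$ grafting the root of $t$ on the $i$-th leaf of $s$. Circulation rules. Parallel: $k$ cars $c_1,\dots,c_k$ enter at the root; at each internal node it reaches, car $c_j$ moves to the left child if the $j$-th letter of the node label is $\prec$ and to the right child if it is $\succ$, until it reaches a leaf $\ell_j$. Series: the cars $c_1,\dots,c_k$ enter one after the other; at each internal node it reaches, car $c_j$ reads the leftmost letter of the node label not yet erased by $c_1,\dots,c_{j-1}$, moves left or right accordingly, and erases that letter; it ends at a leaf $\ell_j$. In both cases $(\ell_1,\dots,\ell_k)\in[n]^k$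 is the (parallel, resp. series) destination vector, and a letter of a node label is called used if some car reads it. A syntax tree is tidy (for the given rule) if every unused letter of every node label equals $\prec$. The messy parallel (resp. messy series) $k$-signaletic operad is the quotient of $\mathcal{F}(\mathcal{O}_k)$ by the subspace (which is an operad ideal) spanned by all differences $s-t$ of syntax trees of the same arity with the same parallel (resp. series) destination vector. The tidy parallel (resp. tidy series) $k$-signaletic operad is the quotient of $\mathcal{F}(\mathcal{O}_k)$ by the subspace (an operad ideal) spanned by all differences $s-t$ of tidy syntax trees of the same arity with the same parallel (resp. series) destination vector, together with all non-tidy syntax trees. A right $k$-signaletic comb (for a given rule) is a syntax tree in which the left child of every internal node is a leaf and which is tidy for that rule. A quadratic operad is called Koszul here in the standard sense; a Poincaré–Birkhoff–Witt basis is the set of normal forms of a convergent (terminating and confluent) rewriting system orienting the quadratic relations. *)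

theory Defs
  imports
    Complex_Main
    "HOL-Library.Poly_Mapping"
    "HOL-Library.Tree"
    "HOL-Library.Confluence"
begin

section \<open>Free vector spaces\<close>

text \<open>
  The vector space with basis \<^typ>\<open>'b\<close> over a field is the type of finitely supported functions
  \<^typ>\<open>'b \<Rightarrow>\<^sub>0 'a::field\<close>; the basis vector of \<open>b\<close> is \<open>Poly_Mapping.single b 1\<close>.
\<close>

definition smul :: "'a::field \<Rightarrow> ('b \<Rightarrow>\<^sub>0 'a) \<Rightarrow> ('b \<Rightarrow>\<^sub>0 'a)" where
  "smul c = Poly_Mapping.map (\<lambda>a. c * a)"

lemma lookup_smul [simp]: "Poly_Mapping.lookup (smul c x) b = c * Poly_Mapping.lookup x b"
  by (simp add: smul_def Poly_Mapping.map.rep_eq when_def)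

interpretation free_vs: vector_space "smul :: 'a::field \<Rightarrow> ('b \<Rightarrow>\<^sub>0 'a) \<Rightarrow> ('b \<Rightarrow>\<^sub>0 'a)"
  by unfold_locales (auto intro!: poly_mapping_eqI simp: lookup_add algebra_simps)

abbreviation basis_vec :: "'b \<Rightarrow> 'b \<Rightarrow>\<^sub>0 'a::field" where
  "basis_vec b \<equiv> Poly_Mapping.single b 1"

definition lin_ext :: "('b \<Rightarrow> ('c \<Rightarrow>\<^sub>0 'a)) \<Rightarrow> ('b \<Rightarrow>\<^sub>0 'a::field) \<Rightarrow> ('c \<Rightarrow>\<^sub>0 'a)" where
  "lin_ext f x = (\<Sum>b\<in>Poly_Mapping.keys x. smul (Poly_Mapping.lookup x b) (f b))"


section \<open>The free nonsymmetric operad on a set of binary operations\<close>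

text \<open>
  A syntax tree is a binary tree in the sense of \<open>HOL-Library.Tree\<close>, with operation symbols at the
  internal nodes. Its arity, the number of leaves, is \<^const>\<open>size1\<close>. Leaves are numbered from 1.
\<close>

definition syntax_trees :: "'x set \<Rightarrow> nat \<Rightarrow> 'x tree set" where
  "syntax_trees G n = {t. set_tree t \<subseteq> G \<and> size1 t = n}"

fun graft :: "'x tree \<Rightarrow> nat \<Rightarrow> 'x tree \<Rightarrow> 'x tree" where
  "graft Leaf i t = t"
| "graft (Node l w r) i t =
     (if i \<le> size1 l then Node (graft l i t) w r else Node l w (graft r (i - size1 l) t))"

definition free_comp :: "('x tree \<Rightarrow>\<^sub>0 'a) \<Rightarrow> nat \<Rightarrow> ('x tree \<Rightarrow>\<^sub>0 'a::field) \<Rightarrow> ('x tree \<Rightarrow>\<^sub>0 'a)" where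
  "free_comp x i y = lin_ext (\<lambda>s. lin_ext (\<lambda>t. basis_vec (graft s i t)) y) x"

definition free_space :: "'x set \<Rightarrow> nat \<Rightarrow> ('x tree \<Rightarrow>\<^sub>0 'a::field) set" where
  "free_space G n = {x. Poly_Mapping.keys x \<subseteq> syntax_trees G n}"

definition operad_ideal :: "'x set \<Rightarrow> (nat \<Rightarrow> ('x tree \<Rightarrow>\<^sub>0 'a::field) set) \<Rightarrow> bool" where
  "operad_ideal G J \<longleftrightarrow>
     (\<forall>n. J n \<subseteq> free_space G n \<and> free_vs.subspace (J n)) \<and>
     (\<forall>m n i x y. 1 \<le> i \<longrightarrow> i \<le> m \<longrightarrow> x \<in> J m \<longrightarrow> y \<in> free_space G n \<longrightarrow>
        free_comp x i y \<in> J (m + n - 1)) \<and>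
     (\<forall>m n i x y. 1 \<le> i \<longrightarrow> i \<le> m \<longrightarrow> x \<in> free_space G m \<longrightarrow> y \<in> J n \<longrightarrow>
        free_comp x i y \<in> J (m + n - 1))"

definition generated_ideal ::
  "'x set \<Rightarrow> (nat \<Rightarrow> ('x tree \<Rightarrow>\<^sub>0 'a::field) set) \<Rightarrow> nat \<Rightarrow> ('x tree \<Rightarrow>\<^sub>0 'a) set" where
  "generated_ideal G R n = \<Inter> {J n | J. operad_ideal G J \<and> (\<forall>m. R m \<subseteq> J m)}"

text \<open>Trees with two internal nodes are those of arity 3.\<close>

definition quadratic :: "'x set \<Rightarrow> (nat \<Rightarrow> ('x tree \<Rightarrow>\<^sub>0 'a::field) set) \<Rightarrow> bool" where
  "quadratic G I \<longleftrightarrow> I = generated_ideal G (\<lambda>n. if n = 3 then I 3 else {})"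


section \<open>Nonsymmetric operads and quotients of the free operad\<close>

text \<open>
  \<open>pcomp P m n i p q\<close> is the partial composition of \<open>p\<close> in arity \<open>m\<close> and \<open>q\<close> in arity \<open>n\<close> at the
  \<open>i\<close>-th input of \<open>p\<close>, with \<open>1 \<le> i \<le> m\<close>. The vector space operations carry the arity because the
  homogeneous components of a quotient have different zero elements.
\<close>

record ('a, 'v) ns_operad =
  space :: "nat \<Rightarrow> 'v set"
  add :: "nat \<Rightarrow> 'v \<Rightarrow> 'v \<Rightarrow> 'v"
  scale :: "nat \<Rightarrow> 'a \<Rightarrow> 'v \<Rightarrow> 'v"
  pcomp :: "nat \<Rightarrow> nat \<Rightarrow> nat \<Rightarrow> 'v \<Rightarrow> 'v \<Rightarrow> 'v"
  unit :: 'v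

definition quotient_operad ::
  "'x set \<Rightarrow> (nat \<Rightarrow> ('x tree \<Rightarrow>\<^sub>0 'a::field) set) \<Rightarrow> ('a, ('x tree \<Rightarrow>\<^sub>0 'a) set) ns_operad" where
  "quotient_operad G I =
     \<lparr> space = (\<lambda>n. {{x + w | w. w \<in> I n} | x. x \<in> free_space G n}),
       add = (\<lambda>n A B. {x + y + w | x y w. x \<in> A \<and> y \<in> B \<and> w \<in> I n}),
       scale = (\<lambda>n c A. {smul c x + w | x w. x \<in> A \<and> w \<in> I n}),
       pcomp = (\<lambda>m n i A B. {free_comp x i y + w | x y w. x \<in> A \<and> y \<in> B \<and> w \<in> I (m + n - 1)}),
       unit = {basis_vec Leaf + w | w. w \<in> I 1} \<rparr>"


section \<open>The bar construction and Koszulness\<close>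

text \<open>
  Let \<open>P\<close> be an operad with \<open>P(0) = 0\<close> and \<open>P(1)\<close> spanned by the unit, so that its augmentation ideal
  is the sum of the \<open>P(n)\<close> for \<open>n \<ge> 2\<close>. The arity \<open>n\<close> part of the bar construction of \<open>P\<close> is the direct
  sum, over the planar rooted trees with \<open>n\<close> leaves in which every vertex has at least two children,
  of the tensor products of the \<open>P(m\<^sub>v)\<close>, where \<open>m\<^sub>v\<close> is the number of children of the vertex \<open>v\<close>.
  The tensor products are presented by generators and relations: the generators are the trees with
  vertices decorated by elements of \<open>P\<close>, and the relations express linearity in each decoration.
\<close>

datatype 'v dtree = DLeaf | DNode 'v "'v dtree list"

fun dleaves :: "'v dtree \<Rightarrow> nat" where
  "dleaves DLeaf = 1"
| "dleaves (DNode p ts) = sum_list (map dleaves ts)"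

fun dnodes :: "'v dtree \<Rightarrow> nat" where
  "dnodes DLeaf = 0"
| "dnodes (DNode p ts) = 1 + sum_list (map dnodes ts)"

fun bar_tree :: "('a, 'v) ns_operad \<Rightarrow> 'v dtree \<Rightarrow> bool" where
  "bar_tree P DLeaf \<longleftrightarrow> True"
| "bar_tree P (DNode p ts) \<longleftrightarrow>
     2 \<le> length ts \<and> p \<in> space P (length ts) \<and> (\<forall>t\<in>set ts. bar_tree P t)"

definition bar_gens :: "('a, 'v) ns_operad \<Rightarrow> nat \<Rightarrow> nat \<Rightarrow> ('v dtree \<Rightarrow>\<^sub>0 'a::field) set" where
  "bar_gens P n d = free_vs.span {basis_vec t | t. bar_tree P t \<and> dleaves t = n \<and> dnodes t = d}"

text \<open>
  \<open>decor_comb P c t u v\<close>: the trees \<open>t\<close>, \<open>u\<close>, \<open>v\<close> differ at one vertex only, where their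
  decorations are \<open>c \<cdot> p + q\<close>, \<open>p\<close> and \<open>q\<close> respectively.
\<close>

inductive decor_comb ::
  "('a, 'v) ns_operad \<Rightarrow> 'a \<Rightarrow> 'v dtree \<Rightarrow> 'v dtree \<Rightarrow> 'v dtree \<Rightarrow> bool" for P c where
  root: "p \<in> space P (length ts) \<Longrightarrow> q \<in> space P (length ts) \<Longrightarrow>
    decor_comb P c (DNode (add P (length ts) (scale P (length ts) c p) q) ts)
      (DNode p ts) (DNode q ts)"
| child: "decor_comb P c t u v \<Longrightarrow>
    decor_comb P c (DNode p (xs @ t # ys)) (DNode p (xs @ u # ys)) (DNode p (xs @ v # ys))"

definition bar_rels :: "('a, 'v) ns_operad \<Rightarrow> nat \<Rightarrow> nat \<Rightarrow> ('v dtree \<Rightarrow>\<^sub>0 'a::field) set" where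
  "bar_rels P n d = free_vs.span
     {basis_vec t - smul c (basis_vec u) - basis_vec v | c t u v.
        decor_comb P c t u v \<and> bar_tree P t \<and> bar_tree P u \<and> bar_tree P v \<and>
        dleaves t = n \<and> dnodes t = d}"

text \<open>
  The bar differential is the signed sum of the contractions of the internal edges, where the
  decorations at both ends of the contracted edge are composed. The vertices carry suspended
  elements, all of degree 1, tensored in preorder. If the lower end of the edge is the \<open>j\<close>-th vertex
  in preorder, counting from \<open>j = 0\<close> at the root, then the Koszul sign rule gives the sign \<open>(-1)^j\<close>
  (up to a global sign): moving this vertex next to its parent and moving the degree \<open>-1\<close>
  composition past the vertices before the parent.
\<close>

function bar_diff :: "('a, 'v) ns_operad \<Rightarrow> 'v dtree \<Rightarrow> ('v dtree \<Rightarrow>\<^sub>0 'a::field)" where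
  "bar_diff P DLeaf = 0"
| "bar_diff P (DNode p ts) =
     (\<Sum>i<length ts. smul ((-1) ^ (1 + sum_list (map dnodes (take i ts))))
        ((case ts ! i of
            DLeaf \<Rightarrow> 0
          | DNode q us \<Rightarrow>
              basis_vec (DNode (pcomp P (length ts) (length us) (i + 1) p q)
                (take i ts @ us @ drop (i + 1) ts)))
         + lin_ext (\<lambda>t. basis_vec (DNode p (ts[i := t]))) (bar_diff P (ts ! i))))"
  by pat_completeness auto
termination
  by (relation "measure (\<lambda>(P, t). size t)")
     (auto dest!: nth_mem intro: size_list_estimation' less_Suc_eq_le[THEN iffD2])

text \<open>
  For an operad whose weight grading is arity minus one, as for every quotient of a free operad on
  binary operations by a homogeneous ideal, Koszulness means that the homology of the bar
  construction is concentrated on the diagonal, where the number of vertices equals the weight.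
  Passing to the quotient by \<^const>\<open>bar_rels\<close>, a chain \<open>x\<close> is a cycle if its differential is a
  relation, and it is a boundary if it equals a differential up to a relation.
\<close>

definition connected_operad :: "('a::field, 'v) ns_operad \<Rightarrow> bool" where
  "connected_operad P \<longleftrightarrow>
     card (space P 0) = 1 \<and> bij_betw (\<lambda>c. scale P 1 c (unit P)) UNIV (space P 1)"

definition koszul :: "('a::field, 'v) ns_operad \<Rightarrow> bool" where
  "koszul P \<longleftrightarrow> connected_operad P \<and>
     (\<forall>n d. d + 1 \<noteq> n \<longrightarrow>
        (\<forall>x\<in>bar_gens P n d. lin_ext (bar_diff P) x \<in> bar_rels P n (d - 1) \<longrightarrow>
           (\<exists>y\<in>bar_gens P n (d + 1). x - lin_ext (bar_diff P) y \<in> bar_rels P n d)))"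


section \<open>Rewriting in the free operad\<close>

text \<open>
  A rule \<open>(s, x)\<close> replaces the tree \<open>s\<close> by the linear combination \<open>x\<close>. The rules apply inside larger
  trees, so their instances are closed under partial composition with trees on both sides.
\<close>

type_synonym ('x, 'a) rules = "('x tree \<times> ('x tree \<Rightarrow>\<^sub>0 'a)) set"

inductive rule_instance ::
  "'x set \<Rightarrow> ('x, 'a) rules \<Rightarrow> 'x tree \<Rightarrow> ('x tree \<Rightarrow>\<^sub>0 'a::field) \<Rightarrow> bool" for G R where
  rule: "(s, x) \<in> R \<Longrightarrow> rule_instance G R s x"
| above: "rule_instance G R t z \<Longrightarrow> u \<in> syntax_trees G m \<Longrightarrow> 1 \<le> i \<Longrightarrow> i \<le> size1 t \<Longrightarrow>
    rule_instance G R (graft t i u) (free_comp z i (basis_vec u))"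
| below: "rule_instance G R t z \<Longrightarrow> u \<in> syntax_trees G m \<Longrightarrow> 1 \<le> i \<Longrightarrow> i \<le> m \<Longrightarrow>
    rule_instance G R (graft u i t) (free_comp (basis_vec u) i z)"

inductive rewrite_step ::
  "'x set \<Rightarrow> ('x, 'a) rules \<Rightarrow> ('x tree \<Rightarrow>\<^sub>0 'a::field) \<Rightarrow> ('x tree \<Rightarrow>\<^sub>0 'a) \<Rightarrow> bool" for G R where
  "x \<in> free_space G n \<Longrightarrow> t \<in> Poly_Mapping.keys x \<Longrightarrow> rule_instance G R t z \<Longrightarrow>
    rewrite_step G R x (x + smul (Poly_Mapping.lookup x t) (z - basis_vec t))"

definition convergent_rules :: "'x set \<Rightarrow> ('x, 'a::field) rules \<Rightarrow> bool" where
  "convergent_rules G R \<longleftrightarrow> wfp (rewrite_step G R)\<inverse>\<inverse> \<and> confluentp (rewrite_step G R)"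

text \<open>The rules are quadratic and orient the arity 3 relations in \<open>I\<close>.\<close>

definition orients_quadratic_relations ::
  "'x set \<Rightarrow> (nat \<Rightarrow> ('x tree \<Rightarrow>\<^sub>0 'a::field) set) \<Rightarrow> ('x, 'a) rules \<Rightarrow> bool" where
  "orients_quadratic_relations G I R \<longleftrightarrow>
     R \<subseteq> syntax_trees G 3 \<times> free_space G 3 \<and>
     free_vs.span {basis_vec s - x | s x. (s, x) \<in> R} = I 3"

definition normal_form_trees :: "'x set \<Rightarrow> ('x, 'a::field) rules \<Rightarrow> 'x tree set" where
  "normal_form_trees G R = {t. set_tree t \<subseteq> G \<and> \<not> (\<exists>y. rewrite_step G R (basis_vec t) y)}"


section \<open>Signaletic operads\<close>

datatype letter = Prec | Succ

definition signals :: "nat \<Rightarrow> letter list set" where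
  "signals k = {w. length w = k}"

datatype circulation = Parallel | Series

datatype flavour = Messy | Tidy

text \<open>Parallel rule. The car \<open>c\<^sub>j\<close> is represented by the index \<open>j - 1\<close> of the letters it reads.\<close>

fun parallel_leaf :: "nat \<Rightarrow> letter list tree \<Rightarrow> nat" where
  "parallel_leaf j Leaf = 1"
| "parallel_leaf j (Node l w r) =
     (case w ! j of Prec \<Rightarrow> parallel_leaf j l | Succ \<Rightarrow> size1 l + parallel_leaf j r)"

text \<open>Here \<open>J\<close> is the set of cars entering the tree at its root.\<close>

fun parallel_tidy :: "nat set \<Rightarrow> letter list tree \<Rightarrow> bool" where
  "parallel_tidy J Leaf \<longleftrightarrow> True"
| "parallel_tidy J (Node l w r) \<longleftrightarrow>
     (\<forall>j<length w. j \<notin> J \<longrightarrow> w ! j = Prec) \<and>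
     parallel_tidy {j \<in> J. w ! j = Prec} l \<and> parallel_tidy {j \<in> J. w ! j = Succ} r"

text \<open>
  Series rule. \<open>drive t\<close> is the leaf reached by one car in the tree \<open>t\<close> together with the tree of
  letters not yet erased afterwards. The case of an empty label does not occur for at most \<open>k\<close> cars
  in a tree with labels of length \<open>k\<close>.
\<close>

fun drive :: "letter list tree \<Rightarrow> nat \<times> letter list tree" where
  "drive Leaf = (1, Leaf)"
| "drive (Node l w r) =
     (case w of
        [] \<Rightarrow> (1, Node l w r)
      | Prec # w' \<Rightarrow> (let (i, l') = drive l in (i, Node l' w' r))
      | Succ # w' \<Rightarrow> (let (i, r') = drive r in (size1 l + i, Node l w' r')))"

fun drive_all :: "nat \<Rightarrow> letter list tree \<Rightarrow> nat list \<times> letter list tree" where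
  "drive_all 0 t = ([], t)"
| "drive_all (Suc c) t =
     (let (i, t') = drive t; (is, t'') = drive_all c t' in (i # is, t''))"

fun destination :: "circulation \<Rightarrow> nat \<Rightarrow> letter list tree \<Rightarrow> nat list" where
  "destination Parallel k t = map (\<lambda>j. parallel_leaf j t) [0..<k]"
| "destination Series k t = fst (drive_all k t)"

text \<open>In series, the unused letters are those left in the tree after all cars have passed.\<close>

fun tidy :: "circulation \<Rightarrow> nat \<Rightarrow> letter list tree \<Rightarrow> bool" where
  "tidy Parallel k t \<longleftrightarrow> parallel_tidy {0..<k} t"
| "tidy Series k t \<longleftrightarrow> (\<forall>w\<in>set_tree (snd (drive_all k t)). set w \<subseteq> {Prec})"

fun signaletic_relations ::
  "flavour \<Rightarrow> circulation \<Rightarrow> nat \<Rightarrow> nat \<Rightarrow> (letter list tree \<Rightarrow>\<^sub>0 'a::field) set" where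
  "signaletic_relations Messy \<rho> k n = free_vs.span
     {basis_vec s - basis_vec t | s t.
        s \<in> syntax_trees (signals k) n \<and> t \<in> syntax_trees (signals k) n \<and>
        destination \<rho> k s = destination \<rho> k t}"
| "signaletic_relations Tidy \<rho> k n = free_vs.span
     ({basis_vec s - basis_vec t | s t.
        s \<in> syntax_trees (signals k) n \<and> t \<in> syntax_trees (signals k) n \<and>
        tidy \<rho> k s \<and> tidy \<rho> k t \<and> destination \<rho> k s = destination \<rho> k t} \<union>
      {basis_vec s | s. s \<in> syntax_trees (signals k) n \<and> \<not> tidy \<rho> k s})"

definition signaletic_operad ::
  "flavour \<Rightarrow> circulation \<Rightarrow> nat \<Rightarrow> ('a::field, (letter list tree \<Rightarrow>\<^sub>0 'a) set) ns_operad" where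
  "signaletic_operad \<phi> \<rho> k = quotient_operad (signals k) (signaletic_relations \<phi> \<rho> k)"

fun right_comb :: "'x tree \<Rightarrow> bool" where
  "right_comb Leaf \<longleftrightarrow> True"
| "right_comb (Node l w r) \<longleftrightarrow> l = Leaf \<and> right_comb r"

definition right_signaletic_combs :: "circulation \<Rightarrow> nat \<Rightarrow> letter list tree set" where
  "right_signaletic_combs \<rho> k = {t. set_tree t \<subseteq> signals k \<and> right_comb t \<and> tidy \<rho> k t}"

end

theory Submission
  imports Defs "HOL-Library.Multiset"
begin

text \<open>
  A destination vector in arity \<open>n\<close> is realized by exactly one tidy right comb of arity \<open>n\<close>, and the
  destination vector and the tidiness of a composite depend only on those of its factors. Hence every
  tree is equal to a right comb or to zero modulo the relations. Rewriting the trees of arity 3 to this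
  normal form moves weight to the right or turns letters \<^const>\<open>Succ\<close> into \<^const>\<open>Prec\<close>, so it terminates;
  it preserves the normal form of a tree, so it is confluent.

  For Koszulness, expand the decorations of the bar construction in the basis of tidy right combs. A
  chain is then a binary tree together with a set of right edges that are internal to the combs, and
  every set of edges between locally tidy pairs of nodes occurs. Up to lower trees, the bar differential
  adds an edge to this set, so each tree with at least one such edge contributes an acyclic cube, and
  the trees without such edges lie on the diagonal.
\<close>

section \<open>Linear maps prescribed on a basis of finitely supported functions\<close>

section \<open>Linear extension\<close>

text \<open>The obstacle to Koszulness is that two normal combs, composed at the last leaf of the
  upper one, need not form a normal comb: reduction may remove letters \<open>Succ\<close>, or give
  zero in the tidy case. So the differential adds an edge to a comb only up to correction terms,
  which an order has to absorb. \<open>tree_less\<close> compares first the left edges, counted with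
  the leaves below them, and then the number of letters \<open>Succ\<close>; it serves both the
  termination of rewriting and the iteration of the homotopy. The four operads enter the argument
  only through the locale \<open>comb_normal_form\<close>. It assumes that either factor of a
  composite may be reduced first, that normality of a comb is a condition on neighbouring labels,
  and that reducing a comb that is not normal lowers its label weight. Locality is what lets every
  set of normal edges occur, so that the complex belonging to one tree is a cube.\<close>

lemma smul_uminus_one [simp]: "smul (- 1) x = - x"
  by (simp add: free_vs.scale_minus_left)

lemma smul_single [simp]: "smul c (Poly_Mapping.single b d) = Poly_Mapping.single b (c * d)"
  by (auto intro!: poly_mapping_eqI simp: lookup_single when_def)

lemma keys_smul: "Poly_Mapping.keys (smul c x) \<subseteq> Poly_Mapping.keys x"
  by (auto simp: in_keys_iff)

lemma keys_smul_eq: "Poly_Mapping.keys (smul c x) = (if c = 0 then {} else Poly_Mapping.keys x)"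
  by (auto simp: in_keys_iff)

lemma keys_diff_subset: "Poly_Mapping.keys (x - y) \<subseteq> Poly_Mapping.keys x \<union> Poly_Mapping.keys y"
  by (auto simp: in_keys_iff lookup_minus)

lemma lin_ext_superset:
  assumes "finite A" "Poly_Mapping.keys x \<subseteq> A"
  shows "lin_ext f x = (\<Sum>b\<in>A. smul (Poly_Mapping.lookup x b) (f b))"
  unfolding lin_ext_def
  by (rule sum.mono_neutral_left) (use assms in \<open>auto simp: in_keys_iff\<close>)

lemma lin_ext_zero [simp]: "lin_ext f 0 = 0"
  by (simp add: lin_ext_def)

lemma lin_ext_single: "lin_ext f (Poly_Mapping.single b c) = smul c (f b)"
  by (cases "c = 0") (simp_all add: lin_ext_def)

lemma lin_ext_basis_vec [simp]: "lin_ext f (basis_vec b) = f b"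
  by (simp add: lin_ext_single)

lemma lin_ext_add: "lin_ext f (x + y) = lin_ext f x + lin_ext f y"
proof -
  let ?A = "Poly_Mapping.keys x \<union> Poly_Mapping.keys y"
  have "Poly_Mapping.keys (x + y) \<subseteq> ?A"
    by (rule keys_add)
  then show ?thesis
    by (simp add: lin_ext_superset[of ?A] lookup_add free_vs.scale_left_distrib sum.distrib)
qed

lemma lin_ext_smul: "lin_ext f (smul c x) = smul c (lin_ext f x)"
  using keys_smul[of c x]
  by (simp add: lin_ext_superset[of "Poly_Mapping.keys x"] free_vs.scale_sum_right)

lemma lin_ext_uminus: "lin_ext f (- x) = - lin_ext f x"
  using lin_ext_smul[of f "-1" x] by simp

lemma lin_ext_diff: "lin_ext f (x - y) = lin_ext f x - lin_ext f y"
  using lin_ext_add[of f x "- y"] by (simp add: lin_ext_uminus)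

lemma lin_ext_sum: "lin_ext f (\<Sum>i\<in>A. x i) = (\<Sum>i\<in>A. lin_ext f (x i))"
  by (induction A rule: infinite_finite_induct) (simp_all add: lin_ext_add)

lemma lin_ext_cong:
  assumes "\<And>b. b \<in> Poly_Mapping.keys x \<Longrightarrow> f b = g b"
  shows "lin_ext f x = lin_ext g x"
  using assms by (simp add: lin_ext_def)

lemma lin_ext_fun_zero [simp]: "lin_ext (\<lambda>b. 0) x = 0"
  by (simp add: lin_ext_def)

lemma lin_ext_fun_add: "lin_ext (\<lambda>b. f b + g b) x = lin_ext f x + lin_ext g x"
  by (simp add: lin_ext_def free_vs.scale_right_distrib sum.distrib)

lemma lin_ext_fun_smul: "lin_ext (\<lambda>b. smul c (f b)) x = smul c (lin_ext f x)"
  by (simp add: lin_ext_def free_vs.scale_sum_right mult.commute)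

lemma lin_ext_fun_uminus: "lin_ext (\<lambda>b. - f b) x = - lin_ext f x"
  using lin_ext_fun_smul[of "-1" f x] by simp

lemma lin_ext_fun_diff: "lin_ext (\<lambda>b. f b - g b) x = lin_ext f x - lin_ext g x"
  using lin_ext_fun_add[of f "\<lambda>b. - g b" x] by (simp add: lin_ext_fun_uminus)

lemma lin_ext_fun_sum: "lin_ext (\<lambda>b. \<Sum>i\<in>A. f i b) x = (\<Sum>i\<in>A. lin_ext (f i) x)"
  by (induction A rule: infinite_finite_induct) (simp_all add: lin_ext_fun_add)

lemma lin_ext_lin_ext: "lin_ext f (lin_ext g x) = lin_ext (\<lambda>b. lin_ext f (g b)) x"
  unfolding lin_ext_def[of g x] lin_ext_def[of "\<lambda>b. lin_ext f (g b)" x]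
  by (simp add: lin_ext_sum lin_ext_smul)

text \<open>Exchange of two finite sums. Multilinear expansions over several vertices of a tree are
  reordered with it.\<close>

lemma lin_ext_swap:
  "lin_ext (\<lambda>a. lin_ext (\<lambda>b. f a b) y) x = lin_ext (\<lambda>b. lin_ext (\<lambda>a. f a b) x) y"
  unfolding lin_ext_def
  by (simp add: free_vs.scale_sum_right mult.commute) (rule sum.swap)

lemma lin_ext_id [simp]: "lin_ext basis_vec x = x"
  by (rule poly_mapping_eqI)
    (auto simp: lin_ext_def lookup_sum lookup_single when_def in_keys_iff if_distrib
      cong: if_cong)

lemma keys_lin_ext: "Poly_Mapping.keys (lin_ext f x) \<subseteq> (\<Union>b\<in>Poly_Mapping.keys x. Poly_Mapping.keys (f b))"
proof -
  have "Poly_Mapping.keys (lin_ext f x) \<subseteq>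
      (\<Union>b\<in>Poly_Mapping.keys x. Poly_Mapping.keys (smul (Poly_Mapping.lookup x b) (f b)))"
    unfolding lin_ext_def by (rule keys_sum)
  also have "\<dots> \<subseteq> (\<Union>b\<in>Poly_Mapping.keys x. Poly_Mapping.keys (f b))"
    by (intro UN_mono keys_smul order_refl)
  finally show ?thesis .
qed

lemma in_keys_lin_extE:
  assumes "c \<in> Poly_Mapping.keys (lin_ext f x)"
  obtains b where "b \<in> Poly_Mapping.keys x" "c \<in> Poly_Mapping.keys (f b)"
  using keys_lin_ext[of f x] assms by blast

lemma lin_ext_in_subspace:
  assumes "free_vs.subspace S" "\<And>b. b \<in> Poly_Mapping.keys x \<Longrightarrow> f b \<in> S"
  shows "lin_ext f x \<in> S"
  unfolding lin_ext_def
  using assms by (intro free_vs.subspace_sum free_vs.subspace_scale) auto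

lemma lin_ext_span_in_subspace:
  assumes "x \<in> free_vs.span B" "free_vs.subspace S" "\<And>b. b \<in> B \<Longrightarrow> lin_ext f b \<in> S"
  shows "lin_ext f x \<in> S"
  using assms(1)
proof (induction rule: free_vs.span_induct)
  case base
  have "free_vs.subspace {x. lin_ext f x \<in> S}"
    using assms(2) by (auto simp: free_vs.subspace_def lin_ext_add lin_ext_smul)
  then show ?case by simp
next
  case (step x)
  then show ?case using assms(3) by blast
qed

lemma lin_ext_span_zero:
  assumes "x \<in> free_vs.span B" "\<And>b. b \<in> B \<Longrightarrow> lin_ext f b = 0"
  shows "lin_ext f x = 0"
  using lin_ext_span_in_subspace[of x B "{0}" f] assms free_vs.subspace_single_0 by auto

lemma subspace_keys_subset: "free_vs.subspace {x. Poly_Mapping.keys x \<subseteq> A}"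
  unfolding free_vs.subspace_def
  by (auto dest: subsetD[OF keys_add] subsetD[OF keys_smul])

lemma span_basis_vecs:
  fixes A :: "'b set"
  defines "S \<equiv> {x :: 'b \<Rightarrow>\<^sub>0 'a::field. Poly_Mapping.keys x \<subseteq> A}"
  shows "free_vs.span (basis_vec ` A) = S"
proof
  show "free_vs.span (basis_vec ` A) \<subseteq> S"
    unfolding S_def by (rule free_vs.span_minimal) (auto simp: subspace_keys_subset)
  show "S \<subseteq> free_vs.span (basis_vec ` A)"
  proof
    fix x assume "x \<in> S"
    then have "lin_ext basis_vec x \<in> free_vs.span (basis_vec ` A)"
      by (intro lin_ext_in_subspace) (auto simp: S_def intro: free_vs.span_base)
    then show "x \<in> free_vs.span (basis_vec ` A)" by simp
  qed
qed

text \<open>Normal forms and compositions of basis elements are again basis elements or zero. They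
  take values in \<open>option\<close>, with \<open>None\<close> for zero and
  \<open>Option.bind\<close> for composition; \<open>opt_vec\<close> returns to linear
  algebra.\<close>

definition opt_vec :: "'b option \<Rightarrow> 'b \<Rightarrow>\<^sub>0 'a::field" where
  "opt_vec b = (case b of None \<Rightarrow> 0 | Some b \<Rightarrow> basis_vec b)"

lemma opt_vec_simps [simp]: "opt_vec None = 0" "opt_vec (Some b) = basis_vec b"
  by (simp_all add: opt_vec_def)

lemma keys_opt_vec [simp]: "Poly_Mapping.keys (opt_vec b :: _ \<Rightarrow>\<^sub>0 'a::field) = set_option b"
  by (cases b) auto

lemma lin_ext_opt_vec_bind:
  "lin_ext (\<lambda>b. opt_vec (f b)) (opt_vec b) = opt_vec (Option.bind b f)"
  by (cases b) auto


section \<open>Grafting of syntax trees, and right combs as words of labels\<close>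

section \<open>Syntax trees\<close>

lemma size_graft [simp]: "size (graft s i t) = size s + size t"
  by (induction s arbitrary: i) auto

lemma size1_graft: "size1 (graft s i t) = size1 s + size1 t - 1"
  by (simp add: size1_size)

lemma set_tree_graft [simp]: "set_tree (graft s i t) = set_tree s \<union> set_tree t"
  by (induction s arbitrary: i) auto

text \<open>Sequential associativity: in \<open>graft s i t\<close> the \<open>j\<close>-th leaf of
  \<open>t\<close> has \<open>i - 1\<close> leaves of \<open>s\<close> before it, whence the number
  \<open>i + j - 1\<close>.\<close>

lemma graft_graft_sequential:
  assumes "1 \<le> i" "i \<le> size1 s" "1 \<le> j" "j \<le> size1 t"
  shows "graft (graft s i t) (i + j - 1) u = graft s i (graft t j u)"
  using assms
proof (induction s arbitrary: i)
  case (Node l w r)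
  have size_t: "size1 t \<ge> 1" by (simp add: size1_size)
  show ?case
  proof (cases "i \<le> size1 l")
    case True
    then have "i + j - 1 \<le> size1 (graft l i t)"
      using Node.prems unfolding size1_graft by linarith
    then show ?thesis using True Node by simp
  next
    case False
    then have "graft (graft r (i - size1 l) t) (i - size1 l + j - 1) u = graft r (i - size1 l) (graft t j u)"
      using Node.prems by (intro Node.IH) auto
    moreover have "i - size1 l + j - 1 = i + j - 1 - size1 l" "\<not> i + j - 1 \<le> size1 l"
      using False Node.prems by auto
    ultimately show ?thesis using False by simp
  qed
qed simp

text \<open>Parallel associativity: a leaf of \<open>s\<close> to the right of leaf \<open>i\<close>
  moves by \<open>size1 t - 1\<close> when \<open>t\<close> replaces that leaf.\<close>

lemma graft_graft_parallel:
  assumes "1 \<le> i" "i < j" "j \<le> size1 s"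
  shows "graft (graft s i t) (j + size1 t - 1) u = graft (graft s j u) i t"
  using assms
proof (induction s arbitrary: i j)
  case (Node l w r)
  have size_t: "size1 t \<ge> 1" by (simp add: size1_size)
  consider "j \<le> size1 l" | "i \<le> size1 l" "size1 l < j" | "size1 l < i" by linarith
  then show ?case
  proof cases
    case 3
    then have "graft (graft r (i - size1 l) t) (j - size1 l + size1 t - 1) u =
        graft (graft r (j - size1 l) u) (i - size1 l) t"
      using Node.prems by (intro Node.IH) auto
    then show ?thesis using 3 Node.prems by auto
  qed (use Node.prems Node.IH size_t in \<open>auto simp: size1_graft\<close>)
qed simp

lemma in_syntax_trees_iff: "t \<in> syntax_trees G n \<longleftrightarrow> set_tree t \<subseteq> G \<and> size1 t = n"
  by (simp add: syntax_trees_def)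

fun comb :: "'x list \<Rightarrow> 'x tree" where
  "comb [] = Leaf"
| "comb (w # ws) = Node Leaf w (comb ws)"

lemma set_tree_comb [simp]: "set_tree (comb ws) = set ws"
  by (induction ws) auto

lemma size_comb [simp]: "size (comb ws) = length ws"
  by (induction ws) auto

lemma size1_comb [simp]: "size1 (comb ws) = length ws + 1"
  by (simp add: size1_size)

lemma comb_eq_iff [simp]: "comb ws = comb vs \<longleftrightarrow> ws = vs"
proof (induction ws arbitrary: vs)
  case Nil
  then show ?case by (cases vs) auto
next
  case (Cons w ws)
  then show ?case by (cases vs) auto
qed

lemma right_comb_iff: "right_comb t \<longleftrightarrow> (\<exists>ws. t = comb ws)"
proof
  show "right_comb t \<Longrightarrow> \<exists>ws. t = comb ws"
  proof (induction t)
    case Leaf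
    then show ?case by (metis comb.simps(1))
  next
    case (Node l w r)
    then show ?case by (metis comb.simps(2) right_comb.simps(2))
  qed
  have "right_comb (comb ws)" for ws :: "'a list"
    by (induction ws) auto
  then show "\<exists>ws. t = comb ws \<Longrightarrow> right_comb t" by blast
qed

lemma graft_comb_comb: "graft (comb ws) (length ws + 1) (comb vs) = comb (ws @ vs)"
  by (induction ws) auto

lemma arity_3_cases:
  assumes "size1 s = 3"
  shows "(\<exists>a b. s = comb [a, b]) \<or> (\<exists>a b. s = Node (Node Leaf a Leaf) b Leaf)"
proof -
  obtain l w r where s: "s = Node l w r" "size l + size r = 1"
    using assms by (cases s) (auto simp: size1_size)
  then consider "l = Leaf" "size r = 1" | "size l = 1" "r = Leaf"
    by (cases "size l") auto
  then show ?thesis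
  proof cases
    case 1
    then obtain v where "r = Node Leaf v Leaf" by (cases r) auto
    then show ?thesis using s 1 by auto
  next
    case 2
    then obtain v where "l = Node Leaf v Leaf" by (cases l) auto
    then show ?thesis using s 2 by auto
  qed
qed

section \<open>The termination order, built from left depths of leaves and weights of labels\<close>

fun left_depths :: "'x tree \<Rightarrow> nat list" where
  "left_depths Leaf = [0]"
| "left_depths (Node l w r) = map Suc (left_depths l) @ left_depths r"

lemma length_left_depths [simp]: "length (left_depths t) = size1 t"
  by (induction t) auto

text \<open>The sum of the entries of \<open>left_depths\<close>: each left edge counts once for
  every leaf below it. It is at least the number of internal nodes, with equality exactly for right
  combs.\<close>

fun left_weight :: "'x tree \<Rightarrow> nat" where
  "left_weight Leaf = 0"
| "left_weight (Node l w r) = left_weight l + left_weight r + size1 l"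

lemma left_weight_comb [simp]: "left_weight (comb ws) = length ws"
  by (induction ws) auto

lemma size_le_left_weight: "size t \<le> left_weight t"
  by (induction t) (auto simp: size1_size)

lemma right_comb_left_weight: "left_weight t \<le> size t \<Longrightarrow> right_comb t"
proof (induction t)
  case (Node l w r)
  have "left_weight l + left_weight r \<le> size r"
    using Node.prems by (simp add: size1_size)
  then have "size l = 0" "left_weight r \<le> size r"
    using size_le_left_weight[of l] size_le_left_weight[of r] by linarith+
  with Node.IH show ?case by auto
qed simp

lemma left_depths_graft:
  assumes "1 \<le> i" "i \<le> size1 s"
  shows "left_depths (graft s i t) = take (i - 1) (left_depths s) @
    map ((+) (left_depths s ! (i - 1))) (left_depths t) @ drop i (left_depths s)"
  using assms
proof (induction s arbitrary: i)
  case Leaf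
  then show ?case by (simp add: map_idI)
next
  case (Node l w r)
  show ?case
  proof (cases "i \<le> size1 l")
    case True
    then have "i - 1 < size1 l" using Node.prems by simp
    then show ?thesis
      using True Node by (simp add: nth_append take_map drop_map o_def)
  next
    case False
    then have "left_depths (graft r (i - size1 l) t) =
        take (i - size1 l - 1) (left_depths r) @
        map ((+) (left_depths r ! (i - size1 l - 1))) (left_depths t) @ drop (i - size1 l) (left_depths r)"
      using Node.prems by (intro Node.IH) auto
    moreover have "\<not> i - 1 < size1 l" "i - 1 - size1 l = i - size1 l - 1" using False by auto
    ultimately show ?thesis
      using False by (simp add: nth_append)
  qed
qed

text \<open>All \<open>size1 t\<close> leaves of \<open>t\<close> inherit the depth of leaf
  \<open>i\<close>, which \<open>left_weight s\<close> counts once already; this leaves the factor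
  \<open>size t\<close>.\<close>

lemma left_weight_graft:
  assumes "1 \<le> i" "i \<le> size1 s"
  shows "left_weight (graft s i t) = left_weight s + left_weight t + left_depths s ! (i - 1) * size t"
  using assms
proof (induction s arbitrary: i)
  case (Node l w r)
  show ?case
  proof (cases "i \<le> size1 l")
    case True
    then have "i - 1 < size1 l" using Node.prems by simp
    then show ?thesis
      using True Node by (simp add: nth_append size1_size)
  next
    case False
    then have "left_weight (graft r (i - size1 l) t) =
        left_weight r + left_weight t + left_depths r ! (i - size1 l - 1) * size t"
      using Node.prems by (intro Node.IH) auto
    moreover have "\<not> i - 1 < size1 l" "i - 1 - size1 l = i - size1 l - 1" using False by auto
    ultimately show ?thesis
      using False by (simp add: nth_append)
  qed
qed simp

lemma left_depths_graft_mono: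
  assumes "list_all2 (\<le>) (left_depths s) (left_depths s')" "list_all2 (\<le>) (left_depths t) (left_depths t')"
    "1 \<le> i" "i \<le> size1 s'"
  shows "list_all2 (\<le>) (left_depths (graft s i t)) (left_depths (graft s' i t'))"
proof -
  have len: "size1 s = size1 s'" using list_all2_lengthD[OF assms(1)] by simp
  have "left_depths s ! (i - 1) \<le> left_depths s' ! (i - 1)"
    using assms(1,3,4) len by (auto simp: list_all2_conv_all_nth)
  moreover have "list_all2 (\<le>) (map ((+) a) (left_depths t)) (map ((+) b) (left_depths t'))"
    if "a \<le> b" for a b
    using assms(2) that by (auto simp: list_all2_conv_all_nth intro: add_mono)
  ultimately show ?thesis
    unfolding left_depths_graft[OF assms(3,4)] left_depths_graft[OF assms(3) assms(4)[folded len]]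
    using assms(1) by (auto intro!: list_all2_appendI list_all2_takeI list_all2_dropI)
qed

fun label_weight :: "('x \<Rightarrow> nat) \<Rightarrow> 'x tree \<Rightarrow> nat" where
  "label_weight f Leaf = 0"
| "label_weight f (Node l w r) = label_weight f l + f w + label_weight f r"

lemma label_weight_graft [simp]:
  "label_weight f (graft s i t) = label_weight f s + label_weight f t"
  by (induction s arbitrary: i) auto

lemma label_weight_comb [simp]: "label_weight f (comb ws) = sum_list (map f ws)"
  by (induction ws) auto

text \<open>Equality of sizes belongs to the order because what a subtree contributes to the left
  weight of a larger tree depends on its number of leaves, too; see
  \<open>tree_less_grow\<close>.\<close>

definition tree_less :: "('x \<Rightarrow> nat) \<Rightarrow> 'x tree \<Rightarrow> 'x tree \<Rightarrow> bool" where
  "tree_less f s t \<longleftrightarrow> size s = size t \<and>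
     (left_weight s < left_weight t \<or>
      left_weight s = left_weight t \<and> label_weight f s < label_weight f t)"

lemma wfp_tree_less: "wfp (tree_less f)"
proof -
  have "{(s, t). tree_less f s t} \<subseteq>
      inv_image (less_than <*lex*> less_than) (\<lambda>t. (left_weight t, label_weight f t))"
    by (auto simp: tree_less_def)
  then show ?thesis
    unfolding wfp_def by (rule wf_subset[rotated]) (intro wf_inv_image wf_lex_prod wf_less_than)
qed

lemma tree_less_irrefl [simp]: "\<not> tree_less f t t"
  by (simp add: tree_less_def)

lemma tree_less_trans: "tree_less f s t \<Longrightarrow> tree_less f t u \<Longrightarrow> tree_less f s u"
  by (auto simp: tree_less_def)

lemma tree_less_graft_left:
  assumes "list_all2 (\<le>) (left_depths s) (left_depths s')" "tree_less f s s'" "1 \<le> i" "i \<le> size1 s'"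
  shows "tree_less f (graft s i t) (graft s' i t)"
proof -
  have len: "size1 s = size1 s'" using list_all2_lengthD[OF assms(1)] by simp
  have "left_depths s ! (i - 1) \<le> left_depths s' ! (i - 1)"
    using assms(1,3,4) len by (auto simp: list_all2_conv_all_nth)
  then have "left_depths s ! (i - 1) * size t \<le> left_depths s' ! (i - 1) * size t"
    by (rule mult_le_mono1)
  then have "left_weight (graft s i t) < left_weight (graft s' i t) \<or>
      left_weight (graft s i t) = left_weight (graft s' i t) \<and> label_weight f s < label_weight f s'"
    using assms(2) unfolding tree_less_def left_weight_graft[OF assms(3,4)]
      left_weight_graft[OF assms(3) assms(4)[folded len]] by linarith
  then show ?thesis
    using assms(2) by (simp add: tree_less_def)
qed

lemma tree_less_graft_right:
  assumes "tree_less f t t'" "1 \<le> i" "i \<le> size1 s"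
  shows "tree_less f (graft s i t) (graft s i t')"
  using assms by (auto simp: tree_less_def left_weight_graft)


section \<open>Composition in the free operad\<close>

lemma free_comp_basis [simp]: "free_comp (basis_vec s) i (basis_vec t) = basis_vec (graft s i t)"
  by (simp add: free_comp_def)

lemma free_comp_diff_left: "free_comp (x - y) i z = free_comp x i z - free_comp y i z"
  by (simp add: free_comp_def lin_ext_diff)

lemma free_comp_diff_right: "free_comp z i (x - y) = free_comp z i x - free_comp z i y"
  by (simp add: free_comp_def lin_ext_diff lin_ext_fun_diff)

lemma free_comp_opt_vec_left:
  "free_comp (opt_vec a) i (basis_vec u) = opt_vec (map_option (\<lambda>t. graft t i u) a)"
  by (cases a) (simp_all add: free_comp_def)

lemma free_comp_opt_vec_right:
  "free_comp (basis_vec u) i (opt_vec a) = opt_vec (map_option (graft u i) a)"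
  by (cases a) (simp_all add: free_comp_def)

lemma free_space_iff: "x \<in> free_space G n \<longleftrightarrow> (\<forall>t\<in>Poly_Mapping.keys x. set_tree t \<subseteq> G \<and> size1 t = n)"
  by (auto simp: free_space_def syntax_trees_def)

lemma subspace_free_space: "free_vs.subspace (free_space G n)"
  unfolding free_space_def by (rule subspace_keys_subset)

lemma basis_vec_in_free_space [simp]: "basis_vec t \<in> free_space G n \<longleftrightarrow> set_tree t \<subseteq> G \<and> size1 t = n"
  by (simp add: free_space_iff)

lemma free_comp_in_free_space:
  assumes "x \<in> free_space G m" "y \<in> free_space G n"
  shows "free_comp x i y \<in> free_space G (m + n - 1)"
  unfolding free_comp_def
  by (intro lin_ext_in_subspace subspace_free_space)
    (use assms in \<open>auto simp: free_space_iff size1_graft\<close>)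


section \<open>The quotient of the free operad by the kernel of a normal form map\<close>

section \<open>Operads with a normal form by right combs\<close>

text \<open>
  \<open>nfl\<close> maps a tree to the list of labels of the right comb equal to it modulo the relations, and to
  \<^const>\<open>None\<close> if the tree is zero modulo the relations.
\<close>

locale comb_normal_form =
  fixes G :: "'x set" and nfl :: "'x tree \<Rightarrow> 'x list option" and wt :: "'x \<Rightarrow> nat"
  assumes nfl_SomeD: "set_tree s \<subseteq> G \<Longrightarrow> nfl s = Some ws \<Longrightarrow>
      set ws \<subseteq> G \<and> length ws = size s \<and> nfl (comb ws) = Some ws"
    and nfl_comb_local: "set ws \<subseteq> G \<Longrightarrow>
      nfl (comb ws) = Some ws \<longleftrightarrow> successively (\<lambda>v w. nfl (comb [v, w]) = Some [v, w]) ws"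
    and nfl_graft_left: "set_tree s \<subseteq> G \<Longrightarrow> set_tree t \<subseteq> G \<Longrightarrow> 1 \<le> i \<Longrightarrow> i \<le> size1 s \<Longrightarrow>
      nfl (graft s i t) = Option.bind (nfl s) (\<lambda>ws. nfl (graft (comb ws) i t))"
    and nfl_graft_right: "set_tree s \<subseteq> G \<Longrightarrow> set_tree t \<subseteq> G \<Longrightarrow> 1 \<le> i \<Longrightarrow> i \<le> size1 s \<Longrightarrow>
      nfl (graft s i t) = Option.bind (nfl t) (\<lambda>ws. nfl (graft s i (comb ws)))"
    and nfl_comb_wt: "set ws \<subseteq> G \<Longrightarrow> nfl (comb ws) = Some vs \<Longrightarrow>
      vs = ws \<or> sum_list (map wt vs) < sum_list (map wt ws)"
begin

text \<open>By \<open>nfl_comb_local\<close> these pairs decide which combs are normal. They mark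
  the edges at which the homotopy will split combs.\<close>

definition normal_pair :: "'x \<Rightarrow> 'x \<Rightarrow> bool" where
  "normal_pair v w \<longleftrightarrow> nfl (comb [v, w]) = Some [v, w]"

lemma nfl_comb_iff: "set ws \<subseteq> G \<Longrightarrow> nfl (comb ws) = Some ws \<longleftrightarrow> successively normal_pair ws"
  using nfl_comb_local unfolding normal_pair_def .

text \<open>A tree that is not a right comb has more left weight than its normal form, a comb of the
  same size. For a comb the left weight stays, and the labels decide by
  \<open>nfl_comb_wt\<close>.\<close>

lemma nfl_less:
  assumes "set_tree s \<subseteq> G" "nfl s = Some ws"
  shows "comb ws = s \<or> tree_less wt (comb ws) s"
proof (cases "right_comb s")
  case True
  then obtain vs where "s = comb vs" by (auto simp: right_comb_iff)
  then show ?thesis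
    using nfl_comb_wt[of vs ws] nfl_SomeD[OF assms] assms by (auto simp: tree_less_def)
next
  case False
  then have "size s < left_weight s" using right_comb_left_weight[of s] by linarith
  then show ?thesis using nfl_SomeD[OF assms] by (simp add: tree_less_def)
qed

definition normal_vec :: "('x tree \<Rightarrow>\<^sub>0 'a) \<Rightarrow> ('x list \<Rightarrow>\<^sub>0 'a::field)" where
  "normal_vec = lin_ext (\<lambda>t. opt_vec (nfl t))"

text \<open>The kernel of the normal form map. \<open>signaletic_relations_eq\<close> identifies it
  with the span that defines each signaletic operad.\<close>

definition relations :: "nat \<Rightarrow> ('x tree \<Rightarrow>\<^sub>0 'a::field) set" where
  "relations n = {x \<in> free_space G n. normal_vec x = 0}"

definition normal_tree :: "'x tree \<Rightarrow> 'x tree option" where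
  "normal_tree t = map_option comb (nfl t)"

lemma lin_ext_comb_normal_vec:
  fixes x :: "'x tree \<Rightarrow>\<^sub>0 'a::field"
  shows "lin_ext (\<lambda>ws. basis_vec (comb ws)) (normal_vec x) = lin_ext (\<lambda>t. opt_vec (normal_tree t)) x"
proof -
  have "lin_ext (\<lambda>ws. basis_vec (comb ws)) (opt_vec (nfl t)) = (opt_vec (normal_tree t) :: _ \<Rightarrow>\<^sub>0 'a)" for t
    by (cases "nfl t") (auto simp: normal_tree_def)
  then show ?thesis by (simp add: normal_vec_def lin_ext_lin_ext)
qed

lemma normal_treeD:
  assumes "set_tree s \<subseteq> G" "normal_tree s = Some t"
  shows "set_tree t \<subseteq> G" "size t = size s" "nfl t = nfl s"
  using nfl_SomeD[OF assms(1)] assms(2) by (auto simp: normal_tree_def)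

lemma normal_vec_opt_vec_normal_tree:
  "set_tree s \<subseteq> G \<Longrightarrow> normal_vec (opt_vec (normal_tree s)) = opt_vec (nfl s)"
  using nfl_SomeD[of s] by (cases "nfl s") (auto simp: normal_vec_def normal_tree_def)

lemma subspace_relations: "free_vs.subspace (relations n)"
  using subspace_free_space[of G n]
  by (auto simp: free_vs.subspace_def relations_def normal_vec_def lin_ext_add lin_ext_smul)

lemma basis_vec_minus_normal_tree_in_relations:
  fixes n :: nat
  defines "I \<equiv> relations n :: ('x tree \<Rightarrow>\<^sub>0 'a::field) set"
  assumes "t \<in> syntax_trees G n"
  shows "basis_vec t - opt_vec (normal_tree t) \<in> I"
proof -
  have t: "set_tree t \<subseteq> G" "size1 t = n" using assms by (auto simp: in_syntax_trees_iff)
  have "(opt_vec (normal_tree t) :: _ \<Rightarrow>\<^sub>0 'a) \<in> free_space G n"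
    using normal_treeD[OF t(1)] t(2) by (auto simp: free_space_iff size1_size)
  then have "(basis_vec t - opt_vec (normal_tree t) :: _ \<Rightarrow>\<^sub>0 'a) \<in> free_space G n"
    using t by (intro free_vs.subspace_diff[OF subspace_free_space]) auto
  then show ?thesis
    by (simp add: I_def relations_def normal_vec_def lin_ext_diff
      normal_vec_opt_vec_normal_tree[OF t(1), unfolded normal_vec_def])
qed

text \<open>If the normal form of \<open>x\<close> vanishes, then \<open>x\<close> is a combination
  of differences between trees and their normal forms, with its own coefficients. So an inclusion of
  the relations in a subspace is tested on these differences.\<close>

lemma relations_subspaceI:
  assumes "x \<in> relations n" "free_vs.subspace S"
    and "\<And>t. t \<in> syntax_trees G n \<Longrightarrow> basis_vec t - opt_vec (normal_tree t) \<in> S"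
  shows "x \<in> S"
proof -
  have "lin_ext (\<lambda>t. opt_vec (normal_tree t)) x = 0"
    using assms(1) by (simp flip: lin_ext_comb_normal_vec add: relations_def)
  then have "x = lin_ext (\<lambda>t. basis_vec t - opt_vec (normal_tree t)) x"
    by (simp add: lin_ext_fun_diff)
  also have "\<dots> \<in> S"
    using assms by (intro lin_ext_in_subspace) (auto simp: relations_def free_space_def)
  finally show ?thesis .
qed

definition comp :: "'x list \<Rightarrow> nat \<Rightarrow> 'x list \<Rightarrow> 'x list option" where
  "comp v i w = nfl (graft (comb v) i (comb w))"

lemma nfl_graft:
  assumes "set_tree s \<subseteq> G" "set_tree t \<subseteq> G" "1 \<le> i" "i \<le> size1 s"
  shows "nfl (graft s i t) = Option.bind (nfl s) (\<lambda>v. Option.bind (nfl t) (comp v i))"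
proof (cases "nfl s")
  case None
  then show ?thesis using nfl_graft_left[OF assms] by simp
next
  case (Some v)
  then have "set_tree (comb v) \<subseteq> G" "size1 (comb v) = size1 s"
    using nfl_SomeD[OF assms(1) Some] by (simp_all add: size1_size)
  then have "nfl (graft (comb v) i t) = Option.bind (nfl t) (comp v i)"
    using assms by (subst nfl_graft_right) (auto simp: comp_def[abs_def])
  then show ?thesis using nfl_graft_left[OF assms] Some by simp
qed

lemma normal_vec_free_comp:
  assumes "x \<in> free_space G m" "y \<in> free_space G n" "1 \<le> i" "i \<le> m"
  shows "normal_vec (free_comp x i y) =
    lin_ext (\<lambda>v. lin_ext (\<lambda>w. opt_vec (comp v i w)) (normal_vec y)) (normal_vec x)"
proof -
  have "opt_vec (nfl (graft s i t)) =
      lin_ext (\<lambda>v. lin_ext (\<lambda>w. opt_vec (comp v i w)) (opt_vec (nfl t))) (opt_vec (nfl s))"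
    if "s \<in> Poly_Mapping.keys x" "t \<in> Poly_Mapping.keys y" for s t
  proof -
    have "nfl (graft s i t) = Option.bind (nfl s) (\<lambda>v. Option.bind (nfl t) (comp v i))"
      using assms that by (intro nfl_graft) (auto simp: free_space_iff)
    then show ?thesis by (cases "nfl s"; cases "nfl t") auto
  qed
  then have "normal_vec (free_comp x i y) = lin_ext (\<lambda>s. lin_ext (\<lambda>t.
      lin_ext (\<lambda>v. lin_ext (\<lambda>w. opt_vec (comp v i w)) (opt_vec (nfl t))) (opt_vec (nfl s))) y) x"
    by (auto simp: normal_vec_def free_comp_def lin_ext_lin_ext intro!: lin_ext_cong)
  also have "\<dots> = lin_ext (\<lambda>v. lin_ext (\<lambda>w. opt_vec (comp v i w)) (normal_vec y)) (normal_vec x)"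
    unfolding normal_vec_def lin_ext_lin_ext
    by (subst lin_ext_swap) (rule refl)
  finally show ?thesis .
qed

text \<open>By \<open>normal_vec_free_comp\<close> the normal form of a composite is bilinear in
  those of its factors, so it vanishes as soon as one of them does.\<close>

lemma operad_ideal_relations: "operad_ideal G (relations :: nat \<Rightarrow> ('x tree \<Rightarrow>\<^sub>0 'a::field) set)"
  unfolding operad_ideal_def
proof (intro conjI allI impI)
  show "(relations n :: ('x tree \<Rightarrow>\<^sub>0 'a) set) \<subseteq> free_space G n" for n by (auto simp: relations_def)
next
  fix m n i :: nat and x y :: "'x tree \<Rightarrow>\<^sub>0 'a"
  assume "1 \<le> i" "i \<le> m" "x \<in> relations m" "y \<in> free_space G n"
  then show "free_comp x i y \<in> relations (m + n - 1)"
    by (auto simp: relations_def normal_vec_free_comp 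
      intro: free_comp_in_free_space[unfolded One_nat_def])
next
  fix m n i :: nat and x y :: "'x tree \<Rightarrow>\<^sub>0 'a"
  assume "1 \<le> i" "i \<le> m" "x \<in> free_space G m" "y \<in> relations n"
  then show "free_comp x i y \<in> relations (m + n - 1)"
    by (auto simp: relations_def normal_vec_free_comp 
      intro: free_comp_in_free_space[unfolded One_nat_def])
qed (rule subspace_relations)


section \<open>The quadratic rewriting system: irreducible trees, convergence, generation in arity
  3\<close>

subsection \<open>Rewriting\<close>

text \<open>Each tree of arity 3 jumps to its normal form in one step. The left-hand sides are all
  left-branching trees and all combs whose two labels do not form a normal pair; the right-hand side
  is zero if the normal form is \<open>None\<close>.\<close>

definition comb_rules :: "('x, 'a::field) rules" where
  "comb_rules = {(s, opt_vec (normal_tree s)) | s. s \<in> syntax_trees G 3 \<and> normal_tree s \<noteq> Some s}"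

text \<open>
  Grafting on a leaf multiplies the contribution of this leaf to \<^const>\<open>left_weight\<close>, so monotonicity
  under rewriting in context needs the comparison of the depths of all leaves.
\<close>

lemma rule_instance_comb_rulesD:
  assumes "rule_instance G comb_rules t z"
  shows "set_tree t \<subseteq> G \<and> (\<exists>a. z = opt_vec a \<and> Option.bind a nfl = nfl t \<and>
    (\<forall>s\<in>set_option a. set_tree s \<subseteq> G \<and> tree_less wt s t \<and>
      list_all2 (\<le>) (left_depths s) (left_depths t)))"
  using assms
proof induction
  case (rule s x)
  then have s: "set_tree s \<subseteq> G" "size1 s = 3" "x = opt_vec (normal_tree s)" "normal_tree s \<noteq> Some s"
    by (auto simp: comb_rules_def in_syntax_trees_iff)
  \<comment> \<open>The leaf depths are 1, 1, 0 for a right comb of arity 3 and 2, 1, 0 for the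
    other shape, so no leaf gets deeper.\<close>
  have "list_all2 (\<le>) (left_depths t) (left_depths s)" if t: "normal_tree s = Some t" for t
  proof -
    obtain ws where "t = comb ws" "length ws = 2"
      using t nfl_SomeD[OF s(1)] s(2) by (auto simp: normal_tree_def size1_size)
    then obtain c d where "t = comb [c, d]" by (auto simp: length_Suc_conv numeral_2_eq_2)
    then show ?thesis using arity_3_cases[OF s(2)] by auto
  qed
  moreover have "tree_less wt t s" if "normal_tree s = Some t" for t
    using nfl_less[OF s(1)] s(4) that by (auto simp: normal_tree_def)
  moreover have "Option.bind (normal_tree s) nfl = nfl s"
    using nfl_SomeD[OF s(1)] by (cases "nfl s") (auto simp: normal_tree_def)
  ultimately show ?case
    using s normal_treeD[OF s(1)] by (intro conjI exI[of _ "normal_tree s"]) auto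
next
  case (above t z u m i)
  then obtain a where a: "z = opt_vec a" "Option.bind a nfl = nfl t" "set_tree t \<subseteq> G"
    "\<forall>s\<in>set_option a. set_tree s \<subseteq> G \<and> tree_less wt s t \<and> list_all2 (\<le>) (left_depths s) (left_depths t)"
    by auto
  have u: "set_tree u \<subseteq> G" using above.hyps by (simp add: in_syntax_trees_iff)
  have "Option.bind (map_option (\<lambda>t. graft t i u) a) nfl = nfl (graft t i u)"
  proof (cases a)
    case None
    then show ?thesis using a u above.hyps by (simp add: nfl_graft_left[of t])
  next
    case (Some s)
    then have "size1 s = size1 t" using a(4) by (simp add: tree_less_def size1_size)
    then show ?thesis
      using Some a u above.hyps by (simp add: nfl_graft_left[of t] nfl_graft_left[of s])
  qed
  moreover have "list_all2 (\<le>) (left_depths u) (left_depths u)"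
    by (simp add: list_all2_refl)
  ultimately show ?case
    using a u above.hyps
    by (intro conjI exI[of _ "map_option (\<lambda>t. graft t i u) a"])
      (auto simp: free_comp_opt_vec_left intro!: tree_less_graft_left left_depths_graft_mono)
next
  case (below t z u m i)
  then obtain a where a: "z = opt_vec a" "Option.bind a nfl = nfl t" "set_tree t \<subseteq> G"
    "\<forall>s\<in>set_option a. set_tree s \<subseteq> G \<and> tree_less wt s t \<and> list_all2 (\<le>) (left_depths s) (left_depths t)"
    by auto
  have u: "set_tree u \<subseteq> G" "i \<le> size1 u" using below.hyps by (auto simp: in_syntax_trees_iff)
  have "Option.bind (map_option (graft u i) a) nfl = nfl (graft u i t)"
  proof (cases a)
    case None
    then show ?thesis using a u below.hyps by (simp add: nfl_graft_right[of u t])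
  next
    case (Some s)
    then show ?thesis
      using a u below.hyps by (simp add: nfl_graft_right[of u t] nfl_graft_right[of u s])
  qed
  moreover have "list_all2 (\<le>) (left_depths u) (left_depths u)"
    by (simp add: list_all2_refl)
  ultimately show ?case
    using a u below.hyps
    by (intro conjI exI[of _ "map_option (graft u i) a"])
      (auto simp: free_comp_opt_vec_right intro!: tree_less_graft_right left_depths_graft_mono)
qed

text \<open>The right subtree is a normal comb by induction. A left child that is an internal node
  exhibits a left-branching tree of arity 3, which is always reducible. Otherwise the root label and
  the next one must form a normal pair, and locality makes the whole comb normal.\<close>

lemma comb_rules_irreducible:
  assumes "set_tree t \<subseteq> G" "\<nexists>z. rule_instance G (comb_rules :: ('x, 'a::field) rules) t z"
  shows "normal_tree t = Some t"
proof -
  let ?R = "comb_rules :: ('x, 'a) rules"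
  define red where "red s \<longleftrightarrow> (\<exists>z. rule_instance G ?R s z)" for s
  have above: "red (graft s i u)"
    if "red s" "set_tree u \<subseteq> G" "1 \<le> i" "i \<le> size1 s" for s i u
    using rule_instance.above[of G ?R s _ u "size1 u" i] that by (auto simp: red_def in_syntax_trees_iff)
  have below: "red (graft u i s)"
    if "red s" "set_tree u \<subseteq> G" "1 \<le> i" "i \<le> size1 u" for s i u
    using rule_instance.below[of G ?R s _ u "size1 u" i] that by (auto simp: red_def in_syntax_trees_iff)
  have base: "red s" if "set_tree s \<subseteq> G" "size1 s = 3" "normal_tree s \<noteq> Some s" for s
    unfolding red_def
    by (rule exI, rule rule_instance.rule) (use that in \<open>auto simp: comb_rules_def in_syntax_trees_iff\<close>)
  have "\<not> red t" using assms(2) by (simp add: red_def)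
  then have "\<exists>ws. t = comb ws \<and> successively normal_pair ws"
    using assms(1)
  proof (induction t)
    case Leaf
    show ?case by (rule exI[of _ "[]"]) simp
  next
    case (Node l w r)
    have "\<not> red r"
      using below[of r "Node l w Leaf" "size1 l + 1"] Node.prems by auto
    then obtain ws where ws: "r = comb ws" "successively normal_pair ws"
      using Node by auto
    have l: "l = Leaf"
    proof (cases l)
      case l: (Node a v b)
      have "comb ws \<noteq> Node (Node Leaf v Leaf) w Leaf" for ws :: "'x list"
        by (cases ws) auto
      then have "red (Node (Node Leaf v Leaf) w Leaf)"
        using Node.prems l by (intro base) (auto simp: normal_tree_def)
      \<comment> \<open>The subtrees are put back from right to left, at leaves 3, 2 and 1, so that
        the numbers of the remaining leaves do not change.\<close>
      then have "red (Node (Node Leaf v Leaf) w r)"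
        using above[of "Node (Node Leaf v Leaf) w Leaf" r 3] Node.prems by simp
      then have "red (Node (Node Leaf v b) w r)"
        using above[of "Node (Node Leaf v Leaf) w r" b 2] Node.prems l by simp
      then have "red (Node (Node a v b) w r)"
        using above[of "Node (Node Leaf v b) w r" a 1] Node.prems l by simp
      then show ?thesis using Node.prems(1) l by simp
    qed
    show ?case
    proof (cases ws)
      case Nil
      then show ?thesis using ws l by (intro exI[of _ "[w]"]) auto
    next
      case (Cons v vs)
      have "normal_pair w v"
      proof (rule ccontr)
        assume *: "\<not> normal_pair w v"
        have "normal_tree (comb [w, v]) \<noteq> Some (comb [w, v])"
          using * by (auto simp: normal_tree_def normal_pair_def simp del: comb.simps)
        then have "red (comb [w, v])"
          using Node.prems ws Cons by (intro base) auto
        then have "red (graft (comb [w, v]) 3 (comb vs))"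
          using Node.prems ws Cons by (intro above) auto
        then show False using Node.prems(1) ws Cons l by simp
      qed
      then show ?thesis using ws l Cons by (intro exI[of _ "w # ws"]) auto
    qed
  qed
  then obtain ws where "t = comb ws" "successively normal_pair ws" by blast
  then show ?thesis using nfl_comb_iff[of ws] assms(1) by (simp add: normal_tree_def)
qed

text \<open>A reduct of a normal tree would lie strictly below it and yet have it as normal form,
  against \<open>nfl_less\<close>.\<close>

lemma rule_instance_comb_rules_iff:
  assumes "set_tree t \<subseteq> G"
  shows "(\<exists>z. rule_instance G (comb_rules :: ('x, 'a::field) rules) t z) \<longleftrightarrow> normal_tree t \<noteq> Some t"
proof
  assume "\<exists>z. rule_instance G (comb_rules :: ('x, 'a) rules) t z"
  then obtain z where "rule_instance G (comb_rules :: ('x, 'a) rules) t z" ..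
  from rule_instance_comb_rulesD[OF this] obtain a where
    a: "Option.bind a nfl = nfl t" "\<forall>s\<in>set_option a. set_tree s \<subseteq> G \<and> tree_less wt s t" by auto
  show "normal_tree t \<noteq> Some t"
  proof
    assume "normal_tree t = Some t"
    then obtain ws where ws: "nfl t = Some ws" "t = comb ws" by (auto simp: normal_tree_def)
    then obtain s where s: "a = Some s" "nfl s = Some ws" using a(1) by (cases a) auto
    then have "comb ws = s \<or> tree_less wt (comb ws) s" using a(2) by (intro nfl_less) auto
    moreover have "tree_less wt s (comb ws)" using a(2) s ws by auto
    ultimately show False using tree_less_trans tree_less_irrefl by metis
  qed
qed (use comb_rules_irreducible assms in blast)

lemma normal_form_trees_comb_rules:
  "normal_form_trees G (comb_rules :: ('x, 'a::field) rules) = {t. set_tree t \<subseteq> G \<and> normal_tree t = Some t}"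
proof -
  have "(\<exists>y. rewrite_step G (comb_rules :: ('x, 'a) rules) (basis_vec t) y) \<longleftrightarrow>
      (\<exists>z. rule_instance G (comb_rules :: ('x, 'a) rules) t z)" if "set_tree t \<subseteq> G" for t
  proof -
    have "basis_vec t \<in> free_space G (size1 t)" using that by simp
    then have "\<exists>y. rewrite_step G comb_rules (basis_vec t :: _ \<Rightarrow>\<^sub>0 'a) y"
      if "rule_instance G (comb_rules :: ('x, 'a) rules) t z" for z
      by (intro exI, rule rewrite_step.intros[OF _ _ that]) auto
    then show ?thesis
      by (auto elim!: rewrite_step.cases split: if_splits)
  qed
  then show ?thesis by (auto simp: normal_form_trees_def rule_instance_comb_rules_iff)
qed

lemma orients_quadratic_relations_comb_rules:
  "orients_quadratic_relations G relations (comb_rules :: ('x, 'a::field) rules)"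
  unfolding orients_quadratic_relations_def
proof
  show "(comb_rules :: ('x, 'a) rules) \<subseteq> syntax_trees G 3 \<times> free_space G 3"
    using normal_treeD by (fastforce simp: comb_rules_def in_syntax_trees_iff free_space_iff size1_size)
  let ?D = "{basis_vec s - x |s x. (s, x) \<in> (comb_rules :: ('x, 'a) rules)}"
  show "free_vs.span ?D = relations 3"
  proof
    show "free_vs.span ?D \<subseteq> relations 3"
      by (intro free_vs.span_minimal subspace_relations)
        (auto simp: comb_rules_def intro: basis_vec_minus_normal_tree_in_relations)
    show "relations 3 \<subseteq> free_vs.span ?D"
    proof
      fix x :: "'x tree \<Rightarrow>\<^sub>0 'a" assume "x \<in> relations 3"
      then show "x \<in> free_vs.span ?D"
      proof (rule relations_subspaceI)
        fix t assume t: "t \<in> syntax_trees G 3"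
        show "basis_vec t - opt_vec (normal_tree t) \<in> free_vs.span ?D"
        proof (cases "normal_tree t = Some t")
          case True
          then show ?thesis by (simp add: free_vs.span_zero)
        next
          case False
          then show ?thesis using t
            by (intro free_vs.span_base) (auto simp: comb_rules_def)
        qed
      qed (rule free_vs.subspace_span)
    qed
  qed
qed

text \<open>The multiset order on supports: a step removes \<open>t\<close> and brings in only trees
  below \<open>t\<close>. Other coefficients may cancel, which only shrinks the support.\<close>

lemma wfp_rewrite_step_comb_rules: "wfp (rewrite_step G (comb_rules :: ('x, 'a::field) rules))\<inverse>\<inverse>"
proof -
  let ?r = "{(s, t). tree_less wt s t}"
  let ?keys = "\<lambda>x :: 'x tree \<Rightarrow>\<^sub>0 'a. mset_set (Poly_Mapping.keys x)"
  have "(?keys y, ?keys x) \<in> mult ?r" if "rewrite_step G comb_rules x y" for x y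
    using that
  proof cases
    case (1 n t z)
    from rule_instance_comb_rulesD[OF 1(4)] obtain a where
      a: "z = opt_vec a" "\<forall>s\<in>set_option a. tree_less wt s t" by auto
    then have t_z: "t \<notin> Poly_Mapping.keys z" by auto
    have "t \<notin> Poly_Mapping.keys y"
      using t_z by (simp add: 1 in_keys_iff lookup_add lookup_minus)
    moreover have y: "Poly_Mapping.keys y \<subseteq> Poly_Mapping.keys x \<union> Poly_Mapping.keys z"
      using 1(3) by (auto simp: 1(1) in_keys_iff lookup_add lookup_minus lookup_single when_def split: if_splits)
    ultimately have *: "t \<in> Poly_Mapping.keys x - Poly_Mapping.keys y"
      "\<forall>s\<in>Poly_Mapping.keys y - Poly_Mapping.keys x. tree_less wt s t"
      using 1(3) a by auto
    let ?I = "Poly_Mapping.keys x \<inter> Poly_Mapping.keys y"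
    have split: "mset_set A = mset_set (A \<inter> B) + mset_set (A - B)" if "finite A" for A B :: "'x tree set"
      using that mset_set_Union[of "A \<inter> B" "A - B"] by (simp add: Int_Diff_Un Int_Diff_disjoint)
    have "(mset_set ?I + mset_set (Poly_Mapping.keys y - Poly_Mapping.keys x),
        mset_set ?I + mset_set (Poly_Mapping.keys x - Poly_Mapping.keys y)) \<in> mult ?r"
    proof (rule one_step_implies_mult)
      show "mset_set (Poly_Mapping.keys x - Poly_Mapping.keys y) \<noteq> {#}"
        using *(1) by (auto simp: mset_set_empty_iff)
    qed (use * in auto)
    then show ?thesis
      using split[of "Poly_Mapping.keys x" "Poly_Mapping.keys y"]
        split[of "Poly_Mapping.keys y" "Poly_Mapping.keys x"]
      by (simp add: Int_commute)
  qed
  then have "{(y, x). rewrite_step G comb_rules x y} \<subseteq> inv_image (mult ?r) ?keys"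
    by auto
  moreover have "wf (inv_image (mult ?r) ?keys)"
    using wfp_tree_less[of wt] by (intro wf_inv_image wf_mult) (simp add: wfp_def)
  ultimately show ?thesis by (auto simp: wfp_def intro: wf_subset)
qed

lemma rewrite_step_comb_rules_invariant:
  assumes "rewrite_step G (comb_rules :: ('x, 'a::field) rules) x y" "x \<in> free_space G n"
  shows "y \<in> free_space G n \<and> normal_vec y = normal_vec x"
  using assms(1)
proof cases
  case (1 m t z)
  from rule_instance_comb_rulesD[OF 1(4)] obtain a where
    a: "z = opt_vec a" "Option.bind a nfl = nfl t" "set_tree t \<subseteq> G"
      "\<forall>s\<in>set_option a. set_tree s \<subseteq> G \<and> tree_less wt s t" by blast
  have "size1 t = n" using assms(2) 1(3) by (auto simp: free_space_iff)
  then have "z - basis_vec t \<in> free_space G n"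
    using a by (intro free_vs.subspace_diff[OF subspace_free_space])
      (auto simp: free_space_iff tree_less_def size1_size)
  then have "y \<in> free_space G n"
    unfolding 1(1) using assms(2)
    by (intro free_vs.subspace_add[OF subspace_free_space] free_vs.subspace_scale[OF subspace_free_space])
  moreover have "normal_vec z = opt_vec (nfl t)"
    using a(1) by (simp flip: a(2) add: normal_vec_def lin_ext_opt_vec_bind)
  then have "normal_vec y = normal_vec x"
    by (simp add: 1(1) normal_vec_def lin_ext_add lin_ext_smul lin_ext_diff)
  ultimately show ?thesis ..
qed

text \<open>Rewriting does not change \<open>normal_vec\<close>, and an irreducible vector is
  determined by it. As rewriting terminates, all vectors reachable from \<open>x\<close> reach one
  common vector, without an analysis of critical pairs.\<close>

lemma confluentp_rewrite_step_comb_rules: "confluentp (rewrite_step G (comb_rules :: ('x, 'a::field) rules))"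
proof (rule confluentpI)
  let ?R = "rewrite_step G (comb_rules :: ('x, 'a) rules)"
  fix x y z assume xy: "?R\<^sup>*\<^sup>* x y" and xz: "?R\<^sup>*\<^sup>* x z"
  show "\<exists>u. ?R\<^sup>*\<^sup>* y u \<and> ?R\<^sup>*\<^sup>* z u"
  proof (cases "\<exists>n. x \<in> free_space G n")
    \<comment> \<open>A vector outside every homogeneous component admits no step at all.\<close>
    case False
    then have irred: "\<not> ?R x v" for v by (auto elim: rewrite_step.cases)
    have "v = x" if "?R\<^sup>*\<^sup>* x v" for v
      using that by (cases rule: converse_rtranclpE) (auto simp: irred)
    then show ?thesis using xy xz by auto
  next
    case True
    then obtain n where n: "x \<in> free_space G n" ..
    have inv: "v \<in> free_space G n \<and> normal_vec v = normal_vec x" if "?R\<^sup>*\<^sup>* x v" for v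
      using that
    proof induction
      case (step v w)
      then show ?case using rewrite_step_comb_rules_invariant[OF step.hyps(2), of n] by simp
    qed (use n in simp)
    define nf where "nf = lin_ext (\<lambda>ws. basis_vec (comb ws)) (normal_vec x)"
    have reach: "?R\<^sup>*\<^sup>* x v \<longrightarrow> ?R\<^sup>*\<^sup>* v nf" for v
    proof (induction v rule: wfp_induct_rule[OF wfp_rewrite_step_comb_rules])
      case (1 v)
      show ?case
      proof (cases "\<exists>u. ?R v u")
        case True
        then obtain u where u: "?R v u" ..
        show ?thesis
        proof
          assume "?R\<^sup>*\<^sup>* x v"
          then have "?R\<^sup>*\<^sup>* x u" using u by (rule rtranclp.rtrancl_into_rtrancl)
          then have "?R\<^sup>*\<^sup>* u nf" using 1[of u] u by simp
          with u show "?R\<^sup>*\<^sup>* v nf" by (rule converse_rtranclp_into_rtranclp)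
        qed
      next
        case False
        show ?thesis
        proof
          assume "?R\<^sup>*\<^sup>* x v"
          then have v: "v \<in> free_space G n" "normal_vec v = normal_vec x" by (blast dest: inv)+
          have "normal_tree t = Some t" if "t \<in> Poly_Mapping.keys v" for t
          proof (rule comb_rules_irreducible)
            show "set_tree t \<subseteq> G" using v that by (auto simp: free_space_iff)
            show "\<nexists>z. rule_instance G (comb_rules :: ('x, 'a) rules) t z"
              using False rewrite_step.intros[OF v(1) that] by blast
          qed
          then have "lin_ext (\<lambda>t. opt_vec (normal_tree t)) v = lin_ext basis_vec v"
            by (intro lin_ext_cong) auto
          then have "v = nf"
            unfolding nf_def v(2)[symmetric] lin_ext_comb_normal_vec by simp
          then show "?R\<^sup>*\<^sup>* v nf" by simp
        qed
      qed
    qed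
    then show ?thesis using xy xz by blast
  qed
qed

lemma convergent_comb_rules: "convergent_rules G (comb_rules :: ('x, 'a::field) rules)"
  by (simp add: convergent_rules_def wfp_rewrite_step_comb_rules confluentp_rewrite_step_comb_rules)

text \<open>Let \<open>J\<close> be any ideal containing the relations of arity 3. Modulo
  \<open>J\<close> a reducible tree is zero or a lower tree with the same normal form, so by
  well-founded induction every tree is congruent to its normal form. These differences span the
  relations.\<close>

lemma quadratic_relations: "quadratic G (relations :: nat \<Rightarrow> ('x tree \<Rightarrow>\<^sub>0 'a::field) set)"
proof -
  let ?I = "relations :: nat \<Rightarrow> ('x tree \<Rightarrow>\<^sub>0 'a) set"
  have "?I n \<subseteq> J n" if J: "operad_ideal G J" "?I 3 \<subseteq> J 3" for J n
  proof -
    have instance_in: "basis_vec t - z \<in> J (size1 t)" if "rule_instance G comb_rules t z" for t z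
      using that
    proof induction
      case (rule s x)
      then have "basis_vec s - x \<in> ?I 3" "size1 s = 3"
        by (auto simp: comb_rules_def in_syntax_trees_iff intro: basis_vec_minus_normal_tree_in_relations)
      then show ?case using J(2) by auto
    next
      case (above t z u m i)
      then have "basis_vec u \<in> free_space G m" "size1 u = m" by (auto simp: in_syntax_trees_iff)
      then have "free_comp (basis_vec t - z) i (basis_vec u) \<in> J (size1 t + m - 1)"
        using J(1) above unfolding operad_ideal_def by blast
      then show ?case using \<open>size1 u = m\<close> by (simp add: free_comp_diff_left size1_graft)
    next
      case (below t z u m i)
      then have "basis_vec u \<in> free_space G m" "size1 u = m" by (auto simp: in_syntax_trees_iff)
      then have "free_comp (basis_vec u) i (basis_vec t - z) \<in> J (m + size1 t - 1)"
        using J(1) below unfolding operad_ideal_def by blast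
      then show ?case using \<open>size1 u = m\<close> by (simp add: free_comp_diff_right size1_graft)
    qed
    have J_sub: "free_vs.subspace (J m)" for m using J(1) by (simp add: operad_ideal_def)
    have "set_tree t \<subseteq> G \<longrightarrow> basis_vec t - opt_vec (normal_tree t) \<in> J (size1 t)" for t
    proof (induction t rule: wfp_induct_rule[OF wfp_tree_less[of wt]])
      case (1 t)
      show ?case
      proof (cases "normal_tree t = Some t")
        case True
        then show ?thesis using free_vs.subspace_0[OF J_sub] by simp
      next
        case False
        show ?thesis
        proof
          assume t: "set_tree t \<subseteq> G"
          then obtain z where z: "rule_instance G (comb_rules :: ('x, 'a) rules) t z"
            using rule_instance_comb_rules_iff False by metis
          from rule_instance_comb_rulesD[OF z] obtain a where
            a: "z = opt_vec a" "Option.bind a nfl = nfl t"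
              "\<forall>s\<in>set_option a. set_tree s \<subseteq> G \<and> tree_less wt s t" by blast
          have "z - opt_vec (normal_tree t) \<in> J (size1 t)"
          proof (cases a)
            case None
            then have "nfl t = None" using a(2) by simp
            then show ?thesis using a(1) None free_vs.subspace_0[OF J_sub] by (simp add: normal_tree_def)
          next
            case (Some s)
            then have "normal_tree t = normal_tree s" "size1 s = size1 t"
              using a by (auto simp: normal_tree_def tree_less_def size1_size)
            then show ?thesis using a Some 1[of s] by auto
          qed
          then have "(basis_vec t - z) + (z - opt_vec (normal_tree t)) \<in> J (size1 t)"
            by (intro free_vs.subspace_add J_sub instance_in z)
          then show "basis_vec t - opt_vec (normal_tree t) \<in> J (size1 t)" by simp
        qed
      qed
    qed
    then have "x \<in> J n" if "x \<in> ?I n" for x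
      by (intro relations_subspaceI[OF that J_sub]) (auto simp: in_syntax_trees_iff)
    then show ?thesis ..
  qed
  then have le: "?I n \<subseteq> J n" if "operad_ideal G J" "?I 3 \<subseteq> J 3" for J n
    using that by simp
  have "?I n \<subseteq> generated_ideal G (\<lambda>n. if n = 3 then ?I 3 else {}) n" for n
    unfolding generated_ideal_def
  proof (rule Inter_greatest, clarify)
    fix J x
    assume J: "operad_ideal G J" "\<forall>m. (if m = 3 then ?I 3 else {}) \<subseteq> J m" and x: "x \<in> ?I n"
    have "?I 3 \<subseteq> J 3" using J(2)[rule_format, of 3] by simp
    then show "x \<in> J n" using le[OF J(1)] x by blast
  qed
  moreover have "generated_ideal G (\<lambda>n. if n = 3 then ?I 3 else {}) n \<subseteq> ?I n" for n
    unfolding generated_ideal_def using operad_ideal_relations by (auto intro!: Inter_lower)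
  ultimately show ?thesis unfolding quadratic_def by blast
qed

end


section \<open>Trees with decorated vertices and the contraction of a single edge\<close>

section \<open>Contraction of edges\<close>

abbreviation fnodes :: "'v dtree list \<Rightarrow> nat" where
  "fnodes ts \<equiv> sum_list (map dnodes ts)"

abbreviation fleaves :: "'v dtree list \<Rightarrow> nat" where
  "fleaves ts \<equiv> sum_list (map dleaves ts)"

text \<open>
  \<open>contract c t j\<close> contracts the edge above the \<open>j\<close>-th vertex of \<open>t\<close> in preorder (the root has number
  0). Here \<open>c m n i p q\<close> is the composition of the decorations, with \<^const>\<open>None\<close> for zero. In
  \<open>contract_below\<close>, the subtrees \<open>xs\<close> of the root have been passed already.
\<close>

fun contract :: "(nat \<Rightarrow> nat \<Rightarrow> nat \<Rightarrow> 'v \<Rightarrow> 'v \<Rightarrow> 'v option) \<Rightarrow> 'v dtree \<Rightarrow> nat \<Rightarrow> 'v dtree option"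
  and contract_below :: "(nat \<Rightarrow> nat \<Rightarrow> nat \<Rightarrow> 'v \<Rightarrow> 'v \<Rightarrow> 'v option) \<Rightarrow> 'v \<Rightarrow> 'v dtree list \<Rightarrow> 'v dtree list \<Rightarrow>
    nat \<Rightarrow> 'v dtree option" where
  "contract c DLeaf j = None"
| "contract c (DNode p ts) j = contract_below c p [] ts (j - 1)"
| "contract_below c p xs [] j = None"
| "contract_below c p xs (t # ts) j =
     (if j < dnodes t then
        if j = 0 then
          (case t of
             DLeaf \<Rightarrow> None
           | DNode q us \<Rightarrow> map_option (\<lambda>r. DNode r (xs @ us @ ts))
               (c (length xs + 1 + length ts) (length us) (length xs + 1) p q))
        else map_option (\<lambda>t'. DNode p (xs @ t' # ts)) (contract c t j)
      else contract_below c p (xs @ [t]) ts (j - dnodes t))"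

lemma contract_below_append:
  "contract_below c p ws (xs @ ys) (fnodes xs + j) = contract_below c p (ws @ xs) ys j"
  by (induction xs arbitrary: ws) (auto simp: add.assoc)

text \<open>In preorder the lower end of this edge is preceded by the root and all vertices of
  \<open>xs\<close>, whence its number \<open>1 + fnodes xs\<close>.\<close>

lemma contract_root:
  "contract c (DNode p (xs @ DNode q us # ys)) (1 + fnodes xs) =
     map_option (\<lambda>r. DNode r (xs @ us @ ys))
       (c (length xs + 1 + length ys) (length us) (length xs + 1) p q)"
  using contract_below_append[of c p "[]" xs "DNode q us # ys" 0] by simp

lemma contract_child:
  assumes "1 \<le> j" "j < dnodes t"
  shows "contract c (DNode p (xs @ t # ys)) (1 + fnodes xs + j) =
     map_option (\<lambda>t'. DNode p (xs @ t' # ys)) (contract c t j)"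
  using contract_below_append[of c p "[]" xs "t # ys" j] assms by simp

declare contract.simps(2) [simp del]

lemma less_fnodesE:
  assumes "j < fnodes ts"
  obtains xs t ys i where "ts = xs @ t # ys" "j = fnodes xs + i" "i < dnodes t"
proof -
  have "\<exists>xs t ys i. ts = xs @ t # ys \<and> j = fnodes xs + i \<and> i < dnodes t"
    using assms
  proof (induction ts arbitrary: j)
    case (Cons t ts)
    show ?case
    proof (cases "j < dnodes t")
      case True
      then show ?thesis by (intro exI[of _ "[]"] exI[of _ t] exI[of _ ts]) auto
    next
      case False
      then have "j - dnodes t < fnodes ts" using Cons.prems by simp
      from Cons.IH[OF this] obtain xs u ys i
        where "ts = xs @ u # ys" "j - dnodes t = fnodes xs + i" "i < dnodes u" by blast
      then show ?thesis
        using False by (intro exI[of _ "t # xs"] exI[of _ u] exI[of _ ys] exI[of _ i]) auto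
    qed
  qed simp
  with that show thesis by blast
qed

text \<open>An edge ends at the root or lies inside one of the subtrees there. This split drives the
  inductions on the number of vertices.\<close>

lemma edge_cases:
  assumes "1 \<le> j" "j < dnodes t"
  obtains (root) p xs q us ys where "t = DNode p (xs @ DNode q us # ys)" "j = 1 + fnodes xs"
  | (child) p xs s ys i where "t = DNode p (xs @ s # ys)" "j = 1 + fnodes xs + i" "1 \<le> i" "i < dnodes s"
proof -
  obtain p ts where t: "t = DNode p ts" using assms by (cases t) auto
  then have "j - 1 < fnodes ts" using assms by auto
  then obtain xs s ys i where *: "ts = xs @ s # ys" "j - 1 = fnodes xs + i" "i < dnodes s"
    by (rule less_fnodesE)
  show thesis
  proof (cases "i = 0")
    case True
    then obtain q us where "s = DNode q us" using * by (cases s) auto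
    then show thesis using root[of p xs q us ys] t * True assms(1) by auto
  next
    case False
    then show thesis using child[of p xs s ys i] t * assms(1) by auto
  qed
qed

fun decorated :: "(nat \<Rightarrow> 'v set) \<Rightarrow> 'v dtree \<Rightarrow> bool" where
  "decorated V DLeaf \<longleftrightarrow> True"
| "decorated V (DNode p ts) \<longleftrightarrow> p \<in> V (length ts) \<and> (\<forall>t\<in>set ts. decorated V t)"

lemma contract_preserves:
  assumes "contract c t j = Some s" "1 \<le> j" "j < dnodes t"
  shows "dleaves s = dleaves t \<and> dnodes s = dnodes t - 1"
  using assms
proof (induction "dnodes t" arbitrary: t s j rule: less_induct)
  case less
  from less.prems(2,3) show ?case
  proof (cases rule: edge_cases)
    case (root p xs q us ys)
    have "map_option (\<lambda>r. DNode r (xs @ us @ ys))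
        (c (length xs + 1 + length ys) (length us) (length xs + 1) p q) = Some s"
      using less.prems(1) unfolding root contract_root .
    then show ?thesis using root by auto
  next
    case (child p xs u ys i)
    have "map_option (\<lambda>u'. DNode p (xs @ u' # ys)) (contract c u i) = Some s"
      using less.prems(1) unfolding child(1,2) contract_child[OF child(3,4)] .
    then obtain u' where "contract c u i = Some u'" "s = DNode p (xs @ u' # ys)" by auto
    then show ?thesis using less.hyps[of u i u'] child by auto
  qed
qed

lemma decorated_contract:
  assumes closed: "\<And>p q m n i r. p \<in> V m \<Longrightarrow> q \<in> V n \<Longrightarrow> 1 \<le> i \<Longrightarrow> i \<le> m \<Longrightarrow> c m n i p q = Some r \<Longrightarrow>
      r \<in> V (m + n - 1)"
    and "decorated V t" "contract c t j = Some s" "1 \<le> j" "j < dnodes t"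
  shows "decorated V s"
  using assms(2-)
proof (induction "dnodes t" arbitrary: t s j rule: less_induct)
  case less
  from less.prems(3,4) show ?case
  proof (cases rule: edge_cases)
    case (root p xs q us ys)
    have "map_option (\<lambda>r. DNode r (xs @ us @ ys))
        (c (length xs + 1 + length ys) (length us) (length xs + 1) p q) = Some s"
      using less.prems(2) unfolding root contract_root .
    then obtain r where r: "c (length xs + 1 + length ys) (length us) (length xs + 1) p q = Some r"
      "s = DNode r (xs @ us @ ys)"
      by auto
    then have "r \<in> V (length xs + 1 + length ys + length us - 1)"
      using less.prems(1) root by (intro closed[OF _ _ _ _ r(1)]) auto
    then have "r \<in> V (length (xs @ us @ ys))" by (simp add: ac_simps)
    then show ?thesis using r less.prems(1) root by auto
  next
    case (child p xs u ys i)
    have "map_option (\<lambda>u'. DNode p (xs @ u' # ys)) (contract c u i) = Some s"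
      using less.prems(2) unfolding child(1,2) contract_child[OF child(3,4)] .
    then obtain u' where "contract c u i = Some u'" "s = DNode p (xs @ u' # ys)" by auto
    then show ?thesis using less.hyps[of u i u'] less.prems(1) child by auto
  qed
qed

lemma append_Cons_eq_append_Cons_cases:
  assumes "xs @ t # ys = xs' @ t' # ys'"
  obtains "xs = xs'" "t = t'" "ys = ys'"
  | zs where "xs' = xs @ t # zs" "ys = zs @ t' # ys'"
  | zs where "xs = xs' @ t' # zs" "ys' = zs @ t # ys"
  using assms by (auto simp: append_eq_append_conv2 append_eq_Cons_conv Cons_eq_append_conv)

text \<open>The axioms of a nonsymmetric operad without unit on graded sets, where an undefined
  composite means zero.\<close>

locale partial_composition =
  fixes V :: "nat \<Rightarrow> 'v set" and c :: "nat \<Rightarrow> nat \<Rightarrow> nat \<Rightarrow> 'v \<Rightarrow> 'v \<Rightarrow> 'v option"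
  assumes comp_closed: "p \<in> V m \<Longrightarrow> q \<in> V n \<Longrightarrow> 1 \<le> i \<Longrightarrow> i \<le> m \<Longrightarrow> c m n i p q = Some r \<Longrightarrow>
      r \<in> V (m + n - 1)"
    and comp_sequential: "p \<in> V m \<Longrightarrow> q \<in> V n \<Longrightarrow> r \<in> V l \<Longrightarrow> 1 \<le> i \<Longrightarrow> i \<le> m \<Longrightarrow> 1 \<le> j \<Longrightarrow> j \<le> n \<Longrightarrow>
      Option.bind (c m n i p q) (\<lambda>x. c (m + n - 1) l (i + j - 1) x r) =
      Option.bind (c n l j q r) (\<lambda>y. c m (n + l - 1) i p y)"
    and comp_parallel: "p \<in> V m \<Longrightarrow> q \<in> V n \<Longrightarrow> r \<in> V l \<Longrightarrow> 1 \<le> i \<Longrightarrow> i < j \<Longrightarrow> j \<le> m \<Longrightarrow>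
      Option.bind (c m n i p q) (\<lambda>x. c (m + n - 1) l (j + n - 1) x r) =
      Option.bind (c m l j p r) (\<lambda>y. c (m + l - 1) n i y q)"
begin

text \<open>The semi-simplicial identity behind \<open>d\<^sup>2 = 0\<close>.\<close>

lemma contract_contract:
  assumes "decorated V t" "1 \<le> a" "a < b" "b < dnodes t"
  shows "Option.bind (contract c t b) (\<lambda>s. contract c s a) =
    Option.bind (contract c t a) (\<lambda>s. contract c s (b - 1))"
  using assms
proof (induction "dnodes t" arbitrary: t a b rule: less_induct)
  case less
  have "1 \<le> b" "a < dnodes t" using less.prems by auto
  from less.prems(2) \<open>a < dnodes t\<close> show ?case
  proof (cases rule: edge_cases)
    case root_a: (root p xs q us ys)
    from \<open>1 \<le> b\<close> less.prems(4) show ?thesis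
    proof (cases rule: edge_cases)
      \<comment> \<open>Two different children of the root are merged into it: the parallel
        axiom.\<close>
      case root_b: (root p' xs' q' us' ys')
      with root_a less.prems(3) obtain zs where zs: "xs' = xs @ DNode q us # zs" "ys = zs @ DNode q' us' # ys'"
        by (auto elim!: append_Cons_eq_append_Cons_cases)
      have eqs: "p' = p" "t = DNode p (xs @ DNode q us # zs @ DNode q' us' # ys')"
        using root_a root_b zs by auto
      let ?m = "length xs + 1 + length zs + 1 + length ys'"
      let ?j = "length xs + 1 + length zs + 1"
      have b: "contract c t b = map_option (\<lambda>r. DNode r ((xs @ DNode q us # zs) @ us' @ ys')) (c ?m (length us') ?j p q')"
        using contract_root[of c p "xs @ DNode q us # zs" q' us' ys'] root_b zs eqs by (simp add: add.assoc)
      have a: "contract c t a = map_option (\<lambda>r. DNode r (xs @ us @ zs @ DNode q' us' # ys')) (c ?m (length us) (length xs + 1) p q)"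
        using contract_root[of c p xs q us "zs @ DNode q' us' # ys'"] root_a eqs by (simp add: add.assoc)
      have ba: "contract c (DNode r ((xs @ DNode q us # zs) @ us' @ ys')) a =
          map_option (\<lambda>r. DNode r (xs @ us @ zs @ us' @ ys')) (c (?m + length us' - 1) (length us) (length xs + 1) r q)" for r
        using contract_root[of c r xs q us "zs @ us' @ ys'"] root_a by (simp add: ac_simps)
      have ab: "contract c (DNode r (xs @ us @ zs @ DNode q' us' # ys')) (b - 1) =
          map_option (\<lambda>r. DNode r (xs @ us @ zs @ us' @ ys')) (c (?m + length us - 1) (length us') (?j + length us - 1) r q')" for r
        using contract_root[of c r "xs @ us @ zs" q' us' ys'] root_b zs by (simp add: ac_simps)
      have "Option.bind (c ?m (length us) (length xs + 1) p q) (\<lambda>x. c (?m + length us - 1) (length us') (?j + length us - 1) x q') =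
          Option.bind (c ?m (length us') ?j p q') (\<lambda>y. c (?m + length us' - 1) (length us) (length xs + 1) y q)"
        using less.prems(1) eqs by (intro comp_parallel) (auto simp: add.assoc)
      then show ?thesis unfolding a b bind_map_option o_def ba ab by (simp flip: map_option_bind[unfolded o_def])
    next
      case child_b: (child p' xs' u ys' i)
      then have "xs @ DNode q us # ys = xs' @ u # ys'" "p' = p" using root_a by auto
      then show ?thesis
      proof (cases rule: append_Cons_eq_append_Cons_cases)
        case 1
        then have i: "1 \<le> i" "i < dnodes (DNode q us)" using child_b by auto
        have b_eq: "b = 1 + fnodes xs + i" using child_b 1 by simp
        have t_eq: "t = DNode p (xs @ DNode q us # ys)" using root_a by simp
        let ?m = "length xs + 1 + length ys"
        have b: "contract c t b = map_option (\<lambda>u. DNode p (xs @ u # ys)) (contract c (DNode q us) i)"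
          using contract_child[OF i, of c p xs ys] b_eq t_eq by simp
        have a: "contract c t a = map_option (\<lambda>r. DNode r (xs @ us @ ys)) (c ?m (length us) (length xs + 1) p q)"
          using contract_root[of c p xs q us ys] root_a by simp
        from i show ?thesis
        proof (cases rule: edge_cases)
          \<comment> \<open>The second edge hangs on the lower end of the first one: the sequential
            axiom.\<close>
          case i_root: (root q0 us1 v vs us2)
          then have us: "q0 = q" "us = us1 @ DNode v vs # us2" by auto
          have b': "contract c (DNode q us) i = map_option (\<lambda>r. DNode r (us1 @ vs @ us2)) (c (length us) (length vs) (length us1 + 1) q v)"
            using contract_root[of c q us1 v vs us2] i_root us by simp
          have ba: "contract c (DNode p (xs @ DNode r (us1 @ vs @ us2) # ys)) a =
            map_option (\<lambda>r. DNode r (xs @ us1 @ vs @ us2 @ ys)) (c ?m (length us + length vs - 1) (length xs + 1) p r)" for r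
            using contract_root[of c p xs r "us1 @ vs @ us2" ys] root_a us by (simp add: ac_simps)
          have ab: "contract c (DNode r (xs @ us @ ys)) (b - 1) =
            map_option (\<lambda>r. DNode r (xs @ us1 @ vs @ us2 @ ys))
              (c (?m + length us - 1) (length vs) (length xs + 1 + (length us1 + 1) - 1) r v)" for r
            using contract_root[of c r "xs @ us1" v vs "us2 @ ys"] b_eq i_root us by (simp add: ac_simps)
          have "Option.bind (c ?m (length us) (length xs + 1) p q)
                (\<lambda>x. c (?m + length us - 1) (length vs) (length xs + 1 + (length us1 + 1) - 1) x v) =
              Option.bind (c (length us) (length vs) (length us1 + 1) q v)
                (\<lambda>y. c ?m (length us + length vs - 1) (length xs + 1) p y)"
            using less.prems(1) t_eq us by (intro comp_sequential) (auto simp: add.assoc)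
          then show ?thesis unfolding a b b' bind_map_option o_def ba ab by (simp flip: map_option_bind[unfolded o_def])
        next
          \<comment> \<open>The two edges share no vertex, so the contractions commute without any
            axiom.\<close>
          case i_child: (child q0 us1 v us2 i')
          then have us: "q0 = q" "us = us1 @ v # us2" by auto
          have b': "contract c (DNode q us) i = map_option (\<lambda>v. DNode q (us1 @ v # us2)) (contract c v i')"
            using contract_child[of i' v c q us1 us2] i_child us by simp
          have ba: "contract c (DNode p (xs @ DNode q (us1 @ v # us2) # ys)) a =
            map_option (\<lambda>r. DNode r (xs @ us1 @ v # us2 @ ys)) (c ?m (length us) (length xs + 1) p q)" for v
            using contract_root[of c p xs q "us1 @ v # us2" ys] root_a us by simp
          have ab: "contract c (DNode r (xs @ us @ ys)) (b - 1) =
            map_option (\<lambda>v. DNode r (xs @ us1 @ v # us2 @ ys)) (contract c v i')" for r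
            using contract_child[of i' v c r "xs @ us1" "us2 @ ys"] b_eq i_child us by (simp add: ac_simps)
          show ?thesis unfolding a b b' bind_map_option o_def ba ab
            by (cases "contract c v i'"; cases "c ?m (length us) (length xs + 1) p q") auto
        qed
      next
        case (2 zs)
        have t_eq: "t = DNode p (xs @ DNode q us # zs @ u # ys')" using root_a 2 by simp
        let ?m = "length xs + 1 + length zs + 1 + length ys'"
        have b: "contract c t b = map_option (\<lambda>u. DNode p ((xs @ DNode q us # zs) @ u # ys')) (contract c u i)"
          using contract_child[of i u c p "xs @ DNode q us # zs" ys'] child_b 2 t_eq by simp
        have a: "contract c t a = map_option (\<lambda>r. DNode r (xs @ us @ zs @ u # ys')) (c ?m (length us) (length xs + 1) p q)"
          using contract_root[of c p xs q us "zs @ u # ys'"] root_a 2 by (simp add: add.assoc)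
        have ba: "contract c (DNode p ((xs @ DNode q us # zs) @ u # ys')) a =
            map_option (\<lambda>r. DNode r (xs @ us @ zs @ u # ys')) (c ?m (length us) (length xs + 1) p q)" for u
          using contract_root[of c p xs q us "zs @ u # ys'"] root_a by (simp add: add.assoc)
        have ab: "contract c (DNode r (xs @ us @ zs @ u # ys')) (b - 1) =
            map_option (\<lambda>u. DNode r (xs @ us @ zs @ u # ys')) (contract c u i)" for r
          using contract_child[of i u c r "xs @ us @ zs" ys'] child_b 2 by (simp add: add.assoc)
        show ?thesis unfolding a b bind_map_option o_def ba ab
          by (cases "contract c u i"; cases "c ?m (length us) (length xs + 1) p q") auto
      next
        \<comment> \<open>Excluded: the subtree containing edge \<open>b\<close> would precede the
          lower end of edge \<open>a\<close> in preorder, against \<open>a < b\<close>.\<close>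
        case (3 zs)
        then show ?thesis using root_a child_b less.prems(3) by simp
      qed
    qed
  next
    case child_a: (child p xs s ys i)
    from \<open>1 \<le> b\<close> less.prems(4) show ?thesis
    proof (cases rule: edge_cases)
      case root_b: (root p' xs' q us ys')
      then have "xs @ s # ys = xs' @ DNode q us # ys'" "p' = p" using child_a by auto
      then show ?thesis
      proof (cases rule: append_Cons_eq_append_Cons_cases)
        case 1
        then show ?thesis using root_b child_a less.prems(3) by simp
      next
        case (2 zs)
        let ?m = "length xs + 1 + length zs + 1 + length ys'"
        let ?j = "length xs + 1 + length zs + 1"
        have t_eq: "t = DNode p (xs @ s # zs @ DNode q us # ys')" using child_a 2 by simp
        have b: "contract c t b = map_option (\<lambda>r. DNode r ((xs @ s # zs) @ us @ ys')) (c ?m (length us) ?j p q)"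
          using contract_root[of c p "xs @ s # zs" q us ys'] root_b 2 t_eq by (simp add: add.assoc)
        have a: "contract c t a = map_option (\<lambda>s. DNode p (xs @ s # zs @ DNode q us # ys')) (contract c s i)"
          using contract_child[of i s c p xs "zs @ DNode q us # ys'"] child_a 2 by simp
        have ba: "contract c (DNode r ((xs @ s # zs) @ us @ ys')) a =
            map_option (\<lambda>s. DNode r (xs @ s # zs @ us @ ys')) (contract c s i)" for r
          using contract_child[of i s c r xs "zs @ us @ ys'"] child_a by simp
        have ab: "contract c (DNode p (xs @ s' # zs @ DNode q us # ys')) (b - 1) =
            map_option (\<lambda>r. DNode r (xs @ s' # zs @ us @ ys')) (c ?m (length us) ?j p q)"
          if "contract c s i = Some s'" for s'
          using contract_root[of c p "xs @ s' # zs" q us ys'] root_b 2 child_a(3,4)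
            contract_preserves[OF that] by (simp add: add.assoc)
        show ?thesis unfolding a b bind_map_option o_def ba using ab
          by (cases "contract c s i"; cases "c ?m (length us) ?j p q") auto
      next
        case (3 zs)
        then show ?thesis using child_a root_b less.prems(3) by simp
      qed
    next
      case child_b: (child p' xs' u ys' i')
      then have "xs @ s # ys = xs' @ u # ys'" "p' = p" using child_a by auto
      then show ?thesis
      proof (cases rule: append_Cons_eq_append_Cons_cases)
        case 1
        have t_eq: "t = DNode p (xs @ s # ys)" using child_a by simp
        have i': "i < i'" "i' < dnodes s" "b = 1 + fnodes xs + i'"
          using child_a child_b 1 less.prems(3) by auto
        have b: "contract c t b = map_option (\<lambda>s. DNode p (xs @ s # ys)) (contract c s i')"
          using contract_child[of i' s c p xs ys] i' child_a by simp
        have a: "contract c t a = map_option (\<lambda>s. DNode p (xs @ s # ys)) (contract c s i)"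
          using contract_child[of i s c p xs ys] child_a by simp
        have ba: "contract c (DNode p (xs @ s' # ys)) a = map_option (\<lambda>s. DNode p (xs @ s # ys)) (contract c s' i)"
          if "contract c s i' = Some s'" for s'
          using contract_child[of i s' c p xs ys] i' child_a(2,3) contract_preserves[OF that] by (simp add: add.assoc)
        have ab: "contract c (DNode p (xs @ s' # ys)) (b - 1) = map_option (\<lambda>s. DNode p (xs @ s # ys)) (contract c s' (i' - 1))"
          if "contract c s i = Some s'" for s'
          using contract_child[of "i' - 1" s' c p xs ys] i' child_a(2,3) contract_preserves[OF that] by (simp add: add.assoc)
        have "Option.bind (contract c s i') (\<lambda>s. contract c s i) = Option.bind (contract c s i) (\<lambda>s. contract c s (i' - 1))"
          using less.prems(1) i' child_a by (intro less.hyps) auto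
        then show ?thesis unfolding a b bind_map_option o_def using ab ba
          by (cases "contract c s i"; cases "contract c s i'") auto
      next
        case (2 zs)
        have t_eq: "t = DNode p (xs @ s # zs @ u # ys')" using child_a 2 by simp
        have b: "contract c t b = map_option (\<lambda>u. DNode p ((xs @ s # zs) @ u # ys')) (contract c u i')"
          using contract_child[of i' u c p "xs @ s # zs" ys'] child_b 2 t_eq by simp
        have a: "contract c t a = map_option (\<lambda>s. DNode p (xs @ s # zs @ u # ys')) (contract c s i)"
          using contract_child[of i s c p xs "zs @ u # ys'"] child_a 2 by simp
        have ba: "contract c (DNode p ((xs @ s # zs) @ u # ys')) a =
            map_option (\<lambda>s. DNode p (xs @ s # zs @ u # ys')) (contract c s i)" for u
          using contract_child[of i s c p xs "zs @ u # ys'"] child_a by simp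
        have ab: "contract c (DNode p (xs @ s' # zs @ u # ys')) (b - 1) =
            map_option (\<lambda>u. DNode p (xs @ s' # zs @ u # ys')) (contract c u i')"
          if "contract c s i = Some s'" for s'
          using contract_child[of i' u c p "xs @ s' # zs" ys'] child_b 2 child_a(3,4)
            contract_preserves[OF that] by (simp add: add.assoc)
        show ?thesis unfolding a b bind_map_option o_def ba using ab
          by (cases "contract c s i"; cases "contract c u i'") auto
      next
        case (3 zs)
        then show ?thesis using child_a child_b less.prems(3) by simp
      qed
    qed
  qed
qed

end


section \<open>The differential as an alternating sum of contractions, and why its square is
  zero\<close>

section \<open>The differential\<close>

definition diff :: "(nat \<Rightarrow> nat \<Rightarrow> nat \<Rightarrow> 'v \<Rightarrow> 'v \<Rightarrow> 'v option) \<Rightarrow> 'v dtree \<Rightarrow> 'v dtree \<Rightarrow>\<^sub>0 'a::field" where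
  "diff c t = (\<Sum>j\<in>{1..<dnodes t}. smul ((-1) ^ j) (opt_vec (contract c t j)))"

text \<open>The part of the differential of \<open>DNode p (xs @ ts)\<close> that comes from edges
  above or inside \<open>ts\<close>. Its recursion over the children, with \<open>xs\<close> already
  passed, matches that of \<open>bar_diff\<close>.\<close>

definition diff_below :: "(nat \<Rightarrow> nat \<Rightarrow> nat \<Rightarrow> 'v \<Rightarrow> 'v \<Rightarrow> 'v option) \<Rightarrow> 'v \<Rightarrow> 'v dtree list \<Rightarrow> 'v dtree list \<Rightarrow>
    'v dtree \<Rightarrow>\<^sub>0 'a::field" where
  "diff_below c p xs ts =
     (\<Sum>j<fnodes ts. smul ((-1) ^ (1 + fnodes xs + j)) (opt_vec (contract_below c p xs ts j)))"

lemma diff_DLeaf [simp]: "diff c DLeaf = 0"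
  by (simp add: diff_def)

lemma diff_DNode: "diff c (DNode p ts) = diff_below c p [] ts"
proof -
  have "diff c (DNode p ts) =
      (\<Sum>j\<in>Suc ` {..<fnodes ts}. smul ((-1) ^ j) (opt_vec (contract_below c p [] ts (j - 1))))"
    unfolding diff_def image_Suc_lessThan
    by (intro sum.cong) (auto simp: contract.simps(2))
  then show ?thesis
    by (simp add: sum.reindex diff_below_def)
qed

lemma diff_below_Nil [simp]: "diff_below c p xs [] = 0"
  by (simp add: diff_below_def)

definition contract_top :: "(nat \<Rightarrow> nat \<Rightarrow> nat \<Rightarrow> 'v \<Rightarrow> 'v \<Rightarrow> 'v option) \<Rightarrow> 'v \<Rightarrow> 'v dtree list \<Rightarrow> 'v dtree \<Rightarrow>
    'v dtree list \<Rightarrow> 'v dtree option" where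
  "contract_top c p xs t ys =
     (case t of
        DLeaf \<Rightarrow> None
      | DNode q us \<Rightarrow> map_option (\<lambda>r. DNode r (xs @ us @ ys))
          (c (length xs + 1 + length ys) (length us) (length xs + 1) p q))"

lemma sum_lessThan_add:
  fixes f :: "nat \<Rightarrow> 'b::comm_monoid_add"
  shows "(\<Sum>j<m + n. f j) = (\<Sum>j<m. f j) + (\<Sum>j<n. f (m + j))"
  by (induction n) (simp_all add: add.assoc)

text \<open>Counted from the first vertex of \<open>t\<close>, the edge above \<open>t\<close> has
  number 0 and the edges inside keep their numbers in \<open>t\<close>, so the common sign
  \<open>(-1) ^ (1 + fnodes xs)\<close> splits off.\<close>

lemma diff_below_Cons:
  "(diff_below c p xs (t # ts) :: 'v dtree \<Rightarrow>\<^sub>0 'a::field) =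
     smul ((-1) ^ (1 + fnodes xs)) (opt_vec (contract_top c p xs t ts) +
       lin_ext (\<lambda>t'. basis_vec (DNode p (xs @ t' # ts))) (diff c t)) +
     diff_below c p (xs @ [t]) ts"
proof -
  let ?s = "\<lambda>j. smul ((-1) ^ (1 + fnodes xs + j)) (opt_vec (contract_below c p xs (t # ts) j)) ::
    'v dtree \<Rightarrow>\<^sub>0 'a"
  have "diff_below c p xs (t # ts) = (\<Sum>j<dnodes t. ?s j) + (\<Sum>j<fnodes ts. ?s (dnodes t + j))"
    by (simp add: diff_below_def sum_lessThan_add)
  also have "(\<Sum>j<fnodes ts. ?s (dnodes t + j)) = diff_below c p (xs @ [t]) ts"
    by (simp add: diff_below_def add.assoc)
  also have "(\<Sum>j<dnodes t. ?s j) = smul ((-1) ^ (1 + fnodes xs)) (opt_vec (contract_top c p xs t ts) +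
       lin_ext (\<lambda>t'. basis_vec (DNode p (xs @ t' # ts))) (diff c t))"
  proof (cases t)
    case DLeaf
    then show ?thesis by (simp add: contract_top_def)
  next
    case (DNode q us)
    then have "{..<dnodes t} = insert 0 {1..<dnodes t}" by auto
    then have "(\<Sum>j<dnodes t. ?s j) = ?s 0 + (\<Sum>j\<in>{1..<dnodes t}. ?s j)" by simp
    also have "?s 0 = smul ((-1) ^ (1 + fnodes xs)) (opt_vec (contract_top c p xs t ts))"
      by (simp add: DNode contract_top_def)
    also have "(\<Sum>j\<in>{1..<dnodes t}. ?s j) = (\<Sum>j\<in>{1..<dnodes t}. smul ((-1) ^ (1 + fnodes xs))
        (smul ((-1) ^ j) (lin_ext (\<lambda>t'. basis_vec (DNode p (xs @ t' # ts))) (opt_vec (contract c t j)))))"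
    proof (rule sum.cong)
      fix j assume "j \<in> {1..<dnodes t}"
      then have "(opt_vec (contract_below c p xs (t # ts) j) :: 'v dtree \<Rightarrow>\<^sub>0 'a) =
          lin_ext (\<lambda>t'. basis_vec (DNode p (xs @ t' # ts))) (opt_vec (contract c t j))"
        by (cases "contract c t j") auto
      then show "?s j = smul ((-1) ^ (1 + fnodes xs))
          (smul ((-1) ^ j) (lin_ext (\<lambda>t'. basis_vec (DNode p (xs @ t' # ts))) (opt_vec (contract c t j))))"
        by (simp only: free_vs.scale_scale power_add)
    qed simp
    also have "\<dots> = smul ((-1) ^ (1 + fnodes xs)) (lin_ext (\<lambda>t'. basis_vec (DNode p (xs @ t' # ts))) (diff c t))"
      by (simp only: diff_def lin_ext_sum lin_ext_smul free_vs.scale_sum_right)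
    finally show ?thesis by (simp only: free_vs.scale_right_distrib)
  qed
  finally show ?thesis .
qed

text \<open>Composition in an operad is total, hence \<open>Some\<close>. One sum over the edges
  reduces properties of the differential to statements about a single contraction.\<close>

lemma bar_diff_eq_diff:
  "bar_diff P t = (diff (\<lambda>m n i p q. Some (pcomp P m n i p q)) t :: _ \<Rightarrow>\<^sub>0 'a::field)"
proof (induction t)
  case DLeaf
  then show ?case by simp
next
  case (DNode p ts)
  let ?c = "\<lambda>m n i p q. Some (pcomp P m n i p q)"
  define f :: "'b dtree list \<Rightarrow> nat \<Rightarrow> 'b dtree \<Rightarrow>\<^sub>0 'a" where "f ts i = smul ((-1) ^ (1 + fnodes (take i ts)))
        ((case ts ! i of
            DLeaf \<Rightarrow> 0
          | DNode q us \<Rightarrow>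
              basis_vec (DNode (pcomp P (length ts) (length us) (i + 1) p q)
                (take i ts @ us @ drop (i + 1) ts)))
         + lin_ext (\<lambda>t. basis_vec (DNode p (ts[i := t]))) (bar_diff P (ts ! i)))" for ts i
  have "(\<Sum>i<length ys. f (xs @ ys) (length xs + i)) = diff_below ?c p xs ys" if "set ys \<subseteq> set ts" for xs ys
    using that
  proof (induction ys arbitrary: xs)
    case (Cons y ys)
    have "(\<Sum>i<length (y # ys). f (xs @ y # ys) (length xs + i)) =
        f (xs @ y # ys) (length xs) + (\<Sum>i<length ys. f ((xs @ [y]) @ ys) (length (xs @ [y]) + i))"
      by (simp add: sum.lessThan_Suc_shift del: sum.lessThan_Suc)
    also have "(\<Sum>i<length ys. f ((xs @ [y]) @ ys) (length (xs @ [y]) + i)) = diff_below ?c p (xs @ [y]) ys"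
      using Cons.prems by (intro Cons.IH) auto
    also have "f (xs @ y # ys) (length xs) = smul ((-1) ^ (1 + fnodes xs))
       (opt_vec (contract_top ?c p xs y ys) + lin_ext (\<lambda>t'. basis_vec (DNode p (xs @ t' # ys))) (diff ?c y))"
      using DNode.IH[of y] Cons.prems by (auto simp: f_def contract_top_def split: dtree.split)
    finally show ?case by (simp only: diff_below_Cons)
  qed simp
  from this[of ts "[]"] show ?case by (simp add: diff_DNode f_def)
qed

text \<open>The terms cancel in pairs: for \<open>b \<le> a\<close>, contracting
  \<open>a + 1\<close> and then \<open>b\<close> gives the same tree as contracting \<open>b\<close>
  and then \<open>a\<close>, with the opposite sign.\<close>

lemma (in partial_composition) diff_diff:
  assumes "decorated V t"
  shows "lin_ext (diff c) (diff c t) = (0 :: _ \<Rightarrow>\<^sub>0 'a::field)"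
proof -
  let ?F = "\<lambda>b a. Option.bind (contract c t b) (\<lambda>s. contract c s a)"
  let ?n = "dnodes t"
  let ?g = "\<lambda>(b, a). smul ((-1) ^ (a + b)) (opt_vec (?F b a)) :: _ \<Rightarrow>\<^sub>0 'a"
  have "lin_ext (diff c) (opt_vec (contract c t b)) =
      (\<Sum>a\<in>{1..<?n - 1}. smul ((-1) ^ a) (opt_vec (?F b a)) :: _ \<Rightarrow>\<^sub>0 'a)" if "b \<in> {1..<?n}" for b
    using that contract_preserves[of c t b] by (cases "contract c t b") (auto simp: diff_def)
  then have "lin_ext (diff c) (diff c t) =
      (\<Sum>b\<in>{1..<?n}. \<Sum>a\<in>{1..<?n - 1}. ?g (b, a))"
    by (simp add: diff_def[of c t] lin_ext_sum lin_ext_smul free_vs.scale_sum_right power_add mult.commute)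
  also have "\<dots> = sum ?g ({1..<?n} \<times> {1..<?n - 1})"
    by (simp add: sum.cartesian_product)
  also have "{1..<?n} \<times> {1..<?n - 1} =
      {(b, a). 1 \<le> a \<and> a < b \<and> b < ?n} \<union> {(b, a). 1 \<le> b \<and> b \<le> a \<and> a < ?n - 1}" (is "_ = ?A \<union> ?B")
    by auto
  also have "sum ?g (?A \<union> ?B) = sum ?g ?A + sum ?g ?B"
    by (rule sum.union_disjoint)
      (auto intro: finite_subset[of _ "{..<?n} \<times> {..<?n}"])
  also have "sum ?g ?A = (\<Sum>(b, a)\<in>?B. ?g (a + 1, b))"
    by (rule sum.reindex_bij_witness[of _ "\<lambda>(b, a). (a + 1, b)" "\<lambda>(b, a). (a, b - 1)"])
      (auto dest!: less_imp_Suc_add)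
  also have "\<dots> = (\<Sum>x\<in>?B. - ?g x)"
  proof (rule sum.cong)
    fix x assume "x \<in> ?B"
    then obtain b a where x: "x = (b, a)" "1 \<le> b" "b \<le> a" "a < ?n - 1" by auto
    then have "?F (a + 1) b = ?F b a"
      using contract_contract[OF assms, of b "a + 1"] by simp
    then show "(case x of (b, a) \<Rightarrow> ?g (a + 1, b)) = - ?g x"
      using x by (simp add: free_vs.scale_minus_left add.commute)
  qed simp
  also have "\<dots> + sum ?g ?B = 0" by (simp add: sum_negf)
  finally show ?thesis .
qed


section \<open>The bar complex in the basis of normal combs, and the effect of contractions on
  skeletons\<close>

section \<open>The complex of trees decorated by combs\<close>

context comb_normal_form
begin

text \<open>Arity at least 2 leaves out the unit: these words are a basis of the augmentation ideal,
  which decorates the vertices of the bar construction.\<close>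

definition normal_words :: "nat \<Rightarrow> 'x list set" where
  "normal_words m = {ws. set ws \<subseteq> G \<and> nfl (comb ws) = Some ws \<and> length ws + 1 = m \<and> 2 \<le> m}"

abbreviation wcomp :: "nat \<Rightarrow> nat \<Rightarrow> nat \<Rightarrow> 'x list \<Rightarrow> 'x list \<Rightarrow> 'x list option" where
  "wcomp m n i v w \<equiv> comp v i w"

text \<open>The operad axioms descend from grafting, as reducing a factor does not change the normal
  form of a composite.\<close>

sublocale words: partial_composition normal_words wcomp
proof
  fix p q r :: "'x list" and m n i :: nat
  assume pq: "p \<in> normal_words m" "q \<in> normal_words n" "1 \<le> i" "i \<le> m" and r: "comp p i q = Some r"
  have "set_tree (graft (comb p) i (comb q)) \<subseteq> G"
    using pq by (auto simp: normal_words_def)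
  from nfl_SomeD[OF this r[unfolded comp_def]] show "r \<in> normal_words (m + n - 1)"
    using pq by (auto simp: normal_words_def)
next
  fix p q r :: "'x list" and m n l i j :: nat
  assume *: "p \<in> normal_words m" "q \<in> normal_words n" "r \<in> normal_words l" "1 \<le> i" "i \<le> m" "1 \<le> j" "j \<le> n"
  let ?P = "comb p" and ?Q = "comb q" and ?R = "comb r"
  have "Option.bind (comp p i q) (\<lambda>x. comp x (i + j - 1) r) = nfl (graft (graft ?P i ?Q) (i + j - 1) ?R)"
    unfolding comp_def
    by (rule nfl_graft_left[symmetric]) (use * in \<open>auto simp: normal_words_def size1_graft\<close>)
  also have "graft (graft ?P i ?Q) (i + j - 1) ?R = graft ?P i (graft ?Q j ?R)"
    using * by (intro graft_graft_sequential) (auto simp: normal_words_def)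
  also have "nfl \<dots> = Option.bind (comp q j r) (\<lambda>y. comp p i y)"
    unfolding comp_def
    by (rule nfl_graft_right) (use * in \<open>auto simp: normal_words_def size1_graft\<close>)
  finally show "Option.bind (comp p i q) (\<lambda>x. comp x (i + j - 1) r) =
      Option.bind (comp q j r) (\<lambda>y. comp p i y)" .
next
  fix p q r :: "'x list" and m n l i j :: nat
  assume *: "p \<in> normal_words m" "q \<in> normal_words n" "r \<in> normal_words l" "1 \<le> i" "i < j" "j \<le> m"
  let ?P = "comb p" and ?Q = "comb q" and ?R = "comb r"
  have n: "n = size1 ?Q" using * by (auto simp: normal_words_def)
  have "Option.bind (comp p i q) (\<lambda>x. comp x (j + n - 1) r) = nfl (graft (graft ?P i ?Q) (j + n - 1) ?R)"
    unfolding comp_def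
    by (rule nfl_graft_left[symmetric]) (use * in \<open>auto simp: normal_words_def size1_graft\<close>)
  also have "graft (graft ?P i ?Q) (j + n - 1) ?R = graft (graft ?P j ?R) i ?Q"
    unfolding n using * by (intro graft_graft_parallel) (auto simp: normal_words_def)
  also have "nfl \<dots> = Option.bind (comp p j r) (\<lambda>y. comp y i q)"
    unfolding comp_def
    by (rule nfl_graft_left) (use * in \<open>auto simp: normal_words_def size1_graft\<close>)
  finally show "Option.bind (comp p i q) (\<lambda>x. comp x (j + n - 1) r) =
      Option.bind (comp p j r) (\<lambda>y. comp y i q)" .
qed

abbreviation wdecorated :: "'x list dtree \<Rightarrow> bool" where
  "wdecorated \<equiv> decorated normal_words"

abbreviation wdiff :: "'x list dtree \<Rightarrow> 'x list dtree \<Rightarrow>\<^sub>0 'a::field" where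
  "wdiff \<equiv> diff wcomp"

text \<open>A decoration with one label has two children; with more labels, the edge from the first
  label to the second lies inside the comb. The homotopy formula is proved along this
  distinction.\<close>

lemma wdecorated_DNodeE:
  assumes "wdecorated (DNode p ts)"
  obtains (single) w l r where "p = [w]" "ts = [l, r]"
  | (merged) w v ws t ts' where "p = w # v # ws" "ts = t # ts'" "length ts' = length ws + 2"
proof (cases p)
  case Nil
  then show thesis using assms by (auto simp: normal_words_def)
next
  case (Cons w p')
  show thesis
  proof (cases p')
    case Nil
    then show thesis using Cons assms single by (auto simp: normal_words_def length_Suc_conv Suc_length_conv numeral_2_eq_2)
  next
    case (Cons v ws)
    then show thesis using \<open>p = w # p'\<close> assms merged by (auto simp: normal_words_def length_Suc_conv Suc_length_conv)
  qed
qed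

lemma wdecorated_DNodeD:
  assumes "wdecorated (DNode p ts)"
  shows "\<exists>v q t ts'. p = v # q \<and> ts = t # ts'"
  using assms by (rule wdecorated_DNodeE) auto

text \<open>
  The binary tree obtained from a tree decorated by combs by composing the combs in the free operad.
\<close>

fun grow :: "'x list \<Rightarrow> 'x tree list \<Rightarrow> 'x tree" where
  "grow (w # ws) (t # ts) = Node t w (grow ws ts)"
| "grow [] (t # ts) = t"
| "grow ws [] = Leaf"

fun skeleton :: "'x list dtree \<Rightarrow> 'x tree" where
  "skeleton DLeaf = Leaf"
| "skeleton (DNode ws ts) = grow ws (map skeleton ts)"

lemma size1_grow: "length ts = length ws + 1 \<Longrightarrow> size1 (grow ws ts) = sum_list (map size1 ts)"
  by (induction ws ts rule: grow.induct) auto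

lemma left_weight_grow: "length ts = length ws + 1 \<Longrightarrow>
    left_weight (grow ws ts) = sum_list (map left_weight ts) + sum_list (map size1 (butlast ts))"
  by (induction ws ts rule: grow.induct) auto

lemma label_weight_grow: "length ts = length ws + 1 \<Longrightarrow>
    label_weight wt (grow ws ts) = sum_list (map wt ws) + sum_list (map (label_weight wt) ts)"
  by (induction ws ts rule: grow.induct) auto

text \<open>Two combs joined at the last child form one comb, which is why a contraction there can
  keep the skeleton.\<close>

lemma grow_append: "length xs = length ws \<Longrightarrow> grow (ws @ vs) (xs @ us) = grow ws (xs @ [grow vs us])"
  by (induction xs ws rule: list_induct2) auto

lemma tree_less_iff_size1: "tree_less f s t \<longleftrightarrow> size1 s = size1 t \<and>
     (left_weight s < left_weight t \<or>
      left_weight s = left_weight t \<and> label_weight f s < label_weight f t)"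
  by (simp add: tree_less_def size1_size)

lemma tree_less_grow:
  assumes "tree_less wt t t'" "length xs + length ys = length ws"
  shows "tree_less wt (grow ws (xs @ t # ys)) (grow ws (xs @ t' # ys))"
  using assms by (cases "ys = []")
    (auto simp: tree_less_iff_size1 size1_grow left_weight_grow label_weight_grow butlast_append)

lemma sum_list_size1_pos: "ts \<noteq> [] \<Longrightarrow> 0 < sum_list (map size1 ts)"
  by (cases ts) (auto simp: size1_size)

text \<open>At a child other than the last, the composite of the two combs branches to the left, and
  its normal form has less left weight. At the last child the words are concatenated: either the
  result is normal and the skeleton stays, or the label weight drops.\<close>

lemma contract_top_cases:
  assumes "wdecorated (DNode p (xs @ t # ys))" "contract_top wcomp p xs t ys = Some s"
  obtains (less) "tree_less wt (skeleton s) (skeleton (DNode p (xs @ t # ys)))"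
  | (merge) q us where "t = DNode q us" "ys = []" "s = DNode (p @ q) (xs @ us)"
      "nfl (comb (p @ q)) = Some (p @ q)"
proof -
  obtain q us r where t: "t = DNode q us" "s = DNode r (xs @ us @ ys)" "comp p (length xs + 1) q = Some r"
    using assms(2) by (cases t) (auto simp: contract_top_def)
  have len: "length p = length xs + length ys" "length us = length q + 1" "set p \<subseteq> G" "set q \<subseteq> G" "q \<noteq> []"
    using assms(1) t by (auto simp: normal_words_def)
  have "set_tree (graft (comb p) (length xs + 1) (comb q)) \<subseteq> G" using len by auto
  then have r: "length r = length p + length q"
    using t(3) nfl_SomeD unfolding comp_def by fastforce
  have "us \<noteq> []" "butlast us \<noteq> []" using len by (cases us; auto)+
  show thesis
  proof (cases "ys = []")
    case False
    \<comment> \<open>This is the drop of the left weight: the number of leaves of the skeletons of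
      \<open>us\<close> without the last one.\<close>
    have "0 < sum_list (map size1 (butlast (map skeleton us)))"
      using \<open>butlast us \<noteq> []\<close> by (intro sum_list_size1_pos) (simp flip: map_butlast)
    then have "tree_less wt (skeleton s) (skeleton (DNode p (xs @ t # ys)))"
      using False len r t \<open>us \<noteq> []\<close>
      by (simp add: tree_less_iff_size1 size1_grow left_weight_grow butlast_append)
    then show thesis by (rule less)
  next
    case True
    then have "nfl (comb (p @ q)) = Some r"
      using t(3) len graft_comb_comb[of p q] by (simp add: comp_def)
    then consider "r = p @ q" | "sum_list (map wt r) < sum_list (map wt (p @ q))"
      using nfl_comb_wt[of "p @ q" r] len by auto
    then show thesis
    proof cases
      case 1
      then show thesis using merge[of q us] t True \<open>nfl (comb (p @ q)) = Some r\<close> by auto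
    next
      case 2
      then have "tree_less wt (skeleton s) (skeleton (DNode p (xs @ t # ys)))"
        using True len r t \<open>us \<noteq> []\<close>
        by (simp add: tree_less_iff_size1 size1_grow left_weight_grow label_weight_grow butlast_append)
      then show thesis by (rule less)
    qed
  qed
qed

lemma skeleton_contract:
  assumes "wdecorated t" "contract wcomp t j = Some s" "1 \<le> j" "j < dnodes t"
  shows "skeleton s = skeleton t \<or> tree_less wt (skeleton s) (skeleton t)"
  using assms
proof (induction "dnodes t" arbitrary: t s j rule: less_induct)
  case less
  from less.prems(3,4) show ?case
  proof (cases rule: edge_cases)
    case (root p xs q us ys)
    have "contract_top wcomp p xs (DNode q us) ys = Some s"
      using less.prems(2) unfolding root contract_root by (simp add: contract_top_def)
    with less.prems(1)[unfolded root(1)] show ?thesis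
    proof (cases rule: contract_top_cases)
      case (merge q' us')
      have "length p = length xs" using less.prems(1) root merge by (auto simp: normal_words_def)
      then show ?thesis using merge root by (simp add: grow_append)
    qed (simp add: root)
  next
    case (child p xs u ys i)
    have "map_option (\<lambda>u'. DNode p (xs @ u' # ys)) (contract wcomp u i) = Some s"
      using less.prems(2) unfolding child(1,2) contract_child[OF child(3,4)] .
    then obtain u' where u': "contract wcomp u i = Some u'" "s = DNode p (xs @ u' # ys)" by auto
    then have "skeleton u' = skeleton u \<or> tree_less wt (skeleton u') (skeleton u)"
      using less.hyps[of u i u'] less.prems(1) child by auto
    moreover have "length xs + length ys = length p" using less.prems(1) child by (auto simp: normal_words_def)
    ultimately show ?thesis using child u' tree_less_grow[of _ _ "map skeleton xs" "map skeleton ys"] by auto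
  qed
qed

lemma keys_wdiff:
  assumes "wdecorated t" "s \<in> Poly_Mapping.keys (wdiff t :: _ \<Rightarrow>\<^sub>0 'a::field)"
  shows "wdecorated s" "dleaves s = dleaves t" "dnodes t = dnodes s + 1"
    "skeleton s = skeleton t \<or> tree_less wt (skeleton s) (skeleton t)"
proof -
  from subsetD[OF keys_sum assms(2)[unfolded diff_def]]
  obtain j where j: "j \<in> {1..<dnodes t}"
    "s \<in> Poly_Mapping.keys (smul ((-1) ^ j) (opt_vec (contract wcomp t j) :: _ \<Rightarrow>\<^sub>0 'a))" ..
  from subsetD[OF keys_smul j(2)] have s: "contract wcomp t j = Some s" by simp
  have "wdecorated s"
    by (rule decorated_contract[OF _ assms(1) s]) (use j(1) words.comp_closed in auto)
  with s show "wdecorated s" "dleaves s = dleaves t" "dnodes t = dnodes s + 1"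
    "skeleton s = skeleton t \<or> tree_less wt (skeleton s) (skeleton t)"
    using contract_preserves[of wcomp t j s] skeleton_contract[of t j s] j(1) assms(1)
    by auto
qed


section \<open>Congruence of leading terms, in place of the graded complex of the filtration by
  skeletons\<close>

subsection \<open>Calculation up to lower terms\<close>

definition lower :: "'x tree \<Rightarrow> ('x list dtree \<Rightarrow>\<^sub>0 'a::field) set" where
  "lower T = {x. Poly_Mapping.keys x \<subseteq> {s. tree_less wt (skeleton s) T}}"

lemma subspace_lower: "free_vs.subspace (lower T)"
  unfolding lower_def by (rule subspace_keys_subset)

lemma basis_vec_in_lower [simp]: "basis_vec s \<in> lower T \<longleftrightarrow> tree_less wt (skeleton s) T"
  by (simp add: lower_def)

definition lcong :: "'x tree \<Rightarrow> ('x list dtree \<Rightarrow>\<^sub>0 'a::field) \<Rightarrow> ('x list dtree \<Rightarrow>\<^sub>0 'a) \<Rightarrow> bool" where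
  "lcong T x y \<longleftrightarrow> x - y \<in> lower T"

lemma lcong_refl [simp]: "lcong T x x"
  by (simp add: lcong_def free_vs.subspace_0[OF subspace_lower])

lemma lcong_sym: "lcong T x y \<Longrightarrow> lcong T y x"
  using free_vs.subspace_neg[OF subspace_lower, of "x - y"] by (simp add: lcong_def)

lemma lcong_trans [trans]: "lcong T x y \<Longrightarrow> lcong T y z \<Longrightarrow> lcong T x z"
  using free_vs.subspace_add[OF subspace_lower, of "x - y" T "y - z"] by (simp add: lcong_def)

lemma lcong_add: "lcong T x y \<Longrightarrow> lcong T x' y' \<Longrightarrow> lcong T (x + x') (y + y')"
  using free_vs.subspace_add[OF subspace_lower, of "x - y" T "x' - y'"] by (simp add: lcong_def algebra_simps)

lemma lcong_smul: "lcong T x y \<Longrightarrow> lcong T (smul a x) (smul a y)"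
  using free_vs.subspace_scale[OF subspace_lower, of "x - y" T a]
  by (simp add: lcong_def free_vs.scale_right_diff_distrib)

lemma lcong_uminus: "lcong T x y \<Longrightarrow> lcong T (- x) (- y)"
  using lcong_smul[of T x y "-1"] by simp

lemma lcong_zero_iff: "lcong T x 0 \<longleftrightarrow> x \<in> lower T"
  by (simp add: lcong_def)

lemma lower_lcong: "x \<in> lower T \<Longrightarrow> y \<in> lower T \<Longrightarrow> lcong T x y"
  unfolding lcong_def by (rule free_vs.subspace_diff[OF subspace_lower])

lemma lcong_lin_ext:
  assumes "\<And>s. s \<in> Poly_Mapping.keys x \<Longrightarrow> lcong T (f s) (g s)"
  shows "lcong T (lin_ext f x) (lin_ext g x)"
  unfolding lcong_def lin_ext_fun_diff[symmetric]
  using assms by (intro lin_ext_in_subspace subspace_lower) (simp add: lcong_def)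


section \<open>A homotopy contracting each cube, and exactness off the diagonal\<close>

subsection \<open>The contracting homotopy\<close>

text \<open>The tree is meant as the right subtree of a node labelled \<open>w\<close>. Only right
  edges between internal nodes can lie inside a comb.\<close>

fun normal_edge :: "'x \<Rightarrow> 'x tree \<Rightarrow> bool" where
  "normal_edge w Leaf \<longleftrightarrow> False"
| "normal_edge w (Node l v r) \<longleftrightarrow> normal_pair w v"

lemma normal_edge_skeletonE:
  assumes "wdecorated r" "normal_edge w (skeleton r)"
  obtains v q u us where "r = DNode (v # q) (u # us)" "normal_pair w v"
proof -
  obtain p ts where "r = DNode p ts" using assms(2) by (cases r) auto
  moreover from this obtain v q u us where "p = v # q" "ts = u # us"
    using assms(1) wdecorated_DNodeD[of p ts] by auto
  ultimately show thesis using that assms(2) by auto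
qed

fun has_normal_edge :: "'x tree \<Rightarrow> bool" where
  "has_normal_edge Leaf \<longleftrightarrow> False"
| "has_normal_edge (Node l w r) \<longleftrightarrow> normal_edge w r \<or> has_normal_edge l \<or> has_normal_edge r"

abbreviation bnode :: "'x \<Rightarrow> 'x list dtree \<Rightarrow> 'x list dtree \<Rightarrow> 'x list dtree" where
  "bnode w l r \<equiv> DNode [w] [l, r]"

text \<open>
  The chains with skeleton \<open>T\<close> correspond to the sets of normal edges of \<open>T\<close>, namely the edges inside
  the combs. Up to lower terms the differential adds an edge to this set. The homotopy removes one
  fixed normal edge, the first one in the preorder of the upper ends.
\<close>

fun homotopy :: "'x list dtree \<Rightarrow> 'x list dtree \<Rightarrow>\<^sub>0 'a::field" where
  "homotopy DLeaf = 0"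
| "homotopy (DNode [] ts) = 0"
| "homotopy (DNode (w # ws) []) = 0"
| "homotopy (DNode (w # ws) (t # ts)) =
     (if ws \<noteq> [] then smul ((-1) ^ (1 + dnodes t)) (basis_vec (bnode w t (DNode ws ts)))
      else case ts of
        [] \<Rightarrow> 0
      | r # _ \<Rightarrow>
          if normal_edge w (skeleton r) then 0
          else if has_normal_edge (skeleton t) then - lin_ext (\<lambda>l. basis_vec (bnode w l r)) (homotopy t)
          else smul ((-1) ^ (1 + dnodes t)) (lin_ext (\<lambda>r'. basis_vec (bnode w t r')) (homotopy r)))"

lemma keys_homotopyE:
  assumes "s \<in> Poly_Mapping.keys (homotopy t :: _ \<Rightarrow>\<^sub>0 'a::field)"
  obtains (split) w v ws t1 ts where "t = DNode (w # v # ws) (t1 # ts)" "s = bnode w t1 (DNode (v # ws) ts)"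
  | (left) w l r rs l' where "t = DNode [w] (l # r # rs)" "s = bnode w l' r" "\<not> normal_edge w (skeleton r)"
      "has_normal_edge (skeleton l)" "l' \<in> Poly_Mapping.keys (homotopy l :: _ \<Rightarrow>\<^sub>0 'a)"
  | (right) w l r rs r' where "t = DNode [w] (l # r # rs)" "s = bnode w l r'" "\<not> normal_edge w (skeleton r)"
      "\<not> has_normal_edge (skeleton l)" "r' \<in> Poly_Mapping.keys (homotopy r :: _ \<Rightarrow>\<^sub>0 'a)"
proof -
  obtain w ws t1 ts where t: "t = DNode (w # ws) (t1 # ts)"
    using assms by (cases t rule: homotopy.cases) auto
  show thesis
  proof (cases ws)
    case (Cons v ws')
    then have "s = bnode w t1 (DNode ws ts)" using assms t by (simp add: keys_smul_eq)
    then show thesis using split t Cons by simp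
  next
    case Nil
    then obtain r rs where ts: "ts = r # rs" using assms t by (cases ts) auto
    then have no_edge: "\<not> normal_edge w (skeleton r)" using assms t Nil by auto
    show thesis
    proof (cases "has_normal_edge (skeleton t1)")
      case True
      then have "s \<in> Poly_Mapping.keys (lin_ext (\<lambda>l. basis_vec (bnode w l r)) (homotopy t1) :: _ \<Rightarrow>\<^sub>0 'a)"
        using assms t Nil ts no_edge by simp
      then obtain l' where "l' \<in> Poly_Mapping.keys (homotopy t1 :: _ \<Rightarrow>\<^sub>0 'a)" "s = bnode w l' r"
        by (rule in_keys_lin_extE) simp
      then show thesis using left t Nil ts no_edge True by simp
    next
      case False
      then have "s \<in> Poly_Mapping.keys (lin_ext (\<lambda>r'. basis_vec (bnode w t1 r')) (homotopy r) :: _ \<Rightarrow>\<^sub>0 'a)"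
        using assms t Nil ts no_edge by (simp add: keys_smul_eq)
      then obtain r' where "r' \<in> Poly_Mapping.keys (homotopy r :: _ \<Rightarrow>\<^sub>0 'a)" "s = bnode w t1 r'"
        by (rule in_keys_lin_extE) simp
      then show thesis using right t Nil ts no_edge False by simp
    qed
  qed
qed

lemma skeleton_homotopy:
  "s \<in> Poly_Mapping.keys (homotopy t :: _ \<Rightarrow>\<^sub>0 'a::field) \<Longrightarrow> skeleton s = skeleton t"
proof (induction "dnodes t" arbitrary: s t rule: less_induct)
  case less
  from less.prems show ?case
  proof (cases rule: keys_homotopyE)
    case (left w l r rs l')
    then have "skeleton l' = skeleton l" by (intro less.hyps) auto
    then show ?thesis using left by simp
  next
    case (right w l r rs r')
    then have "skeleton r' = skeleton r" by (intro less.hyps) auto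
    then show ?thesis using right by simp
  qed simp
qed

text \<open>By locality a normal comb splits after its first label into two normal combs, so the
  homotopy stays among decorated trees.\<close>

lemma normal_words_Cons:
  assumes "w # v # ws \<in> normal_words (Suc m)"
  shows "[w] \<in> normal_words 2" "v # ws \<in> normal_words m" "normal_pair w v"
  using assms nfl_comb_iff[of "w # v # ws"] nfl_comb_iff[of "v # ws"] nfl_comb_iff[of "[w]"]
  by (auto simp: normal_words_def)

lemma keys_homotopy:
  assumes "wdecorated t" "s \<in> Poly_Mapping.keys (homotopy t :: _ \<Rightarrow>\<^sub>0 'a::field)"
  shows "wdecorated s \<and> dleaves s = dleaves t \<and> dnodes s = dnodes t + 1"
  using assms
proof (induction "dnodes t" arbitrary: s t rule: less_induct)
  case less
  from less.prems(2) show ?case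
  proof (cases rule: keys_homotopyE)
    case (split w v ws t1 ts)
    then show ?thesis using less.prems(1) normal_words_Cons[of w v ws "length ts"] by (simp add: numeral_2_eq_2)
  next
    case (left w l r rs l')
    then have "wdecorated l' \<and> dleaves l' = dleaves l \<and> dnodes l' = dnodes l + 1"
      using less.prems(1) by (intro less.hyps) auto
    moreover have "rs = []" using less.prems(1) left by (auto simp: normal_words_def)
    ultimately show ?thesis using left less.prems(1) by simp
  next
    case (right w l r rs r')
    then have "wdecorated r' \<and> dleaves r' = dleaves r \<and> dnodes r' = dnodes r + 1"
      using less.prems(1) by (intro less.hyps) auto
    moreover have "rs = []" using less.prems(1) right by (auto simp: normal_words_def)
    ultimately show ?thesis using right less.prems(1) by simp
  qed
qed

lemma homotopy_in_lower: "tree_less wt (skeleton t) T \<Longrightarrow> homotopy t \<in> lower T"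
  by (auto simp: lower_def dest: skeleton_homotopy)

lemma lcong_homotopy: "lcong T x y \<Longrightarrow> lcong T (lin_ext homotopy x) (lin_ext homotopy y)"
  unfolding lcong_def lin_ext_diff[symmetric]
  by (rule lin_ext_in_subspace[OF subspace_lower], rule homotopy_in_lower) (auto simp: lower_def)

text \<open>The inverse of splitting off the first label of a comb. The value on
  \<open>DLeaf\<close> is a default.\<close>

fun merge :: "'x \<Rightarrow> 'x list dtree \<Rightarrow> 'x list dtree \<Rightarrow> 'x list dtree" where
  "merge w t (DNode ws ts) = DNode (w # ws) (t # ts)"
| "merge w t DLeaf = DLeaf"

lemma skeleton_merge: "s \<noteq> DLeaf \<Longrightarrow> skeleton (merge w t s) = Node (skeleton t) w (skeleton s)"
  by (cases s) auto

lemma tree_less_Node_left: "tree_less wt t t' \<Longrightarrow> tree_less wt (Node t w s) (Node t' w s)"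
  by (auto simp: tree_less_iff_size1)

lemma tree_less_Node_right: "tree_less wt t t' \<Longrightarrow> tree_less wt (Node s w t) (Node s w t')"
  by (auto simp: tree_less_iff_size1)

text \<open>Contracting the edge to the left child lowers the skeleton or gives zero. For the right
  child the skeleton stays only if \<open>w\<close> and the first label there form a normal pair,
  and then \<open>merge w l r\<close> arises. The children have the numbers 1 and
  \<open>1 + dnodes l\<close> in preorder, which gives the signs.\<close>

lemma wdiff_bnode:
  assumes "wdecorated (bnode w l r)"
  shows "lcong (skeleton (bnode w l r)) (wdiff (bnode w l r))
    (- lin_ext (\<lambda>l'. basis_vec (bnode w l' r)) (wdiff l) + smul ((-1) ^ (1 + dnodes l))
      ((if normal_edge w (skeleton r) then basis_vec (merge w l r) else 0) +
        lin_ext (\<lambda>r'. basis_vec (bnode w l r')) (wdiff r)))"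
proof -
  let ?T = "skeleton (bnode w l r)"
  have "lcong ?T (opt_vec (contract_top wcomp [w] [] l [r])) 0"
    using assms contract_top_cases[of "[w]" "[]" l "[r]"]
    by (cases "contract_top wcomp [w] [] l [r]") (auto simp: lcong_zero_iff)
  moreover have "lcong ?T (opt_vec (contract_top wcomp [w] [l] r []))
      (if normal_edge w (skeleton r) then basis_vec (merge w l r) else 0)"
  proof (cases "normal_edge w (skeleton r)")
    case True
    moreover have "wdecorated r" using assms by simp
    ultimately obtain v q u us where r: "r = DNode (v # q) (u # us)" "normal_pair w v"
      using normal_edge_skeletonE by blast
    have "comp [w] 2 (v # q) = nfl (comb (w # v # q))"
      by (simp add: comp_def)
    also have "\<dots> = Some (w # v # q)"
      using assms r nfl_comb_iff[of "w # v # q"] nfl_comb_iff[of "v # q"] by (auto simp: normal_words_def)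
    finally show ?thesis using True r by (simp add: contract_top_def numeral_2_eq_2)
  next
    case False
    have "tree_less wt (skeleton s) ?T" if "contract_top wcomp [w] [l] r [] = Some s" for s
    proof -
      have "wdecorated (DNode [w] ([l] @ r # []))" using assms by simp
      from this that show ?thesis
      proof (cases rule: contract_top_cases)
      case (merge q us)
      then obtain v q' u us' where q: "q = v # q'" "us = u # us'"
        using assms wdecorated_DNodeD[of q us] by auto
      then have "normal_pair w v"
        using assms merge nfl_comb_iff[of "w # v # q'"] by (auto simp: normal_words_def)
      then show ?thesis using False merge q by auto
      qed auto
    qed
    then show ?thesis
      using False by (cases "contract_top wcomp [w] [l] r []") (auto simp: lcong_zero_iff)
  qed
  ultimately have "lcong ?T
      (smul (- 1) (opt_vec (contract_top wcomp [w] [] l [r]) + lin_ext (\<lambda>l'. basis_vec (bnode w l' r)) (wdiff l)) +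
       smul ((-1) ^ (1 + dnodes l)) (opt_vec (contract_top wcomp [w] [l] r []) +
         lin_ext (\<lambda>r'. basis_vec (bnode w l r')) (wdiff r)))
      (smul (- 1) (0 + lin_ext (\<lambda>l'. basis_vec (bnode w l' r)) (wdiff l)) +
       smul ((-1) ^ (1 + dnodes l)) ((if normal_edge w (skeleton r) then basis_vec (merge w l r) else 0) +
         lin_ext (\<lambda>r'. basis_vec (bnode w l r')) (wdiff r)))"
    by (intro lcong_add lcong_smul lcong_refl)
  then show ?thesis
    by (simp add: diff_DNode diff_below_Cons)
qed

text \<open>Since \<open>w\<close> and \<open>v\<close> form a normal pair, a word that starts with
  \<open>v\<close> is normal exactly if it is so with \<open>w\<close> prepended. Hence prepending
  commutes with the contractions below the other children, up to lower terms. The vertices of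
  \<open>t\<close> now precede these children, whence the sign
  \<open>(-1) ^ dnodes t\<close>.\<close>

lemma wdiff_merge:
  assumes "wdecorated (DNode (w # v # ws) (t # ts))"
  shows "lcong (skeleton (DNode (w # v # ws) (t # ts))) (wdiff (DNode (w # v # ws) (t # ts)) :: _ \<Rightarrow>\<^sub>0 'a::field)
    (- lin_ext (\<lambda>t'. basis_vec (DNode (w # v # ws) (t' # ts))) (wdiff t) +
      smul ((-1) ^ dnodes t) (lin_ext (\<lambda>s. basis_vec (merge w t s)) (wdiff (DNode (v # ws) ts))))"
proof -
  let ?T = "skeleton (DNode (w # v # ws) (t # ts))"
  let ?M = "lin_ext (\<lambda>s. basis_vec (merge w t s)) :: _ \<Rightarrow> _ \<Rightarrow>\<^sub>0 'a"
  have "ts \<noteq> []" using assms by (auto simp: normal_words_def)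
  have normal: "nfl (comb ((w # v # ws) @ q)) = Some ((w # v # ws) @ q) \<longleftrightarrow>
      nfl (comb ((v # ws) @ q)) = Some ((v # ws) @ q)" if "set q \<subseteq> G" for q
    using assms that normal_words_Cons(3)[of w v ws] nfl_comb_iff[of "w # v # ws @ q"] nfl_comb_iff[of "v # ws @ q"]
    by (auto simp: normal_words_def)
  have ts: "wdecorated (DNode (v # ws) ts)"
    using assms normal_words_Cons(2)[of w v ws] by auto
  have top: "lcong ?T (opt_vec (contract_top wcomp (w # v # ws) (t # xs) y ys))
      (?M (opt_vec (contract_top wcomp (v # ws) xs y ys)))" if xys: "ts = xs @ y # ys" for xs y ys
  proof -
    let ?s = "contract_top wcomp (w # v # ws) (t # xs) y ys"
    let ?s' = "contract_top wcomp (v # ws) xs y ys"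
    have dec: "wdecorated (DNode (w # v # ws) ((t # xs) @ y # ys))" "wdecorated (DNode (v # ws) (xs @ y # ys))"
      using assms ts xys by auto
    have not_leaf: "s' \<noteq> DLeaf" if "?s' = Some s'" for s'
      using that by (auto simp: contract_top_def split: dtree.splits)
    show ?thesis
    \<comment> \<open>If the concatenated word is normal, both sides are the same tree. Otherwise it
      is not normal with \<open>w\<close> prepended either, and both sides are lower or
      zero.\<close>
    proof (cases "\<exists>q us. y = DNode q us \<and> ys = [] \<and> nfl (comb ((v # ws) @ q)) = Some ((v # ws) @ q)")
      case True
      then obtain q us where y: "y = DNode q us" "ys = []" "nfl (comb ((v # ws) @ q)) = Some ((v # ws) @ q)" by blast
      have q: "set q \<subseteq> G" "length xs = length ws + 1" using dec y by (auto simp: normal_words_def)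
      have "comp (v # ws) (length xs + 1) q = Some ((v # ws) @ q)"
        using y graft_comb_comb[of "v # ws" q] q by (simp add: comp_def)
      moreover have "comp (w # v # ws) (length xs + 2) q = Some ((w # v # ws) @ q)"
        using y graft_comb_comb[of "w # v # ws" q] q normal[of q] by (simp add: comp_def)
      ultimately show ?thesis using y by (simp add: contract_top_def)
    next
      case False
      have "opt_vec ?s \<in> lower ?T"
      proof (cases ?s)
        case (Some s)
        with dec(1) show ?thesis
        proof (cases rule: contract_top_cases)
          case less
          then show ?thesis using Some xys by simp
        next
          case (merge q us)
          then have "set q \<subseteq> G" using dec(1) by (auto simp: normal_words_def)
          then show ?thesis using False merge normal[of q] by simp
        qed
      qed (simp add: free_vs.subspace_0[OF subspace_lower])
      moreover have "?M (opt_vec ?s') \<in> lower ?T"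
      proof (cases ?s')
        case (Some s')
        with dec(2) have "tree_less wt (skeleton s') (skeleton (DNode (v # ws) ts))"
          by (cases rule: contract_top_cases) (use False xys in auto)
        then show ?thesis using Some not_leaf[OF Some]
          by (simp add: skeleton_merge tree_less_Node_right)
      qed (simp add: free_vs.subspace_0[OF subspace_lower])
      ultimately show ?thesis by (rule lower_lcong)
    qed
  qed
  have "lcong ?T (diff_below wcomp (w # v # ws) (t # xs) ys)
      (smul ((-1) ^ dnodes t) (?M (diff_below wcomp (v # ws) xs ys)))" if "ts = xs @ ys" for xs ys
    using that
  proof (induction ys arbitrary: xs)
    case (Cons y ys)
    let ?e = "(-1) ^ (1 + fnodes (t # xs)) :: 'a" and ?e' = "(-1) ^ (1 + fnodes xs) :: 'a"
    have "?e = (-1) ^ dnodes t * ?e'" by (simp add: power_add)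
    have "lcong ?T (smul ?e (opt_vec (contract_top wcomp (w # v # ws) (t # xs) y ys) +
          lin_ext (\<lambda>y'. basis_vec (DNode (w # v # ws) ((t # xs) @ y' # ys))) (wdiff y)) +
        diff_below wcomp (w # v # ws) (t # (xs @ [y])) ys)
       (smul ?e (?M (opt_vec (contract_top wcomp (v # ws) xs y ys)) +
          lin_ext (\<lambda>y'. basis_vec (DNode (w # v # ws) ((t # xs) @ y' # ys))) (wdiff y)) +
        smul ((-1) ^ dnodes t) (?M (diff_below wcomp (v # ws) (xs @ [y]) ys)))"
      using Cons.prems by (intro lcong_add lcong_smul lcong_refl top Cons.IH) auto
    also have "\<dots> = smul ((-1) ^ dnodes t) (?M (diff_below wcomp (v # ws) xs (y # ys)))"
      unfolding \<open>?e = (-1) ^ dnodes t * ?e'\<close>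
      by (simp add: diff_below_Cons lin_ext_add lin_ext_diff lin_ext_smul lin_ext_uminus lin_ext_lin_ext
        free_vs.scale_right_distrib free_vs.scale_right_diff_distrib free_vs.scale_minus_right)
    finally show ?case by (simp only: diff_below_Cons append_Cons)
  qed simp
  from this[of "[]" ts] have below: "lcong ?T (diff_below wcomp (w # v # ws) [t] ts)
      (smul ((-1) ^ dnodes t) (?M (wdiff (DNode (v # ws) ts))))"
    by (simp add: diff_DNode)
  have "lcong ?T (opt_vec (contract_top wcomp (w # v # ws) [] t ts)) 0"
    using assms \<open>ts \<noteq> []\<close> contract_top_cases[of "w # v # ws" "[]" t ts]
    by (cases "contract_top wcomp (w # v # ws) [] t ts") (auto simp: lcong_zero_iff)
  then have "lcong ?T
      (smul (-1) (opt_vec (contract_top wcomp (w # v # ws) [] t ts) +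
        lin_ext (\<lambda>t'. basis_vec (DNode (w # v # ws) (t' # ts))) (wdiff t)) +
       diff_below wcomp (w # v # ws) [t] ts)
      (smul (-1) (0 + lin_ext (\<lambda>t'. basis_vec (DNode (w # v # ws) (t' # ts))) (wdiff t)) +
       smul ((-1) ^ dnodes t) (?M (wdiff (DNode (v # ws) ts))))"
    using below by (intro lcong_add lcong_smul lcong_refl)
  then show ?thesis by (simp add: diff_DNode diff_below_Cons)
qed

text \<open>A comb with at least two labels contains a normal edge of the skeleton. Without such
  edges all vertices are binary.\<close>

lemma diagonal:
  assumes "wdecorated t" "\<not> has_normal_edge (skeleton t)"
  shows "dnodes t + 1 = dleaves t"
  using assms
proof (induction "dnodes t" arbitrary: t rule: less_induct)
  case less
  show ?case
  proof (cases t)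
    case (DNode p ts)
    then have "wdecorated (DNode p ts)" using less.prems by simp
    then show ?thesis
    proof (cases rule: wdecorated_DNodeE)
      case (single w l r)
      then have "dnodes l + 1 = dleaves l" "dnodes r + 1 = dleaves r"
        using DNode less.prems less.hyps[of l] less.hyps[of r] by auto
      then show ?thesis using single DNode by simp
    next
      case (merged w v ws t1 ts')
      then have "normal_pair w v" using DNode less.prems(1) normal_words_Cons(3)[of w v ws] by auto
      then show ?thesis using merged less.prems(2) DNode by (cases ts') auto
    qed
  qed simp
qed

text \<open>A term with the same skeleton would have no normal edge either and so lie on the
  diagonal, but it has as many leaves as \<open>t\<close> and one vertex less.\<close>

lemma keys_wdiff_less:
  assumes "wdecorated t" "\<not> has_normal_edge (skeleton t)" "s \<in> Poly_Mapping.keys (wdiff t :: _ \<Rightarrow>\<^sub>0 'a::field)"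
  shows "tree_less wt (skeleton s) (skeleton t)"
  using keys_wdiff[OF assms(1,3)] diagonal[OF assms(1,2)] diagonal[of s] assms(2) by auto

lemma minus_one_power_squared [simp]: "(- 1) ^ n * ((- 1) ^ n * x) = (x :: 'a::field)"
  by (simp flip: power_add mult.assoc mult_2)

text \<open>The first normal edge sits at the root, in the left subtree or in the right subtree. At
  the root, splitting and merging are inverse to each other, and the other terms of the two
  composites cancel or are lower. In a subtree the formula is inherited, since the mixed terms
  cancel or are lower.\<close>

lemma homotopy_formula:
  assumes "wdecorated t" "has_normal_edge (skeleton t)"
  shows "lcong (skeleton t) (lin_ext wdiff (homotopy t) + lin_ext homotopy (wdiff t))
    (basis_vec t :: _ \<Rightarrow>\<^sub>0 'a::field)"
  using assms
proof (induction "dnodes t" arbitrary: t rule: less_induct)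
  case less
  let ?T = "skeleton t"
  obtain p ts where "t = DNode p ts" using less.prems by (cases t) auto
  then have "wdecorated (DNode p ts)" using less.prems by simp
  then show ?case
  proof (cases rule: wdecorated_DNodeE)
    case (merged w v ws t1 ts')
    let ?s = "DNode (v # ws) ts'"
    let ?e = "(- 1) ^ dnodes t1 :: 'a"
    have t: "t = DNode (w # v # ws) (t1 # ts')" using merged \<open>t = DNode p ts\<close> by simp
    have nodes: "[w] \<in> normal_words 2" "v # ws \<in> normal_words (length ts')" "normal_pair w v"
      using less.prems(1) normal_words_Cons[of w v ws "length ts'"] t by auto
    then have dec: "wdecorated (bnode w t1 ?s)" "wdecorated ?s"
      using less.prems(1) t by (auto simp: numeral_2_eq_2)
    let ?X = "lin_ext (\<lambda>t'. basis_vec (bnode w t' ?s)) (wdiff t1) :: _ \<Rightarrow>\<^sub>0 'a"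
    let ?Y = "lin_ext (\<lambda>s. basis_vec (bnode w t1 s)) (wdiff ?s) :: _ \<Rightarrow>\<^sub>0 'a"
    have skel: "skeleton (bnode w t1 ?s) = ?T" by (simp add: t)
    \<comment> \<open>After \<open>w\<close> is split off, merging it back is one of the
      contractions, and it returns \<open>t\<close>.\<close>
    have "normal_edge w (skeleton ?s)"
      using nodes(3) merged by (cases ts') auto
    then have "lcong ?T (wdiff (bnode w t1 ?s)) (- ?X + smul (- ?e) (basis_vec t + ?Y))"
      using wdiff_bnode[OF dec(1)] skel t by simp
    then have "lcong ?T (smul (- ?e) (wdiff (bnode w t1 ?s))) (smul (- ?e) (- ?X + smul (- ?e) (basis_vec t + ?Y)))"
      by (rule lcong_smul)
    then have 1: "lcong ?T (lin_ext wdiff (homotopy t)) (basis_vec t + ?Y + smul ?e ?X)"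
      by (simp add: t lin_ext_single lin_ext_uminus lin_ext_smul free_vs.scale_right_distrib free_vs.scale_right_diff_distrib
          free_vs.scale_minus_left free_vs.scale_minus_right flip: power_add mult_2)
    have "lcong ?T (lin_ext homotopy (wdiff t)) (lin_ext homotopy
       (- lin_ext (\<lambda>t'. basis_vec (DNode (w # v # ws) (t' # ts'))) (wdiff t1) +
        smul ?e (lin_ext (\<lambda>s. basis_vec (merge w t1 s)) (wdiff ?s))))"
      using wdiff_merge[of w v ws t1 ts'] less.prems(1) unfolding t by (intro lcong_homotopy) auto
    also have "\<dots> = - lin_ext (\<lambda>t'. homotopy (DNode (w # v # ws) (t' # ts'))) (wdiff t1) +
        smul ?e (lin_ext (\<lambda>s. homotopy (merge w t1 s)) (wdiff ?s))"
      by (simp only: lin_ext_add lin_ext_uminus lin_ext_smul lin_ext_lin_ext lin_ext_basis_vec)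
    also have "lin_ext (\<lambda>t'. homotopy (DNode (w # v # ws) (t' # ts'))) (wdiff t1) =
        lin_ext (\<lambda>t'. smul ?e (basis_vec (bnode w t' ?s))) (wdiff t1)"
    proof (rule lin_ext_cong)
      fix t' assume "t' \<in> Poly_Mapping.keys (wdiff t1 :: _ \<Rightarrow>\<^sub>0 'a)"
      then have "dnodes t1 = dnodes t' + 1" using keys_wdiff(3) less.prems(1) t by auto
      then show "homotopy (DNode (w # v # ws) (t' # ts')) = smul ?e (basis_vec (bnode w t' ?s))" by simp
    qed
    also have "\<dots> = smul ?e ?X" by (rule lin_ext_fun_smul)
    also have "lin_ext (\<lambda>s. homotopy (merge w t1 s)) (wdiff ?s) =
        lin_ext (\<lambda>s. smul (- ?e) (basis_vec (bnode w t1 s))) (wdiff ?s)"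
    proof (rule lin_ext_cong)
      fix s assume s: "s \<in> Poly_Mapping.keys (wdiff ?s :: _ \<Rightarrow>\<^sub>0 'a)"
      \<comment> \<open>The default of \<open>merge\<close> does not interfere: the skeleton of
        \<open>s\<close> has the size of that of \<open>?s\<close>, which is not a leaf.\<close>
      have "s \<noteq> DLeaf" using keys_wdiff(4)[OF dec(2) s] merged
        by (cases ts') (auto simp: tree_less_def)
      then obtain q us where "s = DNode q us" by (cases s) auto
      moreover obtain v' q' where "q = v' # q'"
        using keys_wdiff(1)[OF dec(2) s] wdecorated_DNodeD[of q us] \<open>s = DNode q us\<close> by auto
      ultimately show "homotopy (merge w t1 s) = smul (- ?e) (basis_vec (bnode w t1 s))" by simp
    qed
    also have "\<dots> = smul (- ?e) ?Y" by (rule lin_ext_fun_smul)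
    finally have 2: "lcong ?T (lin_ext homotopy (wdiff t)) (- smul ?e ?X - ?Y)"
      by (simp add: free_vs.scale_minus_left free_vs.scale_minus_right flip: power_add mult_2)
    from lcong_add[OF 1 2] show ?thesis by simp
  next
    case (single w l r)
    have t: "t = bnode w l r" using single \<open>t = DNode p ts\<close> by simp
    have dec: "wdecorated l" "wdecorated r" using less.prems(1) t by auto
    let ?e = "(- 1) ^ dnodes l :: 'a"
    let ?L = "\<lambda>x. lin_ext (\<lambda>l'. basis_vec (bnode w l' r)) x :: _ \<Rightarrow>\<^sub>0 'a"
    let ?R = "\<lambda>x. lin_ext (\<lambda>r'. basis_vec (bnode w l r')) x :: _ \<Rightarrow>\<^sub>0 'a"
    let ?m = "if normal_edge w (skeleton r) then basis_vec (merge w l r) else 0 :: _ \<Rightarrow>\<^sub>0 'a"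
    have "lcong ?T (lin_ext homotopy (wdiff t)) (lin_ext homotopy (- ?L (wdiff l) + smul (- ?e) (?m + ?R (wdiff r))))"
      using wdiff_bnode[of w l r] less.prems(1) unfolding t by (intro lcong_homotopy) auto
    also have "\<dots> = - lin_ext (\<lambda>l'. homotopy (bnode w l' r)) (wdiff l) +
        smul (- ?e) (lin_ext homotopy ?m + lin_ext (\<lambda>r'. homotopy (bnode w l r')) (wdiff r))"
      by (simp only: lin_ext_add lin_ext_uminus lin_ext_smul lin_ext_lin_ext lin_ext_basis_vec)
    finally have hd: "lcong ?T (lin_ext homotopy (wdiff t)) (- lin_ext (\<lambda>l'. homotopy (bnode w l' r)) (wdiff l) +
        smul (- ?e) (lin_ext homotopy ?m + lin_ext (\<lambda>r'. homotopy (bnode w l r')) (wdiff r)))" .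
    have left_cases: "skeleton l' = skeleton l \<or> tree_less wt (skeleton (bnode w l' r)) ?T"
      if "l' \<in> Poly_Mapping.keys (wdiff l :: _ \<Rightarrow>\<^sub>0 'a)" for l'
      using keys_wdiff(4)[OF dec(1) that] by (auto simp: t intro: tree_less_Node_left)
    have right_cases: "skeleton r' = skeleton r \<or> tree_less wt (skeleton (bnode w l r')) ?T"
      if "r' \<in> Poly_Mapping.keys (wdiff r :: _ \<Rightarrow>\<^sub>0 'a)" for r'
      using keys_wdiff(4)[OF dec(2) that] by (auto simp: t intro: tree_less_Node_right)
    have diff_node: "lcong ?T (wdiff (bnode w l' r'))
        (- lin_ext (\<lambda>l'. basis_vec (bnode w l' r')) (wdiff l') + smul ((- 1) ^ (1 + dnodes l'))
          (lin_ext (\<lambda>r'. basis_vec (bnode w l' r')) (wdiff r')))"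
      if "wdecorated l'" "wdecorated r'" "skeleton l' = skeleton l" "skeleton r' = skeleton r" "\<not> normal_edge w (skeleton r)" for l' r'
      using wdiff_bnode[of w l' r'] less.prems(1) that by (simp add: t)
    show ?thesis
    proof (cases "normal_edge w (skeleton r)")
      case True
      with dec(2) obtain v q u us where r: "r = DNode (v # q) (u # us)"
        by (rule normal_edge_skeletonE)
      \<comment> \<open>A term of the differential of \<open>r\<close> is lower, or it keeps the
        skeleton; then the edge from \<open>w\<close> to it is still normal and outside the comb, so
        that the homotopy gives 0.\<close>
      have "lcong ?T (lin_ext (\<lambda>r'. homotopy (bnode w l r')) (wdiff r)) (lin_ext (\<lambda>r'. 0) (wdiff r) :: _ \<Rightarrow>\<^sub>0 'a)"
      proof (rule lcong_lin_ext)
        fix r' assume "r' \<in> Poly_Mapping.keys (wdiff r :: _ \<Rightarrow>\<^sub>0 'a)"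
        from right_cases[OF this] show "lcong ?T (homotopy (bnode w l r')) (0 :: _ \<Rightarrow>\<^sub>0 'a)"
        proof
          assume "tree_less wt (skeleton (bnode w l r')) ?T"
          then show ?thesis unfolding lcong_zero_iff by (rule homotopy_in_lower)
        qed (use True in simp)
      qed
      then have "lcong ?T (- lin_ext (\<lambda>l'. homotopy (bnode w l' r)) (wdiff l) +
         smul (- ?e) (lin_ext homotopy ?m + lin_ext (\<lambda>r'. homotopy (bnode w l r')) (wdiff r)))
        (- lin_ext (\<lambda>l'. homotopy (bnode w l' r)) (wdiff l) +
         smul (- ?e) (lin_ext homotopy ?m + lin_ext (\<lambda>r'. 0) (wdiff r)))"
        by (intro lcong_add lcong_smul lcong_refl)
      also have "\<dots> = basis_vec t"
        using True by (simp add: t r flip: power_add mult_2)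
      finally show ?thesis using lcong_trans[OF hd] True by (simp add: t)
    next
      case False
      note no_edge = False
      show ?thesis
      proof (cases "has_normal_edge (skeleton l)")
        case True
        have h: "homotopy t = - ?L (homotopy l)" using True False by (simp add: t)
        have "lcong ?T (lin_ext (\<lambda>l'. wdiff (bnode w l' r)) (homotopy l))
          (lin_ext (\<lambda>l'. - ?L (wdiff l') + smul ?e (lin_ext (\<lambda>r'. basis_vec (bnode w l' r')) (wdiff r))) (homotopy l))"
        proof (rule lcong_lin_ext)
          fix l' assume l': "l' \<in> Poly_Mapping.keys (homotopy l :: _ \<Rightarrow>\<^sub>0 'a)"
          \<comment> \<open>The homotopy adds a vertex on the left, which reverses the sign of the
            right differential. So this mixed term is opposite to the one that arises when the
            homotopy follows the differential.\<close>
          have "dnodes l' = dnodes l + 1" "wdecorated l'" "skeleton l' = skeleton l"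
            using keys_homotopy[OF dec(1) l'] skeleton_homotopy[OF l'] by auto
          with diff_node[of l' r] False dec
          show "lcong ?T (wdiff (bnode w l' r))
              (- ?L (wdiff l') + smul ?e (lin_ext (\<lambda>r'. basis_vec (bnode w l' r')) (wdiff r)))"
            by simp
        qed
        then have dh: "lcong ?T (lin_ext wdiff (homotopy t)) (?L (lin_ext wdiff (homotopy l)) -
            smul ?e (lin_ext (\<lambda>l'. lin_ext (\<lambda>r'. basis_vec (bnode w l' r')) (wdiff r)) (homotopy l)))"
          unfolding h lin_ext_uminus lin_ext_lin_ext lin_ext_basis_vec
          by (drule_tac lcong_uminus) (simp add: lin_ext_fun_diff lin_ext_fun_smul lin_ext_fun_uminus)
        have 1: "lcong ?T (lin_ext (\<lambda>l'. homotopy (bnode w l' r)) (wdiff l)) (lin_ext (\<lambda>l'. - ?L (homotopy l')) (wdiff l))"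
        proof (rule lcong_lin_ext)
          fix l' assume l': "l' \<in> Poly_Mapping.keys (wdiff l :: _ \<Rightarrow>\<^sub>0 'a)"
          from left_cases[OF this] show "lcong ?T (homotopy (bnode w l' r)) (- ?L (homotopy l'))"
          proof
            assume less: "tree_less wt (skeleton (bnode w l' r)) ?T"
            have "?L (homotopy l') \<in> lower ?T"
              using less by (intro lin_ext_in_subspace subspace_lower) (auto dest: skeleton_homotopy)
            then show ?thesis
              using less free_vs.subspace_neg[OF subspace_lower] by (intro lower_lcong homotopy_in_lower) auto
          qed (use no_edge True in simp)
        qed
        have 2: "lcong ?T (lin_ext (\<lambda>r'. homotopy (bnode w l r')) (wdiff r) :: _ \<Rightarrow>\<^sub>0 'a)
            (lin_ext (\<lambda>r'. - lin_ext (\<lambda>l'. basis_vec (bnode w l' r')) (homotopy l)) (wdiff r))"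
        proof (rule lcong_lin_ext)
          fix r' assume r': "r' \<in> Poly_Mapping.keys (wdiff r :: _ \<Rightarrow>\<^sub>0 'a)"
          from right_cases[OF this] show "lcong ?T (homotopy (bnode w l r') :: _ \<Rightarrow>\<^sub>0 'a)
              (- lin_ext (\<lambda>l'. basis_vec (bnode w l' r')) (homotopy l))"
          proof
            assume less: "tree_less wt (skeleton (bnode w l r')) ?T"
            have "(lin_ext (\<lambda>l'. basis_vec (bnode w l' r')) (homotopy l) :: _ \<Rightarrow>\<^sub>0 'a) \<in> lower ?T"
              using less by (intro lin_ext_in_subspace subspace_lower) (auto dest: skeleton_homotopy)
            then show ?thesis
              using less free_vs.subspace_neg[OF subspace_lower] by (intro lower_lcong homotopy_in_lower) auto
          qed (use no_edge True in simp)
        qed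
        have "lcong ?T (- lin_ext (\<lambda>l'. homotopy (bnode w l' r)) (wdiff l) +
            smul (- ?e) (0 + lin_ext (\<lambda>r'. homotopy (bnode w l r')) (wdiff r)))
          (- lin_ext (\<lambda>l'. - ?L (homotopy l')) (wdiff l) +
            smul (- ?e) (0 + lin_ext (\<lambda>r'. - lin_ext (\<lambda>l'. basis_vec (bnode w l' r')) (homotopy l)) (wdiff r)))"
          using 1 2 by (intro lcong_add lcong_smul lcong_uminus lcong_refl)
        also have "\<dots> = ?L (lin_ext homotopy (wdiff l)) +
            smul ?e (lin_ext (\<lambda>r'. lin_ext (\<lambda>l'. basis_vec (bnode w l' r')) (homotopy l)) (wdiff r))"
          by (simp add: lin_ext_fun_uminus lin_ext_lin_ext free_vs.scale_minus_left free_vs.scale_minus_right)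
        also have "lin_ext (\<lambda>r'. lin_ext (\<lambda>l'. basis_vec (bnode w l' r')) (homotopy l)) (wdiff r) =
            lin_ext (\<lambda>l'. lin_ext (\<lambda>r'. basis_vec (bnode w l' r')) (wdiff r)) (homotopy l)"
          by (rule lin_ext_swap)
        finally have "lcong ?T (lin_ext homotopy (wdiff t)) (?L (lin_ext homotopy (wdiff l)) +
            smul ?e (lin_ext (\<lambda>l'. lin_ext (\<lambda>r'. basis_vec (bnode w l' r')) (wdiff r)) (homotopy l)))"
          using lcong_trans[OF hd] False by simp
        from lcong_add[OF dh this] have "lcong ?T (lin_ext wdiff (homotopy t) + lin_ext homotopy (wdiff t))
            (?L (lin_ext wdiff (homotopy l) + lin_ext homotopy (wdiff l)))"
          by (simp add: lin_ext_add)
        also have "lcong ?T \<dots> (?L (basis_vec l))"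
        proof -
          have "lcong (skeleton l) (lin_ext wdiff (homotopy l) + lin_ext homotopy (wdiff l)) (basis_vec l :: _ \<Rightarrow>\<^sub>0 'a)"
            using dec True t by (intro less.hyps) auto
          then show ?thesis
            unfolding lcong_def lin_ext_diff[symmetric]
            by (intro lin_ext_in_subspace subspace_lower) (auto simp: lower_def t intro: tree_less_Node_left)
        qed
        finally show ?thesis by (simp add: t)
      next
        case False
        have h: "homotopy t = smul (- ?e) (?R (homotopy r))" using False no_edge by (simp add: t)
        have "lcong ?T (lin_ext (\<lambda>r'. wdiff (bnode w l r')) (homotopy r))
          (lin_ext (\<lambda>r'. smul (- ?e) (?R (wdiff r'))) (homotopy r))"
        proof (rule lcong_lin_ext)
          fix r' assume r': "r' \<in> Poly_Mapping.keys (homotopy r :: _ \<Rightarrow>\<^sub>0 'a)"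
          have dec': "wdecorated r'" "skeleton r' = skeleton r"
            using keys_homotopy[OF dec(2) r'] skeleton_homotopy[OF r'] by auto
          \<comment> \<open>Without normal edges in \<open>l\<close>, every term of its differential
            is lower, so only the right subtree contributes.\<close>
          have "lcong ?T (lin_ext (\<lambda>l'. basis_vec (bnode w l' r')) (wdiff l)) 0"
            unfolding lcong_zero_iff
            by (rule lin_ext_in_subspace[OF subspace_lower])
              (use keys_wdiff_less[OF dec(1) False] dec' in \<open>auto simp: t intro: tree_less_Node_left\<close>)
          then have "lcong ?T (- lin_ext (\<lambda>l'. basis_vec (bnode w l' r')) (wdiff l) + smul (- ?e) (?R (wdiff r')))
              (- 0 + smul (- ?e) (?R (wdiff r')))"
            by (intro lcong_add lcong_uminus lcong_refl)
          with diff_node[of l r'] dec dec' no_edge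
          show "lcong ?T (wdiff (bnode w l r')) (smul (- ?e) (?R (wdiff r')))"
            using lcong_trans by fastforce
        qed
        then have "lcong ?T (smul (- ?e) (lin_ext (\<lambda>r'. wdiff (bnode w l r')) (homotopy r)))
          (smul (- ?e) (lin_ext (\<lambda>r'. smul (- ?e) (?R (wdiff r'))) (homotopy r)))"
          by (rule lcong_smul)
        then have dh: "lcong ?T (lin_ext wdiff (homotopy t)) (?R (lin_ext wdiff (homotopy r)))"
          by (simp add: h lin_ext_smul lin_ext_uminus lin_ext_lin_ext lin_ext_fun_smul lin_ext_fun_uminus)
        have 1: "lcong ?T (lin_ext (\<lambda>l'. homotopy (bnode w l' r)) (wdiff l)) 0"
          unfolding lcong_zero_iff
          by (rule lin_ext_in_subspace[OF subspace_lower], rule homotopy_in_lower)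
            (simp add: t tree_less_Node_left keys_wdiff_less[OF dec(1) False])
        have 2: "lcong ?T (lin_ext (\<lambda>r'. homotopy (bnode w l r')) (wdiff r) :: _ \<Rightarrow>\<^sub>0 'a)
            (lin_ext (\<lambda>r'. smul (- ?e) (?R (homotopy r'))) (wdiff r))"
        proof (rule lcong_lin_ext)
          fix r' assume r': "r' \<in> Poly_Mapping.keys (wdiff r :: _ \<Rightarrow>\<^sub>0 'a)"
          from right_cases[OF this] show "lcong ?T (homotopy (bnode w l r')) (smul (- ?e) (?R (homotopy r')))"
          proof
            assume less: "tree_less wt (skeleton (bnode w l r')) ?T"
            have "?R (homotopy r') \<in> lower ?T"
              using less by (intro lin_ext_in_subspace subspace_lower) (auto dest: skeleton_homotopy)
            then show ?thesis
              using less by (intro lower_lcong homotopy_in_lower free_vs.subspace_scale[OF subspace_lower]) auto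
          qed (use no_edge False in simp)
        qed
        have "lcong ?T (- lin_ext (\<lambda>l'. homotopy (bnode w l' r)) (wdiff l) +
            smul (- ?e) (0 + lin_ext (\<lambda>r'. homotopy (bnode w l r')) (wdiff r)))
          (- 0 + smul (- ?e) (0 + lin_ext (\<lambda>r'. smul (- ?e) (?R (homotopy r'))) (wdiff r)))"
          using 1 2 by (intro lcong_add lcong_smul lcong_uminus lcong_refl)
        also have "\<dots> = ?R (lin_ext homotopy (wdiff r))"
          by (simp add: lin_ext_fun_smul lin_ext_fun_uminus lin_ext_lin_ext)
        finally have "lcong ?T (lin_ext homotopy (wdiff t)) (?R (lin_ext homotopy (wdiff r)))"
          using lcong_trans[OF hd] no_edge by simp
        from lcong_add[OF dh this] have "lcong ?T (lin_ext wdiff (homotopy t) + lin_ext homotopy (wdiff t))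
            (?R (lin_ext wdiff (homotopy r) + lin_ext homotopy (wdiff r)))"
          by (simp add: lin_ext_add)
        also have "lcong ?T \<dots> (?R (basis_vec r))"
        proof -
          have "lcong (skeleton r) (lin_ext wdiff (homotopy r) + lin_ext homotopy (wdiff r)) (basis_vec r :: _ \<Rightarrow>\<^sub>0 'a)"
            using dec False no_edge less.prems t by (intro less.hyps) auto
          then show ?thesis
            unfolding lcong_def lin_ext_diff[symmetric]
            by (intro lin_ext_in_subspace subspace_lower) (auto simp: lower_def t intro: tree_less_Node_right)
        qed
        finally show ?thesis by (simp add: t)
      qed
    qed
  qed
qed

definition chains :: "nat \<Rightarrow> nat \<Rightarrow> ('x list dtree \<Rightarrow>\<^sub>0 'a::field) set" where
  "chains n d = {x. Poly_Mapping.keys x \<subseteq> {t. wdecorated t \<and> dleaves t = n \<and> dnodes t = d}}"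

lemma subspace_chains: "free_vs.subspace (chains n d)"
  unfolding chains_def by (rule subspace_keys_subset)

lemma wdiff_in_chains:
  assumes "wdecorated t" "dleaves t = n" "dnodes t = d + 1"
  shows "wdiff t \<in> chains n d"
  using assms keys_wdiff(1-3)[OF assms(1)] by (auto simp: chains_def)

text \<open>Iterating \<^term>\<open>homotopy\<close> terminates because the error terms are strictly lower.\<close>

lemma chains_exact:
  fixes x :: "'x list dtree \<Rightarrow>\<^sub>0 'a::field"
  assumes "x \<in> chains n d" "lin_ext wdiff x = 0" "d + 1 \<noteq> n"
  shows "\<exists>y\<in>chains n (d + 1). x = lin_ext wdiff y"
proof -
  let ?r = "{(s, t). tree_less wt (skeleton s) (skeleton t)}"
  \<comment> \<open>In \<open>max_ext\<close> every tree of the new support lies below some tree of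
    the old one, which is not empty.\<close>
  have wf: "wf (inv_image (max_ext ?r) (\<lambda>x :: 'x list dtree \<Rightarrow>\<^sub>0 'a. Poly_Mapping.keys x))"
  proof (intro wf_inv_image max_ext_wf)
    have "?r = inv_image {(s, t). tree_less wt s t} skeleton" by auto
    then show "wf ?r" using wfp_tree_less[of wt] by (simp add: wfp_def wf_inv_image)
  qed
  show ?thesis
    using assms(1,2)
  proof (induction x rule: wf_induct_rule[OF wf])
    case (1 x)
    show ?case
    proof (cases "x = 0")
      case True
      then show ?thesis using free_vs.subspace_0[OF subspace_chains] by (intro bexI[of _ 0]) auto
    next
      case False
      \<comment> \<open>Off the diagonal every tree in the support of \<open>x\<close> has a normal
        edge by \<open>diagonal\<close>, so that the homotopy formula applies to it.\<close>
      have t: "wdecorated t" "dleaves t = n" "dnodes t = d" "has_normal_edge (skeleton t)"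
        if "t \<in> Poly_Mapping.keys x" for t
        using 1(2) that diagonal[of t] assms(3) by (auto simp: chains_def)
      have hx: "lin_ext homotopy x \<in> chains n (d + 1)"
        using t keys_homotopy by (intro lin_ext_in_subspace subspace_chains) (fastforce simp: chains_def)
      have dd: "lin_ext wdiff (lin_ext wdiff (lin_ext homotopy x)) = 0"
      proof -
        have "lin_ext wdiff (lin_ext wdiff (lin_ext homotopy x)) = lin_ext (\<lambda>t. 0) (lin_ext homotopy x)"
          unfolding lin_ext_lin_ext[of wdiff wdiff]
          using hx by (intro lin_ext_cong words.diff_diff) (auto simp: chains_def)
        then show ?thesis by simp
      qed
      have dhx: "lin_ext wdiff (lin_ext homotopy x) \<in> chains n d"
        using hx by (intro lin_ext_in_subspace subspace_chains wdiff_in_chains) (auto simp: chains_def)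
      define x' where "x' = x - lin_ext wdiff (lin_ext homotopy x)"
      let ?error = "\<lambda>t. basis_vec t - (lin_ext wdiff (homotopy t) + lin_ext homotopy (wdiff t)) :: _ \<Rightarrow>\<^sub>0 'a"
      \<comment> \<open>As \<open>x\<close> is a cycle, the part of the formula in which the
        homotopy follows the differential vanishes on \<open>x\<close>.\<close>
      have x': "x' = lin_ext ?error x"
        using 1(3) by (simp add: x'_def lin_ext_fun_diff lin_ext_fun_add flip: lin_ext_lin_ext)
      have "\<exists>t\<in>Poly_Mapping.keys x. tree_less wt (skeleton s) (skeleton t)" if s: "s \<in> Poly_Mapping.keys x'" for s
      proof -
        obtain u where u: "u \<in> Poly_Mapping.keys x" "s \<in> Poly_Mapping.keys (?error u)"
          using s unfolding x' by (rule in_keys_lin_extE)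
        have "?error u \<in> lower (skeleton u)"
          using lcong_sym[OF homotopy_formula[OF t(1,4)[OF u(1)]]] by (simp add: lcong_def)
        then show ?thesis using u by (auto simp: lower_def)
      qed
      then have "(x', x) \<in> inv_image (max_ext ?r) Poly_Mapping.keys"
        using False by (auto intro!: max_ext.intros)
      moreover have "x' \<in> chains n d"
        unfolding x'_def using 1(2) dhx by (rule free_vs.subspace_diff[OF subspace_chains])
      moreover have "lin_ext wdiff x' = 0" using 1(3) dd by (simp add: x'_def lin_ext_diff)
      ultimately obtain y where "y \<in> chains n (d + 1)" "x' = lin_ext wdiff y"
        using 1(1) by blast
      then have "y + lin_ext homotopy x \<in> chains n (d + 1)" "x = lin_ext wdiff (y + lin_ext homotopy x)"
        using hx by (auto simp: x'_def lin_ext_add algebra_simps intro: free_vs.subspace_add[OF subspace_chains])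
      then show ?thesis by blast
    qed
  qed
qed

end


section \<open>The quotient operad computed in coordinates\<close>

section \<open>Comparison with the bar construction\<close>

context comb_normal_form
begin

definition normal_space :: "nat \<Rightarrow> ('x list \<Rightarrow>\<^sub>0 'a::field) set" where
  "normal_space n =
     {v. Poly_Mapping.keys v \<subseteq> {ws. set ws \<subseteq> G \<and> nfl (comb ws) = Some ws \<and> length ws + 1 = n}}"

text \<open>The coset of the relations whose normal form is \<open>v\<close>. In this way
  \<open>normal_space n\<close> parametrizes the quotient in arity \<open>n\<close>, where its
  operations are then computed.\<close>

definition normal_class :: "nat \<Rightarrow> ('x list \<Rightarrow>\<^sub>0 'a::field) \<Rightarrow> ('x tree \<Rightarrow>\<^sub>0 'a) set" where
  "normal_class n v = {x \<in> free_space G n. normal_vec x = v}"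

definition coordinates :: "('x tree \<Rightarrow>\<^sub>0 'a::field) set \<Rightarrow> 'x list \<Rightarrow>\<^sub>0 'a" where
  "coordinates A = normal_vec (SOME x. x \<in> A)"

abbreviation quotient :: "('a::field, ('x tree \<Rightarrow>\<^sub>0 'a) set) ns_operad" where
  "quotient \<equiv> quotient_operad G relations"

lemma subspace_normal_space: "free_vs.subspace (normal_space n)"
  unfolding normal_space_def by (rule subspace_keys_subset)

lemma normal_vec_add: "normal_vec (x + y) = normal_vec x + normal_vec y"
  by (simp add: normal_vec_def lin_ext_add)

lemma normal_vec_diff: "normal_vec (x - y) = normal_vec x - normal_vec y"
  by (simp add: normal_vec_def lin_ext_diff)

lemma normal_vec_smul: "normal_vec (smul a x) = smul a (normal_vec x)"
  by (simp add: normal_vec_def lin_ext_smul)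

lemma normal_vec_in_normal_space:
  assumes "x \<in> free_space G n"
  shows "normal_vec x \<in> normal_space n"
  unfolding normal_vec_def
proof (rule lin_ext_in_subspace[OF subspace_normal_space])
  fix t assume "t \<in> Poly_Mapping.keys x"
  then have "set_tree t \<subseteq> G" "size1 t = n" using assms by (auto simp: free_space_iff)
  then show "opt_vec (nfl t) \<in> normal_space n"
    using nfl_SomeD[of t] by (cases "nfl t") (auto simp: normal_space_def size1_size)
qed

lemma normal_class_nonempty:
  assumes "v \<in> normal_space n"
  obtains x where "x \<in> normal_class n v"
proof
  let ?x = "lin_ext (\<lambda>ws. basis_vec (comb ws)) v"
  have "?x \<in> free_space G n"
    using assms by (intro lin_ext_in_subspace subspace_free_space) (auto simp: normal_space_def)
  moreover have "normal_vec ?x = lin_ext basis_vec v"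
    unfolding normal_vec_def lin_ext_lin_ext using assms
    by (intro lin_ext_cong) (auto simp: normal_space_def)
  ultimately show "?x \<in> normal_class n v" by (simp add: normal_class_def)
qed

lemma coordinates_normal_class [simp]: "v \<in> normal_space n \<Longrightarrow> coordinates (normal_class n v) = v"
proof -
  assume "v \<in> normal_space n"
  then obtain x where "x \<in> normal_class n v" by (rule normal_class_nonempty)
  then have "(SOME x. x \<in> normal_class n v) \<in> normal_class n v" by (rule someI)
  then show ?thesis by (simp add: coordinates_def normal_class_def)
qed

lemma coset_eq_normal_class:
  assumes "x \<in> free_space G n"
  shows "{x + w | w. w \<in> relations n} = normal_class n (normal_vec x)"
proof
  show "{x + w | w. w \<in> relations n} \<subseteq> normal_class n (normal_vec x)"
    using assms by (auto simp: relations_def normal_class_def normal_vec_add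
      intro: free_vs.subspace_add[OF subspace_free_space])
  show "normal_class n (normal_vec x) \<subseteq> {x + w | w. w \<in> relations n}"
  proof
    fix y assume "y \<in> normal_class n (normal_vec x)"
    then have "y - x \<in> relations n"
      using assms by (auto simp: relations_def normal_class_def normal_vec_diff
        intro: free_vs.subspace_diff[OF subspace_free_space])
    then show "y \<in> {x + w | w. w \<in> relations n}" by (auto intro!: exI[of _ "y - x"])
  qed
qed

text \<open>The operations of \<open>quotient_operad\<close> collect the results for all
  representatives and add the relations. If all results have one normal form, this set is a single
  coset.\<close>

lemma Union_coset_eq_normal_class:
  assumes "z \<in> S" "S \<subseteq> normal_class n v"
  shows "{x + w | x w. x \<in> S \<and> w \<in> relations n} = normal_class n v"
proof -
  have "{x + w | x w. x \<in> S \<and> w \<in> relations n} = (\<Union>x\<in>S. {x + w | w. w \<in> relations n})" by blast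
  also have "\<dots> = (\<Union>x\<in>S. normal_class n v)"
  proof (rule SUP_cong[OF refl])
    fix x assume "x \<in> S"
    then have "x \<in> free_space G n" "normal_vec x = v" using assms(2) by (auto simp: normal_class_def)
    then show "{x + w | w. w \<in> relations n} = normal_class n v" using coset_eq_normal_class by blast
  qed
  also have "\<dots> = normal_class n v" using assms(1) by auto
  finally show ?thesis .
qed

lemma space_quotient: "space (quotient :: ('a::field, _) ns_operad) n = normal_class n ` normal_space n"
proof -
  have "space (quotient :: ('a, _) ns_operad) n = (\<lambda>x. normal_class n (normal_vec x)) ` free_space G n"
    unfolding quotient_operad_def by (auto simp flip: coset_eq_normal_class)
  also have "\<dots> = normal_class n ` normal_space n"
  proof
    show "normal_class n ` normal_space n \<subseteq> (\<lambda>x. normal_class n (normal_vec x)) ` (free_space G n :: ('x tree \<Rightarrow>\<^sub>0 'a) set)"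
    proof clarify
      fix v :: "'x list \<Rightarrow>\<^sub>0 'a" assume "v \<in> normal_space n"
      then obtain x where "x \<in> normal_class n v" by (rule normal_class_nonempty)
      then show "normal_class n v \<in> (\<lambda>x. normal_class n (normal_vec x)) ` free_space G n"
        by (auto simp: normal_class_def)
    qed
  qed (use normal_vec_in_normal_space in blast)
  finally show ?thesis .
qed

lemma in_space_quotientE:
  assumes "A \<in> space (quotient :: ('a::field, _) ns_operad) n"
  obtains "coordinates A \<in> normal_space n" "A = normal_class n (coordinates A)"
  using assms by (auto simp: space_quotient)

lemma add_quotient:
  assumes "v \<in> normal_space n" "u \<in> normal_space n"
  shows "add quotient n (normal_class n v) (normal_class n u) = normal_class n (v + u :: _ \<Rightarrow>\<^sub>0 'a::field)"
proof -
  let ?S = "{x + y | x y. x \<in> normal_class n v \<and> y \<in> normal_class n u}"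
  obtain x y where xy: "x \<in> normal_class n v" "y \<in> normal_class n u"
    using assms normal_class_nonempty by metis
  have "add quotient n (normal_class n v) (normal_class n u) = {x + w | x w. x \<in> ?S \<and> w \<in> relations n}"
    by (auto simp: quotient_operad_def)
  also have "\<dots> = normal_class n (v + u)"
    by (rule Union_coset_eq_normal_class[of "x + y"])
      (use xy in \<open>auto simp: normal_class_def normal_vec_add intro: free_vs.subspace_add[OF subspace_free_space]\<close>)
  finally show ?thesis .
qed

lemma scale_quotient:
  assumes "v \<in> normal_space n"
  shows "scale quotient n a (normal_class n v) = normal_class n (smul a v :: _ \<Rightarrow>\<^sub>0 'a::field)"
proof -
  let ?S = "smul a ` normal_class n v"
  obtain x where x: "x \<in> normal_class n v"
    using assms normal_class_nonempty by metis
  have "scale quotient n a (normal_class n v) = {x + w | x w. x \<in> ?S \<and> w \<in> relations n}"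
    by (auto simp: quotient_operad_def)
  also have "\<dots> = normal_class n (smul a v)"
    by (rule Union_coset_eq_normal_class[of "smul a x"])
      (use x in \<open>auto simp: normal_class_def normal_vec_smul intro: free_vs.subspace_scale[OF subspace_free_space]\<close>)
  finally show ?thesis .
qed

lemma pcomp_quotient:
  assumes "v \<in> normal_space m" "u \<in> normal_space n" "1 \<le> i" "i \<le> m"
  shows "pcomp quotient m n i (normal_class m v) (normal_class n u) =
    normal_class (m + n - 1) (lin_ext (\<lambda>p. lin_ext (\<lambda>q. opt_vec (comp p i q)) u) v :: _ \<Rightarrow>\<^sub>0 'a::field)"
proof -
  let ?S = "{free_comp x i y | x y. x \<in> normal_class m v \<and> y \<in> normal_class n u}"
  obtain x y where xy: "x \<in> normal_class m v" "y \<in> normal_class n u"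
    using assms normal_class_nonempty by metis
  have "pcomp quotient m n i (normal_class m v) (normal_class n u) =
      {x + w | x w. x \<in> ?S \<and> w \<in> relations (m + n - 1)}"
    by (auto simp: quotient_operad_def)
  also have "\<dots> = normal_class (m + n - 1) (lin_ext (\<lambda>p. lin_ext (\<lambda>q. opt_vec (comp p i q)) u) v)"
  proof (rule Union_coset_eq_normal_class[of "free_comp x i y"])
    show "?S \<subseteq> normal_class (m + n - 1) (lin_ext (\<lambda>p. lin_ext (\<lambda>q. opt_vec (comp p i q)) u) v)"
    proof clarify
      fix x y assume "x \<in> normal_class m v" "y \<in> normal_class n u"
      then show "free_comp x i y \<in> normal_class (m + n - 1) (lin_ext (\<lambda>p. lin_ext (\<lambda>q. opt_vec (comp p i q)) u) v)"
        using assms(3,4) normal_vec_free_comp[of x m y n i] free_comp_in_free_space[of x G m y n i]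
        unfolding normal_class_def by auto
    qed
  qed (use xy in blast)
  finally show ?thesis .
qed

lemma comp_in_normal_space:
  assumes "v \<in> normal_space m" "u \<in> normal_space n" "1 \<le> i" "i \<le> m"
  shows "lin_ext (\<lambda>p. lin_ext (\<lambda>q. opt_vec (comp p i q)) u) v \<in> normal_space (m + n - 1)"
proof -
  obtain x y where "x \<in> normal_class m v" "y \<in> normal_class n u"
    using assms normal_class_nonempty by metis
  then have "free_comp x i y \<in> free_space G (m + n - 1)"
    "normal_vec (free_comp x i y) = lin_ext (\<lambda>p. lin_ext (\<lambda>q. opt_vec (comp p i q)) u) v"
    using assms(3,4) normal_vec_free_comp[of x m y n i] free_comp_in_free_space[of x G m y n i]
    unfolding normal_class_def by auto
  then show ?thesis using normal_vec_in_normal_space by metis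
qed

text \<open>A comb has at least one leaf, so arity 0 is zero. In arity 1 the only word is the empty
  one, which is the normal form of the unit.\<close>

lemma connected_operad_quotient: "connected_operad (quotient :: ('a::field, _) ns_operad)"
  unfolding connected_operad_def
proof
  have "normal_space 0 = {0 :: 'x list \<Rightarrow>\<^sub>0 'a}" by (auto simp: normal_space_def)
  then show "card (space (quotient :: ('a, _) ns_operad) 0) = 1" by (simp add: space_quotient)
  have nil: "nfl Leaf = Some []" using nfl_comb_iff[of "[]"] by simp
  have unit: "unit (quotient :: ('a, _) ns_operad) = normal_class 1 (basis_vec [])"
    using coset_eq_normal_class[of "basis_vec Leaf :: _ \<Rightarrow>\<^sub>0 'a" 1]
    by (simp add: quotient_operad_def normal_vec_def nil)
  have space1: "normal_space 1 = range (\<lambda>a :: 'a. smul a (basis_vec ([] :: 'x list)))"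
  proof
    show "normal_space 1 \<subseteq> range (\<lambda>a :: 'a. smul a (basis_vec ([] :: 'x list)))"
    proof
      fix v :: "'x list \<Rightarrow>\<^sub>0 'a" assume "v \<in> normal_space 1"
      then have "Poly_Mapping.keys v \<subseteq> {[]}" by (auto simp: normal_space_def)
      then have "lin_ext basis_vec v = smul (Poly_Mapping.lookup v []) (basis_vec [])"
        by (subst lin_ext_superset[of "{[]}"]) auto
      then show "v \<in> range (\<lambda>a. smul a (basis_vec []))" by simp
    qed
  qed (auto simp: normal_space_def nil split: if_splits)
  have in_space: "smul a (basis_vec []) \<in> normal_space 1" for a :: 'a
    unfolding space1 by blast
  have scale: "scale quotient 1 a (unit quotient) = normal_class 1 (smul a (basis_vec []))" for a :: 'a
    unfolding unit using in_space[of 1] by (intro scale_quotient) simp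
  show "bij_betw (\<lambda>c :: 'a. scale quotient 1 c (unit quotient)) UNIV (space quotient 1)"
    unfolding bij_betw_def scale
  proof
    show "inj (\<lambda>a :: 'a. normal_class 1 (smul a (basis_vec [])))"
    proof (rule injI)
      fix a b :: 'a
      assume "normal_class 1 (smul a (basis_vec [])) = normal_class 1 (smul b (basis_vec []))"
      then have "smul a (basis_vec ([] :: 'x list)) = smul b (basis_vec [])"
        using coordinates_normal_class[OF in_space[of a]] coordinates_normal_class[OF in_space[of b]] by metis
      then show "a = b" by (metis lookup_single_eq mult.right_neutral smul_single)
    qed
  qed (simp only: space_quotient space1 image_image)
qed


section \<open>The bar construction, presented by generators and relations, against the complex of
  normal combs\<close>

subsection \<open>Expansion of decorations\<close>

text \<open>The multilinear expansion of all decorations in the basis of normal combs. Modulo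
  \<open>bar_rels\<close> it is the isomorphism from the bar construction to the complex
  above.\<close>

fun expand :: "('x tree \<Rightarrow>\<^sub>0 'a::field) set dtree \<Rightarrow> 'x list dtree \<Rightarrow>\<^sub>0 'a"
  and expand_list :: "('x tree \<Rightarrow>\<^sub>0 'a) set dtree list \<Rightarrow> 'x list dtree list \<Rightarrow>\<^sub>0 'a" where
  "expand DLeaf = basis_vec DLeaf"
| "expand (DNode A ts) = lin_ext (\<lambda>p. lin_ext (\<lambda>us. basis_vec (DNode p us)) (expand_list ts)) (coordinates A)"
| "expand_list [] = basis_vec []"
| "expand_list (t # ts) = lin_ext (\<lambda>u. lin_ext (\<lambda>us. basis_vec (u # us)) (expand_list ts)) (expand t)"

lemma expand_list_append:
  "lin_ext f (expand_list (xs @ ys)) = lin_ext (\<lambda>a. lin_ext (\<lambda>b. f (a @ b)) (expand_list ys)) (expand_list xs)"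
  by (induction xs arbitrary: f) (simp_all add: lin_ext_lin_ext)

lemma lin_ext_expand_list_Cons:
  "lin_ext f (expand_list (t # ts)) = lin_ext (\<lambda>u. lin_ext (\<lambda>us. f (u # us)) (expand_list ts)) (expand t)"
  by (simp add: lin_ext_lin_ext)

declare expand_list.simps(2) [simp del]

abbreviation bar :: "('x tree \<Rightarrow>\<^sub>0 'a::field) set dtree \<Rightarrow> bool" where
  "bar \<equiv> bar_tree quotient"

lemma keys_expand:
  fixes t :: "('x tree \<Rightarrow>\<^sub>0 'a::field) set dtree" and ts :: "('x tree \<Rightarrow>\<^sub>0 'a) set dtree list"
  shows "bar t \<Longrightarrow> s \<in> Poly_Mapping.keys (expand t) \<Longrightarrow>
      wdecorated s \<and> dleaves s = dleaves t \<and> dnodes s = dnodes t"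
    and "\<forall>t\<in>set ts. bar t \<Longrightarrow> us \<in> Poly_Mapping.keys (expand_list ts) \<Longrightarrow>
      (\<forall>u\<in>set us. wdecorated u) \<and> length us = length ts \<and> fleaves us = fleaves ts \<and> fnodes us = fnodes ts"
proof (induction t and ts arbitrary: s and us rule: expand_expand_list.induct)
  case (2 A ts)
  from 2(3) obtain p us where us: "p \<in> Poly_Mapping.keys (coordinates A)"
    "us \<in> Poly_Mapping.keys (expand_list ts)" "s = DNode p us"
    by (auto elim!: in_keys_lin_extE)
  have "coordinates A \<in> normal_space (length ts)"
    using 2(2) by (auto elim: in_space_quotientE)
  then have "p \<in> normal_words (length ts)"
    using us(1) 2(2) by (auto simp: normal_space_def normal_words_def)
  then show ?case using 2(1)[OF _ us(2)] 2(2) us(3) by auto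
next
  case (4 t ts)
  from 4(4) obtain v vs where v: "v \<in> Poly_Mapping.keys (expand t)"
    "vs \<in> Poly_Mapping.keys (expand_list ts)" "us = v # vs"
    by (auto simp: expand_list.simps(2) elim!: in_keys_lin_extE)
  then show ?case using 4(2)[OF _ v(1)] 4(1)[OF _ v(2)] 4(3) by auto
qed auto

text \<open>In coordinates the composition of the quotient is the bilinear extension of
  \<open>comp\<close>. All terms in the expansion of a subtree have as many vertices as the subtree,
  so \<open>j\<close> denotes the same edge in each of them.\<close>

lemma expand_contract:
  fixes t :: "('x tree \<Rightarrow>\<^sub>0 'a::field) set dtree"
  assumes "bar t" "1 \<le> j" "j < dnodes t"
  defines "c \<equiv> \<lambda>m n i p q. Some (pcomp (quotient :: ('a, _) ns_operad) m n i p q)"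
  shows "lin_ext expand (opt_vec (contract c t j)) =
    lin_ext (\<lambda>s. opt_vec (contract wcomp s j)) (expand t)"
  using assms(1-3)
proof (induction "dnodes t" arbitrary: t j rule: less_induct)
  case less
  from less.prems(2,3) show ?case
  proof (cases rule: edge_cases)
    case (root A xs B us ys)
    let ?m = "length xs + 1 + length ys" and ?i = "length xs + 1"
    have A: "coordinates A \<in> normal_space ?m" "A = normal_class ?m (coordinates A)"
      and B: "coordinates B \<in> normal_space (length us)" "B = normal_class (length us) (coordinates B)"
      using less.prems(1) root by (auto elim: in_space_quotientE)
    have "pcomp quotient ?m (length us) ?i A B = normal_class (?m + length us - 1)
        (lin_ext (\<lambda>p. lin_ext (\<lambda>q. opt_vec (comp p ?i q)) (coordinates B)) (coordinates A))"
      using pcomp_quotient[OF A(1) B(1), of ?i] A(2) B(2) by simp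
    moreover have "lin_ext (\<lambda>p. lin_ext (\<lambda>q. opt_vec (comp p ?i q)) (coordinates B)) (coordinates A) \<in>
        normal_space (?m + length us - 1)"
      using comp_in_normal_space[OF A(1) B(1), of ?i] by simp
    ultimately have coords: "coordinates (pcomp quotient ?m (length us) ?i A B) =
        lin_ext (\<lambda>p. lin_ext (\<lambda>q. opt_vec (comp p ?i q)) (coordinates B)) (coordinates A)"
      by simp
    have "lin_ext expand (opt_vec (contract c t j)) =
        expand (DNode (pcomp quotient ?m (length us) ?i A B) (xs @ us @ ys))"
      unfolding root contract_root by (simp add: c_def)
    also have "\<dots> = lin_ext (\<lambda>p. lin_ext (\<lambda>q. lin_ext (\<lambda>r. lin_ext (\<lambda>a. lin_ext (\<lambda>b. lin_ext (\<lambda>d.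
        basis_vec (DNode r (a @ b @ d))) (expand_list ys)) (expand_list us)) (expand_list xs))
        (opt_vec (comp p ?i q))) (coordinates B)) (coordinates A)"
      by (simp only: expand.simps coords lin_ext_lin_ext expand_list_append)
    also have "\<dots> = lin_ext (\<lambda>p. lin_ext (\<lambda>q. lin_ext (\<lambda>a. lin_ext (\<lambda>b. lin_ext (\<lambda>d. lin_ext (\<lambda>r.
        basis_vec (DNode r (a @ b @ d))) (opt_vec (comp p ?i q))) (expand_list ys)) (expand_list us))
        (expand_list xs)) (coordinates B)) (coordinates A)"
      by (simp only: lin_ext_swap[where x = "opt_vec _"])
    also have "\<dots> = lin_ext (\<lambda>p. lin_ext (\<lambda>q. lin_ext (\<lambda>a. lin_ext (\<lambda>b. lin_ext (\<lambda>d.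
        opt_vec (contract wcomp (DNode p (a @ DNode q b # d)) j)) (expand_list ys)) (expand_list us))
        (expand_list xs)) (coordinates B)) (coordinates A)"
    proof (intro lin_ext_cong)
      fix p q a b d assume "a \<in> Poly_Mapping.keys (expand_list xs)"
      then have "length a = length xs" "fnodes a = fnodes xs"
        using keys_expand(2)[of xs a] less.prems(1) root by auto
      then have "contract wcomp (DNode p (a @ DNode q b # d)) j =
          map_option (\<lambda>r. DNode r (a @ b @ d)) (comp p ?i q)"
        using contract_root[of wcomp p a q b d] root by simp
      then show "lin_ext (\<lambda>r. basis_vec (DNode r (a @ b @ d))) (opt_vec (comp p ?i q)) =
          opt_vec (contract wcomp (DNode p (a @ DNode q b # d)) j)"
        by (cases "comp p ?i q") auto
    qed
    also have "\<dots> = lin_ext (\<lambda>p. lin_ext (\<lambda>a. lin_ext (\<lambda>q. lin_ext (\<lambda>b. lin_ext (\<lambda>d.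
        opt_vec (contract wcomp (DNode p (a @ DNode q b # d)) j)) (expand_list ys)) (expand_list us))
        (coordinates B)) (expand_list xs)) (coordinates A)"
      by (simp only: lin_ext_swap[where x = "coordinates B"])
    also have "\<dots> = lin_ext (\<lambda>s. opt_vec (contract wcomp s j)) (expand t)"
      by (simp only: root expand.simps lin_ext_lin_ext expand_list_append lin_ext_expand_list_Cons lin_ext_basis_vec
        append_Cons)
    finally show ?thesis .
  next
    case (child A xs u ys i)
    let ?F = "\<lambda>p a v. lin_ext (\<lambda>d. basis_vec (DNode p (a @ v # d))) (expand_list ys)"
    have u: "bar u" using less.prems(1) child by auto
    have IH: "lin_ext expand (opt_vec (contract c u i)) = lin_ext (\<lambda>s. opt_vec (contract wcomp s i)) (expand u)"
      using child u by (intro less.hyps) auto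
    have "lin_ext (\<lambda>s. opt_vec (contract wcomp s j)) (expand t) =
        lin_ext (\<lambda>p. lin_ext (\<lambda>a. lin_ext (\<lambda>v. lin_ext (\<lambda>d.
        opt_vec (contract wcomp (DNode p (a @ v # d)) j)) (expand_list ys)) (expand u))
        (expand_list xs)) (coordinates A)"
      by (simp only: child(1) expand.simps lin_ext_lin_ext expand_list_append lin_ext_expand_list_Cons lin_ext_basis_vec)
    also have "\<dots> = lin_ext (\<lambda>p. lin_ext (\<lambda>a. lin_ext (\<lambda>v. lin_ext (\<lambda>d. lin_ext (\<lambda>v'.
        basis_vec (DNode p (a @ v' # d))) (opt_vec (contract wcomp v i))) (expand_list ys)) (expand u))
        (expand_list xs)) (coordinates A)"
    proof (intro lin_ext_cong)
      fix p a v d assume "a \<in> Poly_Mapping.keys (expand_list xs)" "v \<in> Poly_Mapping.keys (expand u)"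
      then have "fnodes a = fnodes xs" "dnodes v = dnodes u"
        using keys_expand(2)[of xs a] keys_expand(1)[OF u, of v] less.prems(1) child by auto
      then have "contract wcomp (DNode p (a @ v # d)) j =
          map_option (\<lambda>v'. DNode p (a @ v' # d)) (contract wcomp v i)"
        using contract_child[of i v wcomp p a d] child by simp
      then show "opt_vec (contract wcomp (DNode p (a @ v # d)) j) =
          lin_ext (\<lambda>v'. basis_vec (DNode p (a @ v' # d))) (opt_vec (contract wcomp v i))"
        by (cases "contract wcomp v i") auto
    qed
    also have "\<dots> = lin_ext (\<lambda>p. lin_ext (\<lambda>a. lin_ext (?F p a)
        (lin_ext (\<lambda>v. opt_vec (contract wcomp v i)) (expand u))) (expand_list xs)) (coordinates A)"
      unfolding lin_ext_lin_ext by (simp only: lin_ext_swap[where x = "expand_list ys"])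
    also have "\<dots> = lin_ext (\<lambda>p. lin_ext (\<lambda>a. lin_ext (?F p a)
        (lin_ext expand (opt_vec (contract c u i)))) (expand_list xs)) (coordinates A)"
      by (simp only: IH)
    also have "\<dots> = lin_ext expand (opt_vec (contract c t j))"
      unfolding child(1,2) contract_child[OF child(3,4)]
      by (cases "contract c u i")
        (simp_all add: lin_ext_lin_ext expand_list_append lin_ext_expand_list_Cons)
    finally show ?thesis by simp
  qed
qed

lemma expand_bar_diff:
  fixes t :: "('x tree \<Rightarrow>\<^sub>0 'a::field) set dtree"
  assumes "bar t"
  shows "lin_ext expand (bar_diff quotient t) = lin_ext wdiff (expand t)"
proof -
  let ?c = "\<lambda>m n i p q. Some (pcomp (quotient :: ('a, _) ns_operad) m n i p q)"
  have "lin_ext expand (bar_diff quotient t) =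
      (\<Sum>j\<in>{1..<dnodes t}. smul ((-1) ^ j) (lin_ext expand (opt_vec (contract ?c t j))))"
    unfolding bar_diff_eq_diff diff_def by (simp only: lin_ext_sum lin_ext_smul)
  also have "\<dots> = (\<Sum>j\<in>{1..<dnodes t}. smul ((-1) ^ j)
      (lin_ext (\<lambda>s. opt_vec (contract wcomp s j)) (expand t)))"
    by (intro sum.cong refl arg_cong[of _ _ "smul _"] expand_contract assms) auto
  also have "\<dots> = lin_ext (\<lambda>s. \<Sum>j\<in>{1..<dnodes t}. smul ((-1) ^ j) (opt_vec (contract wcomp s j))) (expand t)"
    by (simp only: lin_ext_fun_sum lin_ext_fun_smul)
  also have "\<dots> = lin_ext wdiff (expand t)"
    using keys_expand(1)[OF assms] by (intro lin_ext_cong) (simp add: diff_def)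
  finally show ?thesis .
qed

lemma bar_iff_decorated:
  "bar t \<longleftrightarrow> decorated (\<lambda>m. if 2 \<le> m then space (quotient :: ('a::field, _) ns_operad) m else {}) t"
  by (induction t) auto

lemma keys_bar_diff:
  fixes t :: "('x tree \<Rightarrow>\<^sub>0 'a::field) set dtree"
  assumes "bar t" "s \<in> Poly_Mapping.keys (bar_diff quotient t :: _ \<Rightarrow>\<^sub>0 'a)"
  shows "bar s \<and> dleaves s = dleaves t \<and> dnodes t = dnodes s + 1"
proof -
  let ?V = "\<lambda>m. if 2 \<le> m then space (quotient :: ('a, _) ns_operad) m else {}"
  let ?c = "\<lambda>m n i p q. Some (pcomp (quotient :: ('a, _) ns_operad) m n i p q)"
  have closed: "r \<in> ?V (m + n - 1)"
    if "p \<in> ?V m" "q \<in> ?V n" "1 \<le> i" "i \<le> m" "?c m n i p q = Some r" for p q r m n i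
  proof -
    have "p \<in> space quotient m" "q \<in> space quotient n" "2 \<le> m" "2 \<le> n"
      using that(1,2) by (auto split: if_splits)
    moreover from this obtain u v where "p = normal_class m v" "v \<in> normal_space m"
      "q = normal_class n u" "u \<in> normal_space n" by (auto simp: space_quotient)
    ultimately show ?thesis
      using that(3-5) comp_in_normal_space[of v m u n i] by (auto simp: pcomp_quotient space_quotient)
  qed
  from subsetD[OF keys_sum assms(2)[unfolded bar_diff_eq_diff diff_def]]
  obtain j where j: "j \<in> {1..<dnodes t}"
    "s \<in> Poly_Mapping.keys (smul ((-1) ^ j) (opt_vec (contract ?c t j) :: _ \<Rightarrow>\<^sub>0 'a))" ..
  from subsetD[OF keys_smul j(2)] have s: "contract ?c t j = Some s" by simp
  have "decorated ?V s"
  proof (rule decorated_contract[OF _ _ s])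
    fix p q r m n i
    assume "p \<in> ?V m" "q \<in> ?V n" "1 \<le> i" "i \<le> m" "?c m n i p q = Some r"
    then show "r \<in> ?V (m + n - 1)" by (rule closed)
  qed (use j(1) assms(1) in \<open>auto simp: bar_iff_decorated\<close>)
  then show ?thesis
    using contract_preserves[OF s] j(1) by (simp add: bar_iff_decorated)
qed

text \<open>Each relation expresses linearity in one decoration, and the expansion is linear in each
  decoration separately.\<close>

lemma lin_ext_expand_bar_rels:
  assumes "x \<in> bar_rels (quotient :: ('a::field, _) ns_operad) n d"
  shows "lin_ext expand x = 0"
proof (rule lin_ext_span_zero[OF assms[unfolded bar_rels_def]])
  fix z assume "z \<in> {basis_vec t - smul c (basis_vec u) - basis_vec v | c t u v.
        decor_comb (quotient :: ('a, _) ns_operad) c t u v \<and> bar t \<and> bar u \<and> bar v \<and>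
        dleaves t = n \<and> dnodes t = d}"
  then obtain c t u v where z: "z = basis_vec t - smul c (basis_vec u) - basis_vec v"
    "decor_comb (quotient :: ('a, _) ns_operad) c t u v" by blast
  from z(2) have "expand t = smul c (expand u) + expand v"
  proof induction
    case (root p ts q)
    then obtain a b where ab: "p = normal_class (length ts) a" "a \<in> normal_space (length ts)"
      "q = normal_class (length ts) b" "b \<in> normal_space (length ts)" by (auto simp: space_quotient)
    have sa: "smul c a \<in> normal_space (length ts)"
      using ab by (intro free_vs.subspace_scale[OF subspace_normal_space])
    then have "smul c a + b \<in> normal_space (length ts)"
      using ab by (intro free_vs.subspace_add[OF subspace_normal_space])
    then have "coordinates (add quotient (length ts) (scale quotient (length ts) c p) q) =
        smul c (coordinates p) + coordinates q"
      using ab sa by (simp add: scale_quotient add_quotient)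
    then show ?case by (simp add: lin_ext_add lin_ext_smul)
  next
    case (child t u v p xs ys)
    have "expand (DNode p (xs @ s # ys)) = lin_ext (\<lambda>q. lin_ext (\<lambda>a. lin_ext (\<lambda>s. lin_ext (\<lambda>b.
        basis_vec (DNode q (a @ s # b))) (expand_list ys)) (expand s)) (expand_list xs)) (coordinates p)" for s
      by (simp only: expand.simps expand_list_append lin_ext_expand_list_Cons)
    then show ?case
      by (simp add: child.IH lin_ext_add lin_ext_smul lin_ext_fun_add lin_ext_fun_smul)
  qed
  then show "lin_ext expand z = 0"
    by (simp add: z(1) lin_ext_diff lin_ext_single)
qed

text \<open>Decorating with these classes gives \<open>realize\<close>, which is inverse to
  \<open>expand\<close> modulo the relations of the bar construction.\<close>

definition word_class :: "'x list \<Rightarrow> ('x tree \<Rightarrow>\<^sub>0 'a::field) set" where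
  "word_class w = normal_class (length w + 1) (basis_vec w)"

abbreviation realize :: "'x list dtree \<Rightarrow> ('x tree \<Rightarrow>\<^sub>0 'a::field) set dtree" where
  "realize \<equiv> map_dtree word_class"

lemma dleaves_map_dtree [simp]: "dleaves (map_dtree f t) = dleaves t"
  by (induction t) (auto intro!: arg_cong[of _ _ sum_list])

lemma dnodes_map_dtree [simp]: "dnodes (map_dtree f t) = dnodes t"
  by (induction t) (auto intro!: arg_cong[of _ _ sum_list])

lemma basis_vec_in_normal_space:
  "w \<in> normal_words m \<Longrightarrow> basis_vec w \<in> normal_space m"
  by (auto simp: normal_words_def normal_space_def)

lemma word_class_in_space:
  assumes "w \<in> normal_words m"
  shows "word_class w \<in> space (quotient :: ('a::field, _) ns_operad) m"
  using assms basis_vec_in_normal_space[OF assms]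
  by (auto simp: word_class_def space_quotient normal_words_def)

lemma bar_realize: "wdecorated s \<Longrightarrow> bar (realize s :: ('x tree \<Rightarrow>\<^sub>0 'a::field) set dtree)"
  by (induction s) (auto simp: word_class_in_space, auto simp: normal_words_def)

lemma expand_realize:
  "wdecorated s \<Longrightarrow> expand (realize s) = (basis_vec s :: _ \<Rightarrow>\<^sub>0 'a::field)"
proof (induction s)
  case (DNode p us)
  have "\<forall>u\<in>set us. expand (realize u) = (basis_vec u :: _ \<Rightarrow>\<^sub>0 'a)"
    using DNode by auto
  then have "expand_list (map realize us) = (basis_vec us :: _ \<Rightarrow>\<^sub>0 'a)"
    by (induction us) (auto simp: expand_list.simps(2))
  moreover have "coordinates (word_class p) = (basis_vec p :: _ \<Rightarrow>\<^sub>0 'a)"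
  proof -
    have "p \<in> normal_words (length us)" using DNode.prems by simp
    then have "(basis_vec p :: _ \<Rightarrow>\<^sub>0 'a) \<in> normal_space (length us)" "length us = length p + 1"
      by (auto intro: basis_vec_in_normal_space simp: normal_words_def)
    then show ?thesis by (simp add: word_class_def)
  qed
  ultimately show ?case by simp
qed simp

text \<open>Below a further vertex, a relation in one decoration remains one. This lets children be
  replaced one at a time.\<close>

lemma bar_rels_child:
  assumes "z \<in> bar_rels (quotient :: ('a::field, _) ns_operad) n d"
    and "p \<in> space (quotient :: ('a, _) ns_operad) (length (xs @ ys) + 1)" "xs @ ys \<noteq> []"
      "\<forall>t\<in>set (xs @ ys). bar t"
  shows "lin_ext (\<lambda>s. basis_vec (DNode p (xs @ s # ys))) z \<in>
    bar_rels quotient (fleaves (xs @ ys) + n) (1 + fnodes (xs @ ys) + d)"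
proof (rule lin_ext_span_in_subspace[OF assms(1)[unfolded bar_rels_def]])
  show "free_vs.subspace (bar_rels (quotient :: ('a, _) ns_operad) (fleaves (xs @ ys) + n) (1 + fnodes (xs @ ys) + d))"
    unfolding bar_rels_def by (rule free_vs.subspace_span)
  fix z assume "z \<in> {basis_vec t - smul c (basis_vec u) - basis_vec v | c t u v.
        decor_comb (quotient :: ('a, _) ns_operad) c t u v \<and> bar t \<and> bar u \<and> bar v \<and>
        dleaves t = n \<and> dnodes t = d}"
  then obtain c t u v where z: "z = basis_vec t - smul c (basis_vec u) - basis_vec v"
    "decor_comb (quotient :: ('a, _) ns_operad) c t u v" "bar t" "bar u" "bar v"
    "dleaves t = n" "dnodes t = d" by blast
  have "xs \<noteq> [] \<or> ys \<noteq> []" using assms(3) by auto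
  then have "2 \<le> Suc (length xs + length ys)" by (cases xs; cases ys) auto
  then have bar: "bar (DNode p (xs @ s # ys))" if "bar s" for s
    using assms(2,4) that by auto
  have "lin_ext (\<lambda>s. basis_vec (DNode p (xs @ s # ys))) z = basis_vec (DNode p (xs @ t # ys)) -
      smul c (basis_vec (DNode p (xs @ u # ys))) - basis_vec (DNode p (xs @ v # ys))"
    unfolding z(1) by (simp only: lin_ext_diff lin_ext_smul lin_ext_basis_vec)
  then show "lin_ext (\<lambda>s. basis_vec (DNode p (xs @ s # ys))) z \<in>
      bar_rels quotient (fleaves (xs @ ys) + n) (1 + fnodes (xs @ ys) + d)"
    unfolding bar_rels_def using z bar
    by (intro free_vs.span_base CollectI exI[of _ c] exI[of _ "DNode p (xs @ t # ys)"]
        exI[of _ "DNode p (xs @ u # ys)"] exI[of _ "DNode p (xs @ v # ys)"] conjI decor_comb.child) auto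
qed

lemma subspace_bar_rels: "free_vs.subspace (bar_rels P n d)"
  unfolding bar_rels_def by (rule free_vs.subspace_span)

text \<open>The relation for two summands yields the expansion of a decoration with any finite
  support, by splitting off one word after the other.\<close>

lemma bar_rels_root:
  fixes us :: "('x tree \<Rightarrow>\<^sub>0 'a::field) set dtree list"
  assumes "v \<in> normal_space (length us)" "2 \<le> length us" "\<forall>t\<in>set us. bar t"
  shows "basis_vec (DNode (normal_class (length us) v) us) -
      lin_ext (\<lambda>p. basis_vec (DNode (word_class p) us)) v \<in> bar_rels quotient (fleaves us) (1 + fnodes us)"
proof -
  let ?m = "length us"
  let ?R = "bar_rels (quotient :: ('a, _) ns_operad) (fleaves us) (1 + fnodes us)"
  let ?N = "\<lambda>v. basis_vec (DNode (normal_class ?m v) us) :: _ \<Rightarrow>\<^sub>0 'a"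
  have comb: "?N (smul c u + v) - smul c (?N u) - ?N v \<in> ?R"
    if "u \<in> normal_space ?m" "v \<in> normal_space ?m" for c u v
  proof -
    have in_space: "smul c u \<in> normal_space ?m" "smul c u + v \<in> normal_space ?m"
      using that by (auto intro: free_vs.subspace_scale[OF subspace_normal_space] free_vs.subspace_add[OF subspace_normal_space])
    have space: "normal_class ?m w \<in> space quotient ?m" if "w \<in> normal_space ?m" for w :: "'x list \<Rightarrow>\<^sub>0 'a"
      using that by (simp add: space_quotient)
    have "decor_comb quotient c (DNode (add quotient ?m (scale quotient ?m c (normal_class ?m u)) (normal_class ?m v)) us)
        (DNode (normal_class ?m u) us) (DNode (normal_class ?m v) us)"
      using that by (intro decor_comb.root space)
    then have "decor_comb quotient c (DNode (normal_class ?m (smul c u + v)) us)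
        (DNode (normal_class ?m u) us) (DNode (normal_class ?m v) us)"
      using that in_space by (simp add: scale_quotient add_quotient)
    moreover have "bar (DNode (normal_class ?m w) us)" if "w \<in> normal_space ?m" for w
      using assms(2,3) space[OF that] by simp
    ultimately show ?thesis
      unfolding bar_rels_def using that in_space
      by (intro free_vs.span_base CollectI exI[of _ c] exI[of _ "DNode (normal_class ?m (smul c u + v)) us"]
        exI[of _ "DNode (normal_class ?m u) us"] exI[of _ "DNode (normal_class ?m v) us"] conjI refl) auto
  qed
  have "(0 :: 'x list \<Rightarrow>\<^sub>0 'a) \<in> normal_space ?m"
    by (rule free_vs.subspace_0[OF subspace_normal_space])
  \<comment> \<open>The relation with \<open>c = 1\<close> and two zero decorations is the negative
    of the tree whose root is decorated with zero.\<close>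
  then have zero: "?N 0 \<in> ?R"
    using comb[of 0 0 1] free_vs.subspace_neg[OF subspace_bar_rels, of "- ?N 0"] by simp
  have "v \<in> normal_space ?m \<Longrightarrow> Poly_Mapping.keys v \<subseteq> S \<Longrightarrow>
      ?N v - lin_ext (\<lambda>p. basis_vec (DNode (word_class p) us)) v \<in> ?R" if "finite S" for S v
    using that
  proof (induction S arbitrary: v)
    case empty
    then show ?case using zero by simp
  next
    case (insert p S)
    show ?case
    proof (cases "p \<in> Poly_Mapping.keys v")
      case False
      then show ?thesis using insert by auto
    next
      case True
      define c where "c = Poly_Mapping.lookup v p"
      define v' where "v' = v - smul c (basis_vec p)"
      have v: "v = smul c (basis_vec p) + v'" by (simp add: v'_def)
      have p: "basis_vec p \<in> normal_space ?m" "length p + 1 = ?m"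
        using True insert.prems(1) by (auto simp: normal_space_def)
      have v': "v' \<in> normal_space ?m"
        unfolding v'_def using p insert.prems(1)
        by (intro free_vs.subspace_diff[OF subspace_normal_space] free_vs.subspace_scale[OF subspace_normal_space])
      have "p \<notin> Poly_Mapping.keys v'" by (simp add: in_keys_iff v'_def c_def lookup_minus)
      moreover have "Poly_Mapping.keys v' \<subseteq> insert p S"
        using insert.prems(2) keys_diff_subset[of v "smul c (basis_vec p)"] by (auto simp: v'_def split: if_splits)
      ultimately have "?N v' - lin_ext (\<lambda>p. basis_vec (DNode (word_class p) us)) v' \<in> ?R"
        using v' by (intro insert.IH) auto
      from free_vs.subspace_add[OF subspace_bar_rels comb[OF p(1) v', of c] this]
      show ?thesis unfolding v using p(2)
        by (simp add: lin_ext_add lin_ext_single word_class_def algebra_simps)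
    qed
  qed
  from this[OF finite_keys assms(1) order_refl] show ?thesis .
qed

text \<open>The children are replaced by their expansions from left to right, where
  \<open>xs\<close> holds those already treated, and the root comes last. It follows that a chain
  with expansion zero is a relation.\<close>

lemma basis_vec_minus_realize_expand:
  fixes t :: "('x tree \<Rightarrow>\<^sub>0 'a::field) set dtree"
  assumes "bar t"
  shows "basis_vec t - lin_ext (\<lambda>s. basis_vec (realize s)) (expand t) \<in> bar_rels quotient (dleaves t) (dnodes t)"
  using assms
proof (induction t)
  case DLeaf
  then show ?case by (simp add: free_vs.subspace_0[OF subspace_bar_rels])
next
  case (DNode A ts)
  let ?m = "length ts"
  let ?R = "bar_rels (quotient :: ('a, _) ns_operad) (fleaves ts) (1 + fnodes ts)"
  have A: "coordinates A \<in> normal_space ?m" "A = normal_class ?m (coordinates A)" "2 \<le> ?m"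
    using DNode.prems by (auto elim: in_space_quotientE)
  have "basis_vec (DNode A (xs @ ys)) -
      lin_ext (\<lambda>us. basis_vec (DNode A (xs @ map realize us))) (expand_list ys) \<in> ?R"
    if "length xs + length ys = ?m" "fleaves xs + fleaves ys = fleaves ts" "fnodes xs + fnodes ys = fnodes ts"
      "\<forall>t\<in>set xs. bar t" "set ys \<subseteq> set ts" for xs ys
    using that
  proof (induction ys arbitrary: xs)
    case Nil
    then show ?case by (simp add: free_vs.subspace_0[OF subspace_bar_rels])
  next
    case (Cons y ys)
    have y: "bar y" "y \<in> set ts" and ys: "\<forall>t\<in>set ys. bar t"
      using Cons.prems DNode.prems by auto
    have "lin_ext (\<lambda>s. basis_vec (DNode A (xs @ s # ys))) (basis_vec y - lin_ext (\<lambda>s. basis_vec (realize s)) (expand y))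
        \<in> bar_rels quotient (fleaves (xs @ ys) + dleaves y) (1 + fnodes (xs @ ys) + dnodes y)"
      using DNode.IH[OF y(2,1)] DNode.prems Cons.prems ys A(3)
      by (intro bar_rels_child) auto
    then have 1: "basis_vec (DNode A (xs @ y # ys)) -
        lin_ext (\<lambda>s. basis_vec (DNode A (xs @ realize s # ys))) (expand y) \<in> ?R"
      using Cons.prems(2,3) by (simp add: lin_ext_diff lin_ext_lin_ext ac_simps)
    have "lin_ext (\<lambda>s. basis_vec (DNode A ((xs @ [realize s]) @ ys)) -
        lin_ext (\<lambda>us. basis_vec (DNode A ((xs @ [realize s]) @ map realize us))) (expand_list ys)) (expand y) \<in> ?R"
      using keys_expand(1)[OF y(1)] Cons.prems
      by (intro lin_ext_in_subspace subspace_bar_rels Cons.IH) (auto simp: bar_realize)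
    from free_vs.subspace_add[OF subspace_bar_rels 1 this] show ?case
      by (simp add: lin_ext_fun_diff lin_ext_expand_list_Cons)
  qed
  from this[of "[]" ts] have 1: "basis_vec (DNode A ts) -
      lin_ext (\<lambda>us. basis_vec (DNode A (map realize us))) (expand_list ts) \<in> ?R"
    by simp
  have "lin_ext (\<lambda>us. basis_vec (DNode A (map realize us)) -
      lin_ext (\<lambda>p. basis_vec (DNode (word_class p) (map realize us))) (coordinates A)) (expand_list ts) \<in> ?R"
  proof (rule lin_ext_in_subspace[OF subspace_bar_rels])
    fix us assume "us \<in> Poly_Mapping.keys (expand_list ts)"
    then have us: "\<forall>u\<in>set us. wdecorated u" "length us = ?m" "fleaves us = fleaves ts" "fnodes us = fnodes ts"
      using keys_expand(2)[of ts us] DNode.prems by auto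
    let ?us = "map realize us :: ('x tree \<Rightarrow>\<^sub>0 'a) set dtree list"
    have "basis_vec (DNode (normal_class (length ?us) (coordinates A)) ?us) -
      lin_ext (\<lambda>p. basis_vec (DNode (word_class p) ?us)) (coordinates A)
      \<in> bar_rels quotient (fleaves ?us) (1 + fnodes ?us)"
      using A(1,3) us by (intro bar_rels_root) (auto simp: bar_realize)
    then show "basis_vec (DNode A (map realize us)) -
      lin_ext (\<lambda>p. basis_vec (DNode (word_class p) (map realize us))) (coordinates A) \<in> ?R"
      using us A(2) by (simp add: o_def)
  qed
  from free_vs.subspace_add[OF subspace_bar_rels 1 this]
  have "basis_vec (DNode A ts) - lin_ext (\<lambda>us. lin_ext (\<lambda>p. basis_vec (DNode (word_class p) (map realize us)))
      (coordinates A)) (expand_list ts) \<in> ?R"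
    by (simp add: lin_ext_fun_diff)
  also have "lin_ext (\<lambda>us. lin_ext (\<lambda>p. basis_vec (DNode (word_class p) (map realize us)))
      (coordinates A)) (expand_list ts) = lin_ext (\<lambda>s. basis_vec (realize s)) (expand (DNode A ts))"
    by (simp add: lin_ext_lin_ext lin_ext_swap[where x = "expand_list ts"])
  finally show ?case by simp
qed

lemma bar_gens_eq:
  "bar_gens (quotient :: ('a::field, _) ns_operad) n d =
     {x. Poly_Mapping.keys x \<subseteq> {t. bar t \<and> dleaves t = n \<and> dnodes t = d}}"
  unfolding bar_gens_def span_basis_vecs[symmetric]
  by (rule arg_cong[of _ _ free_vs.span]) auto

lemma minus_realize_expand:
  assumes "x \<in> bar_gens (quotient :: ('a::field, _) ns_operad) n d"
  shows "x - lin_ext (\<lambda>s. basis_vec (realize s)) (lin_ext expand x) \<in> bar_rels quotient n d"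
proof -
  have "x - lin_ext (\<lambda>s. basis_vec (realize s)) (lin_ext expand x) =
      lin_ext (\<lambda>t. basis_vec t - lin_ext (\<lambda>s. basis_vec (realize s)) (expand t)) x"
    by (simp add: lin_ext_fun_diff lin_ext_lin_ext)
  also have "\<dots> \<in> bar_rels quotient n d"
    using assms basis_vec_minus_realize_expand
    by (intro lin_ext_in_subspace subspace_bar_rels) (fastforce simp: bar_gens_eq)
  finally show ?thesis .
qed

lemma expand_bar_diff_chain:
  assumes "x \<in> bar_gens (quotient :: ('a::field, _) ns_operad) n d"
  shows "lin_ext expand (lin_ext (bar_diff quotient) x) = lin_ext wdiff (lin_ext expand x)"
  unfolding lin_ext_lin_ext using assms
  by (intro lin_ext_cong expand_bar_diff) (auto simp: bar_gens_eq)

text \<open>The expansion is compatible with the differentials and kills the relations, so a cycle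
  up to relations becomes a cycle. A primitive found there is lifted by \<open>realize\<close>; the
  difference \<open>x - ?D y\<close> expands to zero and is therefore a relation.\<close>

theorem koszul_quotient: "koszul (quotient :: ('a::field, _) ns_operad)"
  unfolding koszul_def
proof (intro conjI connected_operad_quotient allI impI ballI)
  fix n d and x :: "('x tree \<Rightarrow>\<^sub>0 'a) set dtree \<Rightarrow>\<^sub>0 'a"
  let ?P = "quotient :: ('a, _) ns_operad"
  let ?D = "lin_ext (bar_diff ?P) :: _ \<Rightarrow> _ \<Rightarrow>\<^sub>0 'a"
  assume dn: "d + 1 \<noteq> n" and x: "x \<in> bar_gens ?P n d" and cycle: "?D x \<in> bar_rels ?P n (d - 1)"
  have "lin_ext wdiff (lin_ext expand x) = 0"
    using expand_bar_diff_chain[OF x] lin_ext_expand_bar_rels[OF cycle] by simp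
  moreover have "lin_ext expand x \<in> chains n d"
    using x keys_expand(1) by (intro lin_ext_in_subspace subspace_chains) (auto simp: bar_gens_eq chains_def)
  ultimately obtain z where z: "z \<in> chains n (d + 1)" "lin_ext expand x = lin_ext wdiff z"
    using chains_exact dn by blast
  define y where "y = lin_ext (\<lambda>s. basis_vec (realize s :: ('x tree \<Rightarrow>\<^sub>0 'a) set dtree)) z"
  have y: "y \<in> bar_gens ?P n (d + 1)"
    unfolding bar_gens_eq y_def
    using z(1) by (intro lin_ext_in_subspace subspace_keys_subset) (auto simp: chains_def bar_realize)
  have "lin_ext expand y = lin_ext basis_vec z"
    unfolding y_def lin_ext_lin_ext using z(1)
    by (intro lin_ext_cong) (auto simp: chains_def expand_realize)
  then have expand_eq: "lin_ext expand (?D y) = lin_ext expand x"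
    using z(2) by (simp add: expand_bar_diff_chain[OF y])
  have Dy: "?D y \<in> bar_gens ?P n d"
    unfolding bar_gens_eq
    using y keys_bar_diff by (intro lin_ext_in_subspace subspace_keys_subset) (fastforce simp: bar_gens_eq)
  have "(x - lin_ext (\<lambda>s. basis_vec (realize s)) (lin_ext expand x)) -
      (?D y - lin_ext (\<lambda>s. basis_vec (realize s)) (lin_ext expand (?D y))) \<in> bar_rels ?P n d"
    by (intro free_vs.subspace_diff[OF subspace_bar_rels] minus_realize_expand x Dy)
  then have "x - ?D y \<in> bar_rels ?P n d"
    by (simp add: expand_eq)
  with y show "\<exists>y\<in>bar_gens ?P n (d + 1). x - ?D y \<in> bar_rels ?P n d" by blast
qed

end


section \<open>One description of both circulation rules, and its behaviour under grafting\<close>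

section \<open>Circulation of cars\<close>

text \<open>
  Both circulation rules read one letter per car. If \<open>f\<close> tells which way the cars leave a node (or at
  which leaf they leave a tree), then the car with index \<open>j\<close> has the index \<open>car_rank \<rho> f j\<close> in the
  subtree it enters: cars keep their index in the parallel rule, and are renumbered consecutively in the
  series rule.
\<close>

fun car_rank :: "circulation \<Rightarrow> (nat \<Rightarrow> 'b) \<Rightarrow> nat \<Rightarrow> nat" where
  "car_rank Parallel f j = j"
| "car_rank Series f j = card {i. i < j \<and> f i = f j}"

fun car_leaf :: "circulation \<Rightarrow> letter list tree \<Rightarrow> nat \<Rightarrow> nat" where
  "car_leaf \<rho> Leaf j = 1"
| "car_leaf \<rho> (Node l w r) j =
     (case w ! j of
        Prec \<Rightarrow> car_leaf \<rho> l (car_rank \<rho> ((!) w) j)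
      | Succ \<Rightarrow> size1 l + car_leaf \<rho> r (car_rank \<rho> ((!) w) j))"

fun cars_tidy :: "circulation \<Rightarrow> nat \<Rightarrow> nat set \<Rightarrow> letter list tree \<Rightarrow> bool" where
  "cars_tidy \<rho> k C Leaf \<longleftrightarrow> True"
| "cars_tidy \<rho> k C (Node l w r) \<longleftrightarrow>
     (\<forall>j<k. j \<notin> C \<longrightarrow> w ! j = Prec) \<and>
     cars_tidy \<rho> k (car_rank \<rho> ((!) w) ` {j \<in> C. w ! j = Prec}) l \<and>
     cars_tidy \<rho> k (car_rank \<rho> ((!) w) ` {j \<in> C. w ! j = Succ}) r"

text \<open>In series the cars entering a subtree are renumbered, so their indices form an initial
  segment; in parallel any set of cars may enter.\<close>

fun car_set :: "circulation \<Rightarrow> nat \<Rightarrow> nat set \<Rightarrow> bool" where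
  "car_set Parallel k C \<longleftrightarrow> C \<subseteq> {..<k}"
| "car_set Series k C \<longleftrightarrow> (\<exists>c\<le>k. C = {..<c})"

lemma car_set_subset: "car_set \<rho> k C \<Longrightarrow> C \<subseteq> {..<k}"
  by (cases \<rho>) auto

lemma car_set_all [simp]: "car_set \<rho> k {..<k}"
  by (cases \<rho>) auto

lemma car_rank_le: "car_rank \<rho> f j \<le> j"
proof (cases \<rho>)
  case Series
  have "card {i. i < j \<and> f i = f j} \<le> card {..<j}" by (intro card_mono) auto
  then show ?thesis using Series by simp
qed simp

lemma car_rank_less:
  assumes "i < j" "f i = f j"
  shows "car_rank \<rho> f i < car_rank \<rho> f j"
proof (cases \<rho>)
  case Series
  have "{a. a < i \<and> f a = f i} \<subset> {a. a < j \<and> f a = f j}" using assms by auto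
  then show ?thesis using Series by (simp add: psubset_card_mono)
qed (use assms in simp)

lemma car_rank_inj:
  assumes "car_rank \<rho> f i = car_rank \<rho> f j" "f i = f j"
  shows "i = j"
  using car_rank_less[of i j f \<rho>] car_rank_less[of j i f \<rho>] assms by (metis linorder_neqE_nat nat_neq_iff)

lemma car_rank_Series_image:
  "car_rank Series f ` {j. j < c \<and> f j = x} = {..<card {j. j < c \<and> f j = x}}"
proof (rule card_subset_eq)
  let ?S = "{j. j < c \<and> f j = x}"
  show "car_rank Series f ` ?S \<subseteq> {..<card ?S}"
    by (auto intro!: psubset_card_mono)
  have "inj_on (car_rank Series f) ?S"
    by (intro inj_onI) (auto intro: car_rank_inj[of Series f])
  then show "card (car_rank Series f ` ?S) = card {..<card ?S}"
    by (simp only: card_image card_lessThan)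
qed simp

lemma car_set_image:
  assumes "car_set \<rho> k C"
  shows "car_set \<rho> k (car_rank \<rho> f ` {j \<in> C. f j = x})"
proof (cases \<rho>)
  case Parallel
  then show ?thesis using assms by auto
next
  case Series
  then obtain c where c: "c \<le> k" "C = {..<c}" using assms by auto
  then have "car_rank \<rho> f ` {j \<in> C. f j = x} = {..<card {j. j < c \<and> f j = x}}"
    using Series car_rank_Series_image[of f c x] by simp
  moreover have "card {j. j < c \<and> f j = x} \<le> card {..<c}" by (intro card_mono) auto
  ultimately show ?thesis using Series c by auto
qed

lemma car_rank_cong:
  assumes "car_set \<rho> k C" "j \<in> C" "\<And>i. i \<in> C \<Longrightarrow> f i = g i"
  shows "car_rank \<rho> f j = car_rank \<rho> g j"
proof (cases \<rho>)
  case Series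
  then obtain c where "C = {..<c}" using assms by auto
  then have "{i. i < j \<and> f i = f j} = {i. i < j \<and> g i = g j}" using assms(2,3) by auto
  then show ?thesis using Series by simp
qed simp

text \<open>Renumbering by \<open>f\<close> and then by \<open>g\<close> amounts to one renumbering
  by \<open>h\<close> if \<open>h\<close> separates cars exactly as \<open>f\<close> and
  \<open>g\<close> do together. In series the first rank is a bijection between the sets counted on
  the two sides.\<close>

lemma car_rank_car_rank:
  assumes "\<And>i. i \<le> j \<Longrightarrow> h i = h j \<longleftrightarrow> f i = f j \<and> g (car_rank \<rho> f i) = g (car_rank \<rho> f j)"
  shows "car_rank \<rho> h j = car_rank \<rho> g (car_rank \<rho> f j)"
proof (cases \<rho>)
  case Series
  let ?r = "car_rank Series f"
  let ?S = "{i. i < j \<and> h i = h j}" and ?T = "{a. a < ?r j \<and> g a = g (?r j)}"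
  have h_iff: "h i = h j \<longleftrightarrow> f i = f j \<and> g (?r i) = g (?r j)" if "i < j" for i
    using assms[of i] that unfolding Series by (meson less_imp_le)
  then have S: "i < j \<and> f i = f j \<and> g (?r i) = g (?r j)" if "i \<in> ?S" for i
    using that by blast
  have inj: "inj_on ?r ?S"
  proof (rule inj_onI)
    fix x y assume "x \<in> ?S" "y \<in> ?S" "?r x = ?r y"
    moreover from this have "f x = f y" using S by metis
    ultimately show "x = y" by (blast intro: car_rank_inj[of Series f])
  qed
  have "?r ` ?S = ?T"
  proof
    show "?r ` ?S \<subseteq> ?T"
    proof (rule image_subsetI)
      fix i assume "i \<in> ?S"
      from S[OF this] show "?r i \<in> ?T" using car_rank_less[of i j f Series] by blast
    qed
    show "?T \<subseteq> ?r ` ?S"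
    proof
      fix a assume a: "a \<in> ?T"
      then have "a \<in> ?r ` {i. i < j \<and> f i = f j}"
        unfolding car_rank_Series_image by simp
      then obtain i where i: "i < j" "f i = f j" "a = ?r i" by blast
      then have "i \<in> ?S" using h_iff[of i] a by blast
      with i(3) show "a \<in> ?r ` ?S" by (rule image_eqI)
    qed
  qed
  then have "card ?S = card ?T" using card_image[OF inj] by simp
  then show ?thesis using Series by simp
qed simp

lemma car_leaf_bounds: "1 \<le> car_leaf \<rho> t j \<and> car_leaf \<rho> t j \<le> size1 t"
proof (induction t arbitrary: j)
  case (Node l w r)
  from Node.IH(1)[of "car_rank \<rho> ((!) w) j"] Node.IH(2)[of "car_rank \<rho> ((!) w) j"]
  show ?case by (auto split: letter.splits)
qed simp

text \<open>Leaves of \<open>l\<close> have numbers up to \<open>size1 l\<close> and those of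
  \<open>r\<close> larger ones. So two cars share a leaf iff they turn alike at the root and then
  share a leaf of the subtree.\<close>

lemma car_rank_car_leaf_Node:
  shows "w ! j = Prec \<Longrightarrow> car_rank \<rho> (car_leaf \<rho> (Node l w r)) j =
      car_rank \<rho> (car_leaf \<rho> l) (car_rank \<rho> ((!) w) j)"
    and "w ! j = Succ \<Longrightarrow> car_rank \<rho> (car_leaf \<rho> (Node l w r)) j =
      car_rank \<rho> (car_leaf \<rho> r) (car_rank \<rho> ((!) w) j)"
proof -
  have le: "car_leaf \<rho> l a \<le> size1 l" "1 \<le> car_leaf \<rho> r b" for a b
    using car_leaf_bounds by auto
  have ne: "car_leaf \<rho> l a \<noteq> size1 l + car_leaf \<rho> r b" "size1 l + car_leaf \<rho> r b \<noteq> car_leaf \<rho> l a" for a b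
    using le(1)[of a] le(2)[of b] by linarith+
  show "car_rank \<rho> (car_leaf \<rho> (Node l w r)) j = car_rank \<rho> (car_leaf \<rho> l) (car_rank \<rho> ((!) w) j)" if "w ! j = Prec"
    by (rule car_rank_car_rank) (use that ne in \<open>auto split: letter.splits\<close>)
  show "car_rank \<rho> (car_leaf \<rho> (Node l w r)) j = car_rank \<rho> (car_leaf \<rho> r) (car_rank \<rho> ((!) w) j)" if "w ! j = Succ"
    by (rule car_rank_car_rank) (use that ne in \<open>auto split: letter.splits\<close>)
qed

lemma car_rank_const: "car_rank \<rho> (\<lambda>i. c) j = j"
  by (cases \<rho>) auto

lemma car_leaf_Leaf: "car_leaf \<rho> Leaf = (\<lambda>j. 1)"
  by auto

text \<open>The cars arriving at leaf \<open>i\<close> enter \<open>t\<close> with new indices,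
  which the destinations in \<open>s\<close> determine. Hence the destinations in a composite depend
  only on the arities and destinations of the factors.\<close>

lemma car_leaf_graft:
  assumes "1 \<le> i" "i \<le> size1 s"
  shows "car_leaf \<rho> (graft s i t) j =
    (if car_leaf \<rho> s j < i then car_leaf \<rho> s j
     else if car_leaf \<rho> s j = i then i - 1 + car_leaf \<rho> t (car_rank \<rho> (car_leaf \<rho> s) j)
     else car_leaf \<rho> s j + size1 t - 1)"
  using assms
proof (induction s arbitrary: i j)
  case Leaf
  then show ?case by (simp add: car_leaf_Leaf car_rank_const)
next
  case (Node l w r)
  let ?j = "car_rank \<rho> ((!) w) j"
  have le: "car_leaf \<rho> l a \<le> size1 l" "1 \<le> car_leaf \<rho> r a" "1 \<le> size1 t" for a
    using car_leaf_bounds by (auto simp: size1_size)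
  show ?case
  proof (cases "i \<le> size1 l")
    case True
    show ?thesis
    proof (cases "w ! j")
      case Prec
      then show ?thesis
        using True Node.prems Node.IH(1)[of i ?j] by (simp add: car_rank_car_leaf_Node del: car_rank.simps)
    next
      case Succ
      then show ?thesis
        using True le(2)[of ?j] le(3) by (auto simp: size1_graft)
    qed
  next
    case False
    show ?thesis
    proof (cases "w ! j")
      case Prec
      then show ?thesis using False le(1)[of ?j] by auto
    next
      case Succ
      then show ?thesis
        using False Node.prems Node.IH(2)[of "i - size1 l" ?j] le(3)
        by (auto simp: car_rank_car_leaf_Node simp del: car_rank.simps)
    qed
  qed
qed

text \<open>The letters of \<open>s\<close> are read as before, and \<open>t\<close> is entered just
  by the cars that \<open>s\<close> leads to leaf \<open>i\<close>.\<close>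

lemma cars_tidy_graft:
  assumes "1 \<le> i" "i \<le> size1 s"
  shows "cars_tidy \<rho> k C (graft s i t) \<longleftrightarrow> cars_tidy \<rho> k C s \<and>
    cars_tidy \<rho> k (car_rank \<rho> (car_leaf \<rho> s) ` {j \<in> C. car_leaf \<rho> s j = i}) t"
  using assms
proof (induction s arbitrary: i C)
  case Leaf
  then show ?case by (simp add: car_leaf_Leaf car_rank_const)
next
  case (Node l w r)
  let ?r = "car_rank \<rho> ((!) w)" and ?s = "Node l w r"
  have le: "car_leaf \<rho> l a \<le> size1 l" "1 \<le> car_leaf \<rho> r a" for a
    using car_leaf_bounds by auto
  show ?case
  proof (cases "i \<le> size1 l")
    case True
    have leaf_iff: "car_leaf \<rho> ?s j = i \<longleftrightarrow> w ! j = Prec \<and> car_leaf \<rho> l (?r j) = i" for j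
      using True le(2)[of "?r j"] by (auto split: letter.splits)
    have "car_rank \<rho> (car_leaf \<rho> ?s) ` {j \<in> C. car_leaf \<rho> ?s j = i} =
        (\<lambda>j. car_rank \<rho> (car_leaf \<rho> l) (?r j)) ` {j \<in> C. car_leaf \<rho> ?s j = i}"
      by (intro image_cong refl) (auto simp only: leaf_iff mem_Collect_eq car_rank_car_leaf_Node(1))
    also have "\<dots> = car_rank \<rho> (car_leaf \<rho> l) ` {j \<in> ?r ` {j \<in> C. w ! j = Prec}. car_leaf \<rho> l j = i}"
      unfolding leaf_iff by (auto simp del: car_rank.simps)
    finally show ?thesis
      using True Node.prems Node.IH(1)[of i] by (auto simp del: car_rank.simps car_leaf.simps)
  next
    case False
    have leaf_iff: "car_leaf \<rho> ?s j = i \<longleftrightarrow> w ! j = Succ \<and> car_leaf \<rho> r (?r j) = i - size1 l" for j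
      using False le(1)[of "?r j"] by (auto split: letter.splits)
    have "car_rank \<rho> (car_leaf \<rho> ?s) ` {j \<in> C. car_leaf \<rho> ?s j = i} =
        (\<lambda>j. car_rank \<rho> (car_leaf \<rho> r) (?r j)) ` {j \<in> C. car_leaf \<rho> ?s j = i}"
      by (intro image_cong refl) (auto simp only: leaf_iff mem_Collect_eq car_rank_car_leaf_Node(2))
    also have "\<dots> = car_rank \<rho> (car_leaf \<rho> r) ` {j \<in> ?r ` {j \<in> C. w ! j = Succ}. car_leaf \<rho> r j = i - size1 l}"
      unfolding leaf_iff by (auto simp del: car_rank.simps)
    finally show ?thesis
      using False Node.prems Node.IH(2)[of "i - size1 l"] by (auto simp del: car_rank.simps car_leaf.simps)
  qed
qed

lemma cars_tidy_mono: "C \<subseteq> C' \<Longrightarrow> cars_tidy \<rho> k C t \<Longrightarrow> cars_tidy \<rho> k C' t"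
proof (induction t arbitrary: C C')
  case (Node l w r)
  let ?S = "\<lambda>C x. car_rank \<rho> ((!) w) ` {j \<in> C. w ! j = x}"
  have "?S C x \<subseteq> ?S C' x" for x using Node.prems(1) by blast
  then have "cars_tidy \<rho> k (?S C' Prec) l" "cars_tidy \<rho> k (?S C' Succ) r"
    using Node.prems(2) by (auto intro: Node.IH simp del: car_rank.simps)
  then show ?case using Node.prems by auto
qed simp

text \<open>A car that reads only the letter \<^const>\<open>Prec\<close> is one that ends at the first leaf.\<close>

lemma cars_tidy_iff_leaf:
  assumes "cars_tidy \<rho> k C' t" "C \<subseteq> C'" "C' \<subseteq> {..<k}"
  shows "cars_tidy \<rho> k C t \<longleftrightarrow> (\<forall>j\<in>C' - C. car_leaf \<rho> t j = 1)"
  using assms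
proof (induction t arbitrary: C C')
  case (Node l w r)
  let ?r = "car_rank \<rho> ((!) w)"
  let ?S = "\<lambda>C x. ?r ` {j \<in> C. w ! j = x}"
  have sub: "?S C' x \<subseteq> {..<k}" for x
  proof (rule image_subsetI)
    fix j assume "j \<in> {j \<in> C'. w ! j = x}"
    then have "j < k" using Node.prems(3) by auto
    with car_rank_le[of \<rho> "(!) w" j] have "?r j < k" by (rule le_less_trans)
    then show "?r j \<in> {..<k}" by (rule lessThan_iff[THEN iffD2])
  qed
  have l: "cars_tidy \<rho> k (?S C Prec) l \<longleftrightarrow> (\<forall>j\<in>?S C' Prec - ?S C Prec. car_leaf \<rho> l j = 1)"
    using Node.prems sub by (intro Node.IH) auto
  have diff: "?S C' Prec - ?S C Prec = ?r ` {j \<in> C' - C. w ! j = Prec}"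
  proof -
    have "inj_on ?r {j \<in> C'. w ! j = Prec}"
      by (rule inj_onI) (rule car_rank_inj[of \<rho> "(!) w"], simp_all del: car_rank.simps)
    then have "?r ` ({j \<in> C'. w ! j = Prec} - {j \<in> C. w ! j = Prec}) = ?S C' Prec - ?S C Prec"
      using Node.prems(2) by (intro inj_on_image_set_diff) auto
    moreover have "{j \<in> C'. w ! j = Prec} - {j \<in> C. w ! j = Prec} = {j \<in> C' - C. w ! j = Prec}" by auto
    ultimately show ?thesis by simp
  qed
  have ne: "size1 l + car_leaf \<rho> r j \<noteq> 1" for j
    using car_leaf_bounds[of \<rho> r j] by (simp add: size1_size)
  show ?case
  proof
    assume "cars_tidy \<rho> k C (Node l w r)"
    then have "\<forall>j<k. j \<notin> C \<longrightarrow> w ! j = Prec" "\<forall>j\<in>?S C' Prec - ?S C Prec. car_leaf \<rho> l j = 1"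
      using l by (simp_all del: car_rank.simps)
    then show "\<forall>j\<in>C' - C. car_leaf \<rho> (Node l w r) j = 1"
      using Node.prems(3) unfolding diff by (auto simp del: car_rank.simps)
  next
    assume leaf: "\<forall>j\<in>C' - C. car_leaf \<rho> (Node l w r) j = 1"
    have prec: "w ! j = Prec \<and> car_leaf \<rho> l (?r j) = 1" if "j \<in> C' - C" for j
      using bspec[OF leaf that] ne by (cases "w ! j") (simp_all del: car_rank.simps)
    \<comment> \<open>The removed cars all turn left, so the same cars as before enter the right
      subtree.\<close>
    have "{j \<in> C. w ! j = Succ} = {j \<in> C'. w ! j = Succ}"
      using prec Node.prems(2) by fastforce
    moreover have "cars_tidy \<rho> k (?S C Prec) l"
      unfolding l diff using prec by auto
    ultimately show "cars_tidy \<rho> k C (Node l w r)"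
      using Node.prems(1) prec by (auto simp del: car_rank.simps)
  qed
qed simp


section \<open>Existence, uniqueness and minimality of the tidy right comb with given
  destinations\<close>

section \<open>Right signaletic combs\<close>

lemma car_leaf_comb_Cons:
  "car_leaf \<rho> (comb (w # ws)) j =
     (case w ! j of Prec \<Rightarrow> 1 | Succ \<Rightarrow> 1 + car_leaf \<rho> (comb ws) (car_rank \<rho> ((!) w) j))"
  by (simp split: letter.splits)

text \<open>At the first node a car turns right iff its target is not leaf 1, and the letters that
  no car reads are \<open>Prec\<close>. The rest of the comb serves the cars that turned
  right.\<close>

lemma exists_tidy_comb:
  assumes "car_set \<rho> k C" "\<And>j. j \<in> C \<Longrightarrow> 1 \<le> f j \<and> f j \<le> n + 1"
  shows "\<exists>ws. set ws \<subseteq> signals k \<and> length ws = n \<and> cars_tidy \<rho> k C (comb ws) \<and>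
    (\<forall>j\<in>C. car_leaf \<rho> (comb ws) j = f j)"
  using assms
proof (induction n arbitrary: C f)
  case 0
  then show ?case by (intro exI[of _ "[]"]) force
next
  case (Suc n)
  define w where "w = map (\<lambda>j. if j \<in> C \<and> f j \<noteq> 1 then Succ else Prec) [0..<k]"
  have w: "w ! j = (if j \<in> C \<and> f j \<noteq> 1 then Succ else Prec)" if "j < k" for j
    using that by (simp add: w_def)
  have C: "C \<subseteq> {..<k}" using Suc.prems(1) by (rule car_set_subset)
  let ?r = "car_rank \<rho> ((!) w)"
  let ?S = "{j \<in> C. w ! j = Succ}"
  have inj: "inj_on ?r ?S"
    by (rule inj_onI) (rule car_rank_inj[of \<rho> "(!) w"], simp_all del: car_rank.simps)
  \<comment> \<open>The targets in terms of the new indices; 1 is subtracted for the leaf to the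
    left of the first node.\<close>
  define g where "g a = f (the_inv_into ?S ?r a) - 1" for a
  have g: "g (?r j) = f j - 1" if "j \<in> ?S" for j
    using that by (simp add: g_def the_inv_into_f_f[OF inj] del: car_rank.simps)
  have "1 \<le> g a \<and> g a \<le> n + 1" if a: "a \<in> ?r ` ?S" for a
  proof -
    obtain j where j: "j \<in> ?S" "a = ?r j" using a by (rule imageE)
    then have "f j \<noteq> 1" using w[of j] C by (auto split: if_splits)
    then show ?thesis using j g[OF j(1)] Suc.prems(2)[of j] by auto
  qed
  with Suc.IH[OF car_set_image[OF Suc.prems(1)], of "(!) w" Succ g] obtain ws where
    ws: "set ws \<subseteq> signals k" "length ws = n" "cars_tidy \<rho> k (?r ` ?S) (comb ws)"
      "\<forall>j\<in>?r ` ?S. car_leaf \<rho> (comb ws) j = g j" by blast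
  have "car_leaf \<rho> (comb (w # ws)) j = f j" if "j \<in> C" for j
  proof (cases "w ! j")
    case Prec
    then have "f j = 1" using w[of j] C that by (auto split: if_splits)
    then show ?thesis using Prec by simp
  next
    case Succ
    then have "car_leaf \<rho> (comb ws) (?r j) = f j - 1" using ws(4) g[of j] that by auto
    then show ?thesis using Succ Suc.prems(2)[OF that] by (simp del: car_rank.simps)
  qed
  moreover have "w \<in> signals k" by (simp add: w_def signals_def)
  ultimately show ?case using ws w by (intro exI[of _ "w # ws"]) auto
qed

definition succ_count :: "letter list \<Rightarrow> nat" where
  "succ_count w = card {j. j < length w \<and> w ! j = Succ}"

lemma tidy_comb_minimal:
  assumes "car_set \<rho> k C" "set ws \<subseteq> signals k" "set vs \<subseteq> signals k" "length vs = length ws"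
    "cars_tidy \<rho> k C (comb vs)" "\<And>j. j \<in> C \<Longrightarrow> car_leaf \<rho> (comb vs) j = car_leaf \<rho> (comb ws) j"
  shows "vs = ws \<or> sum_list (map succ_count vs) < sum_list (map succ_count ws)"
  using assms
proof (induction ws arbitrary: vs C)
  case (Cons w ws)
  then obtain v vs' where vs: "vs = v # vs'" by (cases vs) auto
  have C: "C \<subseteq> {..<k}" using Cons.prems(1) by (rule car_set_subset)
  have len: "length v = k" "length w = k" using Cons.prems(2,3) vs by (auto simp: signals_def)
  have pos: "car_leaf \<rho> t j \<noteq> 0" for t j using car_leaf_bounds[of \<rho> t j] by auto
  have eq: "v ! j = w ! j" if "j \<in> C" for j
    using Cons.prems(6)[OF that] unfolding vs car_leaf_comb_Cons by (auto simp: pos split: letter.splits)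
  have prec: "v ! j = Prec" if "j < k" "j \<notin> C" for j
    using Cons.prems(5) vs that by simp
  have heads: "v = w \<or> succ_count v < succ_count w"
  proof (cases "\<exists>j<k. v ! j \<noteq> w ! j")
    case True
    then obtain j where j: "j < k" "v ! j \<noteq> w ! j" by blast
    then have "v ! j = Prec" "w ! j = Succ" using eq prec by (metis letter.exhaust)+
    then have "j \<in> {j. j < length w \<and> w ! j = Succ}" "j \<notin> {j. j < length v \<and> v ! j = Succ}"
      using len j by auto
    moreover have "w ! i = Succ" if "i < k" "v ! i = Succ" for i
      using eq[of i] prec[OF that(1)] that(2) by (cases "i \<in> C") auto
    then have "{j. j < length v \<and> v ! j = Succ} \<subseteq> {j. j < length w \<and> w ! j = Succ}"
      using len by auto
    ultimately have "{j. j < length v \<and> v ! j = Succ} \<subset> {j. j < length w \<and> w ! j = Succ}"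
      by blast
    then show ?thesis by (simp add: succ_count_def psubset_card_mono)
  next
    case False
    then show ?thesis using len by (auto intro: nth_equalityI)
  qed
  let ?r = "car_rank \<rho> ((!) v)" and ?S = "{j \<in> C. v ! j = Succ}"
  have "vs' = ws \<or> sum_list (map succ_count vs') < sum_list (map succ_count ws)"
  proof (rule Cons.IH)
    show "car_set \<rho> k (?r ` ?S)" by (rule car_set_image[OF Cons.prems(1)])
    show "cars_tidy \<rho> k (?r ` ?S) (comb vs')" using Cons.prems(5) vs by simp
    fix a assume "a \<in> ?r ` ?S"
    then obtain j where j: "j \<in> C" "v ! j = Succ" "a = ?r j" by blast
    have "?r j = car_rank \<rho> ((!) w) j"
      by (rule car_rank_cong[OF Cons.prems(1) j(1)]) (rule eq)
    then show "car_leaf \<rho> (comb vs') a = car_leaf \<rho> (comb ws) a"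
      using Cons.prems(6)[OF j(1)] j eq[OF j(1)] unfolding vs car_leaf_comb_Cons by simp
  qed (use Cons.prems vs in auto)
  then show ?case using heads vs by auto
qed simp

lemma tidy_comb_unique:
  assumes "car_set \<rho> k C" "set ws \<subseteq> signals k" "set vs \<subseteq> signals k" "length vs = length ws"
    "cars_tidy \<rho> k C (comb vs)" "cars_tidy \<rho> k C (comb ws)"
    "\<And>j. j \<in> C \<Longrightarrow> car_leaf \<rho> (comb vs) j = car_leaf \<rho> (comb ws) j"
  shows "vs = ws"
  using tidy_comb_minimal[OF assms(1,2,3,4,5,7)]
    tidy_comb_minimal[OF assms(1,3,2) assms(4)[symmetric] assms(6) assms(7)[symmetric]] by auto

text \<open>Tidiness at \<open>v\<close> forces \<open>Prec\<close> on all letters of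
  \<open>v\<close> that no car reads. So \<open>v\<close> sends the same cars on whether only the
  arriving ones or all \<open>k\<close> cars start there, and the tail can be tested on its
  own.\<close>

lemma cars_tidy_comb_local:
  "cars_tidy \<rho> k {..<k} (comb ws) \<longleftrightarrow> successively (\<lambda>w v. cars_tidy \<rho> k {..<k} (comb [w, v])) ws"
proof (induction ws rule: induct_list012)
  case (3 w v ws)
  let ?S = "car_rank \<rho> ((!) w) ` {j \<in> {..<k}. w ! j = Succ}"
  have sub: "?S \<subseteq> {..<k}" by (rule car_set_subset[OF car_set_image]) simp
  have "cars_tidy \<rho> k {..<k} (comb (w # v # ws)) \<longleftrightarrow> cars_tidy \<rho> k {..<k} (comb [w, v]) \<and>
      cars_tidy \<rho> k {..<k} (comb (v # ws))"
  proof (cases "\<forall>j<k. j \<notin> ?S \<longrightarrow> v ! j = Prec")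
    case True
    then have "{j \<in> ?S. v ! j = Succ} = {j \<in> {..<k}. v ! j = Succ}" using sub by fastforce
    then show ?thesis using True by simp
  next
    case False
    then show ?thesis unfolding comb.simps cars_tidy.simps by blast
  qed
  then show ?case using 3 by simp
qed simp_all


section \<open>The four normal form maps as instances of the locale\<close>

section \<open>Normal forms of signaletic trees\<close>

definition normal_word :: "circulation \<Rightarrow> nat \<Rightarrow> letter list tree \<Rightarrow> letter list list" where
  "normal_word \<rho> k s = (THE ws. set ws \<subseteq> signals k \<and> length ws = size s \<and>
     cars_tidy \<rho> k {..<k} (comb ws) \<and> (\<forall>j<k. car_leaf \<rho> (comb ws) j = car_leaf \<rho> s j))"

lemma normal_word:
  "set (normal_word \<rho> k s) \<subseteq> signals k \<and> length (normal_word \<rho> k s) = size s \<and>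
     cars_tidy \<rho> k {..<k} (comb (normal_word \<rho> k s)) \<and>
     (\<forall>j<k. car_leaf \<rho> (comb (normal_word \<rho> k s)) j = car_leaf \<rho> s j)"
  unfolding normal_word_def
proof (rule theI')
  let ?P = "\<lambda>ws. set ws \<subseteq> signals k \<and> length ws = size s \<and>
     cars_tidy \<rho> k {..<k} (comb ws) \<and> (\<forall>j<k. car_leaf \<rho> (comb ws) j = car_leaf \<rho> s j)"
  have "\<exists>ws. ?P ws"
    using exists_tidy_comb[of \<rho> k "{..<k}" "car_leaf \<rho> s" "size s"] car_leaf_bounds[of \<rho> s]
    by (auto simp: size1_size)
  moreover have "vs = ws" if "?P ws" "?P vs" for ws vs
    by (rule tidy_comb_unique[OF car_set_all]) (use that in auto)
  ultimately show "\<exists>!ws. ?P ws" by blast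
qed

lemma normal_word_eqI:
  assumes "set ws \<subseteq> signals k" "length ws = size s" "cars_tidy \<rho> k {..<k} (comb ws)"
    "\<And>j. j < k \<Longrightarrow> car_leaf \<rho> (comb ws) j = car_leaf \<rho> s j"
  shows "normal_word \<rho> k s = ws"
  by (rule tidy_comb_unique[OF car_set_all]) (use normal_word[of \<rho> k s] assms in auto)

lemma normal_word_cong:
  assumes "size s = size t" "\<And>j. j < k \<Longrightarrow> car_leaf \<rho> s j = car_leaf \<rho> t j"
  shows "normal_word \<rho> k s = normal_word \<rho> k t"
  by (rule normal_word_eqI) (use normal_word[of \<rho> k t] assms in auto)

lemma normal_word_comb:
  "set ws \<subseteq> signals k \<Longrightarrow> normal_word \<rho> k (comb ws) = ws \<longleftrightarrow> cars_tidy \<rho> k {..<k} (comb ws)"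
  using normal_word[of \<rho> k "comb ws"] normal_word_eqI[of ws k "comb ws" \<rho>] by auto

text \<open>In the messy operads no tree vanishes; in the tidy ones exactly the untidy trees
  do.\<close>

definition signaletic_nf :: "flavour \<Rightarrow> circulation \<Rightarrow> nat \<Rightarrow> letter list tree \<Rightarrow> letter list list option" where
  "signaletic_nf \<phi> \<rho> k s =
     (if \<phi> = Tidy \<and> \<not> cars_tidy \<rho> k {..<k} s then None else Some (normal_word \<rho> k s))"

lemma car_leaf_graft_cong:
  assumes "1 \<le> i" "i \<le> size1 s" "size s = size s'" "size t = size t'" "j < k"
    "\<And>j. j < k \<Longrightarrow> car_leaf \<rho> s j = car_leaf \<rho> s' j" "\<And>j. j < k \<Longrightarrow> car_leaf \<rho> t j = car_leaf \<rho> t' j"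
  shows "car_leaf \<rho> (graft s i t) j = car_leaf \<rho> (graft s' i t') j"
proof -
  have "car_rank \<rho> (car_leaf \<rho> s) j = car_rank \<rho> (car_leaf \<rho> s') j"
    by (rule car_rank_cong[OF car_set_all[of \<rho> k]]) (use assms in auto)
  moreover have "car_rank \<rho> (car_leaf \<rho> s') j < k"
    using car_rank_le[of \<rho> "car_leaf \<rho> s'" j] assms(5) by linarith
  ultimately show ?thesis
    using assms by (simp add: car_leaf_graft size1_size del: car_rank.simps)
qed

text \<open>Inside the composite, \<open>t\<close> has to be tidy for the cars arriving at leaf
  \<open>i\<close>, a condition on its letters. As \<open>t\<close> is tidy for all \<open>k\<close>
  cars, \<open>cars_tidy_iff_leaf\<close> turns it into a condition on destinations.\<close>

lemma cars_tidy_graft_cong: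
  assumes "1 \<le> i" "i \<le> size1 s" "size s = size s'" "cars_tidy \<rho> k {..<k} s" "cars_tidy \<rho> k {..<k} s'"
    "cars_tidy \<rho> k {..<k} t" "cars_tidy \<rho> k {..<k} t'"
    "\<And>j. j < k \<Longrightarrow> car_leaf \<rho> s j = car_leaf \<rho> s' j" "\<And>j. j < k \<Longrightarrow> car_leaf \<rho> t j = car_leaf \<rho> t' j"
  shows "cars_tidy \<rho> k {..<k} (graft s i t) \<longleftrightarrow> cars_tidy \<rho> k {..<k} (graft s' i t')"
proof -
  let ?C = "\<lambda>s. car_rank \<rho> (car_leaf \<rho> s) ` {j \<in> {..<k}. car_leaf \<rho> s j = i}"
  have "car_rank \<rho> (car_leaf \<rho> s) j = car_rank \<rho> (car_leaf \<rho> s') j" if "j < k" for j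
    by (rule car_rank_cong[OF car_set_all[of \<rho> k]]) (use assms that in auto)
  then have C: "?C s = ?C s'"
    using assms(8) by (intro image_cong) auto
  have sub: "?C s' \<subseteq> {..<k}" by (rule car_set_subset[OF car_set_image[OF car_set_all]])
  have "cars_tidy \<rho> k (?C s') t \<longleftrightarrow> cars_tidy \<rho> k (?C s') t'"
    using cars_tidy_iff_leaf[OF assms(6) sub] cars_tidy_iff_leaf[OF assms(7) sub] assms(9) by auto
  then show ?thesis
    using assms(1-5) C by (simp add: cars_tidy_graft size1_size)
qed

interpretation signaletic: comb_normal_form "signals k" "signaletic_nf \<phi> \<rho> k" succ_count
  for \<phi> :: flavour and \<rho> :: circulation and k :: nat
proof
  note nw = normal_word[of \<rho> k]
  let ?T = "cars_tidy \<rho> k {..<k}"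
  have tidy_graft_left: "?T s" and tidy_graft_right: "?T t"
    if "?T (graft s i t)" "1 \<le> i" "i \<le> size1 s" for s t i
  proof -
    show "?T s" using that by (simp add: cars_tidy_graft)
    have "cars_tidy \<rho> k (car_rank \<rho> (car_leaf \<rho> s) ` {j \<in> {..<k}. car_leaf \<rho> s j = i}) t"
      using that by (simp only: cars_tidy_graft)
    then show "?T t"
      by (rule cars_tidy_mono[rotated]) (rule car_set_subset[OF car_set_image[OF car_set_all]])
  qed
  have comb_iff: "signaletic_nf \<phi> \<rho> k (comb ws) = Some ws \<longleftrightarrow> ?T (comb ws)" if "set ws \<subseteq> signals k" for ws
    using normal_word_comb[OF that, of \<rho>] by (auto simp: signaletic_nf_def)
  show "set ws \<subseteq> signals k \<and> length ws = size s \<and> signaletic_nf \<phi> \<rho> k (comb ws) = Some ws"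
    if "signaletic_nf \<phi> \<rho> k s = Some ws" for s ws
    using that nw[of s] comb_iff[of ws] by (auto simp: signaletic_nf_def split: if_splits)
  show "signaletic_nf \<phi> \<rho> k (comb ws) = Some ws \<longleftrightarrow>
      successively (\<lambda>v w. signaletic_nf \<phi> \<rho> k (comb [v, w]) = Some [v, w]) ws" if "set ws \<subseteq> signals k" for ws
  proof -
    have "signaletic_nf \<phi> \<rho> k (comb [v, w]) = Some [v, w] \<longleftrightarrow> ?T (comb [v, w])"
      if "v \<in> set ws" "w \<in> set ws" for v w
      using that \<open>set ws \<subseteq> signals k\<close> by (intro comb_iff) auto
    then have "successively (\<lambda>v w. signaletic_nf \<phi> \<rho> k (comb [v, w]) = Some [v, w]) ws \<longleftrightarrow>
        successively (\<lambda>v w. ?T (comb [v, w])) ws"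
      by (intro successively_cong refl)
    then show ?thesis using comb_iff[OF that] cars_tidy_comb_local[of \<rho> k ws] by simp
  qed
  show "signaletic_nf \<phi> \<rho> k (graft s i t) =
      Option.bind (signaletic_nf \<phi> \<rho> k s) (\<lambda>ws. signaletic_nf \<phi> \<rho> k (graft (comb ws) i t))"
    if i: "1 \<le> i" "i \<le> size1 s" for s t i
  proof (cases "\<phi> = Tidy \<and> \<not> ?T s")
    case True
    then have "\<not> ?T (graft s i t)" using tidy_graft_left i by blast
    then show ?thesis using True by (simp add: signaletic_nf_def)
  next
    case False
    let ?s = "comb (normal_word \<rho> k s)"
    have s: "size s = size ?s" "?T ?s" "\<And>j. j < k \<Longrightarrow> car_leaf \<rho> s j = car_leaf \<rho> ?s j" using nw[of s] by auto
    have "normal_word \<rho> k (graft s i t) = normal_word \<rho> k (graft ?s i t)"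
      by (intro normal_word_cong car_leaf_graft_cong i s) (use s(1) in simp_all)
    moreover have "?T (graft s i t) \<longleftrightarrow> ?T (graft ?s i t)" if "\<phi> = Tidy"
    proof (cases "?T t")
      case True
      then show ?thesis using False that by (intro cars_tidy_graft_cong i s) auto
    next
      case False
      then show ?thesis using tidy_graft_right[of s i t] tidy_graft_right[of ?s i t] i s(1) by (auto simp: size1_size)
    qed
    ultimately show ?thesis using False by (auto simp: signaletic_nf_def)
  qed
  show "signaletic_nf \<phi> \<rho> k (graft s i t) =
      Option.bind (signaletic_nf \<phi> \<rho> k t) (\<lambda>ws. signaletic_nf \<phi> \<rho> k (graft s i (comb ws)))"
    if i: "1 \<le> i" "i \<le> size1 s" for s t i
  proof (cases "\<phi> = Tidy \<and> \<not> ?T t")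
    case True
    then have "\<not> ?T (graft s i t)" using tidy_graft_right i by blast
    then show ?thesis using True by (simp add: signaletic_nf_def)
  next
    case False
    let ?t = "comb (normal_word \<rho> k t)"
    have t: "size t = size ?t" "?T ?t" "\<And>j. j < k \<Longrightarrow> car_leaf \<rho> t j = car_leaf \<rho> ?t j" using nw[of t] by auto
    have "normal_word \<rho> k (graft s i t) = normal_word \<rho> k (graft s i ?t)"
      by (intro normal_word_cong car_leaf_graft_cong i t) (use t(1) in simp_all)
    moreover have "?T (graft s i t) \<longleftrightarrow> ?T (graft s i ?t)" if "\<phi> = Tidy"
    proof (cases "?T s")
      case True
      then show ?thesis using False that by (intro cars_tidy_graft_cong i t) auto
    next
      case False
      then show ?thesis using tidy_graft_left[of s i t] tidy_graft_left[of s i ?t] i by blast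
    qed
    ultimately show ?thesis using False by (auto simp: signaletic_nf_def)
  qed
  show "vs = ws \<or> sum_list (map succ_count vs) < sum_list (map succ_count ws)"
    if "set ws \<subseteq> signals k" "signaletic_nf \<phi> \<rho> k (comb ws) = Some vs" for ws vs
  proof (rule tidy_comb_minimal[OF car_set_all])
    have "vs = normal_word \<rho> k (comb ws)" using that(2) by (simp add: signaletic_nf_def split: if_splits)
    then show "set vs \<subseteq> signals k" "length vs = length ws" "?T (comb vs)"
      "\<And>j. j \<in> {..<k} \<Longrightarrow> car_leaf \<rho> (comb vs) j = car_leaf \<rho> (comb ws) j"
      using nw[of "comb ws"] by auto
  qed (rule that(1))
qed


section \<open>The definitions by driving cars agree with the uniform description\<close>

section \<open>Destination vectors\<close>

lemma parallel_leaf_eq: "parallel_leaf j t = car_leaf Parallel t j"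
  by (induction t) (auto split: letter.splits)

lemma parallel_tidy_iff:
  "set_tree t \<subseteq> signals k \<Longrightarrow> parallel_tidy C t \<longleftrightarrow> cars_tidy Parallel k C t"
  by (induction t arbitrary: C) (auto simp: signals_def)

text \<open>The definition splits off the first car. Splitting off the last one suits an induction
  on the number of cars that have passed.\<close>

lemma drive_all_Suc:
  "drive_all (Suc c) t =
     (fst (drive_all c t) @ [fst (drive (snd (drive_all c t)))], snd (drive (snd (drive_all c t))))"
proof (induction c arbitrary: t)
  case (Suc c)
  let ?X = "drive_all (Suc c) (snd (drive t))" and ?Y = "drive_all c (snd (drive t))"
  have first: "drive_all (Suc n) t = (fst (drive t) # fst (drive_all n (snd (drive t))), snd (drive_all n (snd (drive t))))" for n
    by (simp add: case_prod_unfold Let_def)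
  have "?X = (fst ?Y @ [fst (drive (snd ?Y))], snd (drive (snd ?Y)))"
    by (rule Suc.IH)
  then show ?case
    unfolding first[of "Suc c"] first[of c] by simp
qed (simp add: case_prod_unfold Let_def)

lemma size1_drive: "size1 (snd (drive t)) = size1 t"
  by (induction t rule: drive.induct) (auto simp: case_prod_unfold Let_def split: list.splits letter.splits)

lemma size1_drive_all: "size1 (snd (drive_all c t)) = size1 t"
  by (induction c) (simp_all add: drive_all_Suc size1_drive del: drive_all.simps(2))

lemma drive_all_Leaf: "snd (drive_all c Leaf) = Leaf"
  by (induction c) (simp_all add: drive_all_Suc del: drive_all.simps(2))

text \<open>Each car erases one letter at the root, so the car of index \<open>i\<close> reads the
  letter \<open>i\<close> there. Each subtree is passed by the cars that turned towards it.\<close>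

lemma drive_all_Node:
  "c \<le> length w \<Longrightarrow> snd (drive_all c (Node l w r)) =
     Node (snd (drive_all (card {i. i < c \<and> w ! i = Prec}) l)) (drop c w)
       (snd (drive_all (card {i. i < c \<and> w ! i = Succ}) r))"
proof (induction c)
  case (Suc c)
  have drop: "drop c w = w ! c # drop (Suc c) w"
    using Suc.prems by (simp add: Cons_nth_drop_Suc)
  have card: "card {i. i < Suc c \<and> w ! i = x} = card {i. i < c \<and> w ! i = x} + (if w ! c = x then 1 else 0)" for x
  proof -
    have "{i. i < Suc c \<and> w ! i = x} =
        (if w ! c = x then insert c {i. i < c \<and> w ! i = x} else {i. i < c \<and> w ! i = x})"
      by (auto simp: less_Suc_eq)
    then show ?thesis by simp
  qed
  show ?case
    using Suc unfolding card
    by (cases "w ! c") (simp_all add: drive_all_Suc drop case_prod_unfold Let_def del: drive_all.simps(2))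
qed simp

text \<open>The number of earlier cars with the same turn is \<open>car_rank Series\<close>, so the
  recursion through the trees left by \<open>j\<close> cars is that of
  \<open>car_leaf\<close>.\<close>

lemma drive_after_drive_all:
  assumes "set_tree t \<subseteq> signals k" "j < k"
  shows "fst (drive (snd (drive_all j t))) = car_leaf Series t j"
  using assms
proof (induction t arbitrary: j)
  case Leaf
  then show ?case by (simp add: drive_all_Leaf)
next
  case (Node l w r)
  have len: "length w = k" using Node.prems(1) by (simp add: signals_def)
  have drop: "drop j w = w ! j # drop (Suc j) w"
    using Node.prems(2) len by (simp add: Cons_nth_drop_Suc)
  have "card {i. i < j \<and> w ! i = w ! j} < k"
    using car_rank_le[of Series "(!) w" j] Node.prems(2) by simp
  then show ?case
    using Node len
    by (cases "w ! j") (simp_all add: drive_all_Node drop case_prod_unfold Let_def size1_drive_all)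
qed

lemma drive_all_destinations:
  assumes "set_tree t \<subseteq> signals k" "c \<le> k"
  shows "fst (drive_all c t) = map (car_leaf Series t) [0..<c]"
  using assms(2)
  by (induction c) (simp_all add: drive_all_Suc drive_after_drive_all[OF assms(1)] del: drive_all.simps(2))

lemma drive_all_tidy_iff:
  assumes "set_tree t \<subseteq> signals k" "c \<le> k"
  shows "(\<forall>w\<in>set_tree (snd (drive_all c t)). set w \<subseteq> {Prec}) \<longleftrightarrow> cars_tidy Series k {..<c} t"
  using assms
proof (induction t arbitrary: c)
  case Leaf
  then show ?case by (simp add: drive_all_Leaf)
next
  case (Node l w r)
  have len: "length w = k" using Node.prems(1) by (simp add: signals_def)
  have card: "card {i. i < c \<and> w ! i = x} \<le> k" for x
  proof -
    have "card {i. i < c \<and> w ! i = x} \<le> card {..<c}" by (intro card_mono) auto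
    then show ?thesis using Node.prems(2) by simp
  qed
  have "set (drop c w) \<subseteq> {Prec} \<longleftrightarrow> (\<forall>i<k - c. w ! (c + i) = Prec)"
    using len by (auto simp: set_conv_nth)
  also have "\<dots> \<longleftrightarrow> (\<forall>j<k. j \<notin> {..<c} \<longrightarrow> w ! j = Prec)"
    using Node.prems(2) by (auto simp: not_less dest: le_Suc_ex)
  finally have drop: "set (drop c w) \<subseteq> {Prec} \<longleftrightarrow> (\<forall>j<k. j \<notin> {..<c} \<longrightarrow> w ! j = Prec)" .
  have image: "car_rank Series ((!) w) ` {j \<in> {..<c}. w ! j = x} = {..<card {i. i < c \<and> w ! i = x}}" for x
    using car_rank_Series_image[of "(!) w" c x] by simp
  show ?case
    using Node.IH(1)[OF _ card[of Prec]] Node.IH(2)[OF _ card[of Succ]] Node.prems len drop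
    unfolding cars_tidy.simps image by (auto simp: drive_all_Node)
qed

lemma destination_eq:
  "set_tree t \<subseteq> signals k \<Longrightarrow> destination \<rho> k t = map (car_leaf \<rho> t) [0..<k]"
  by (cases \<rho>) (simp_all add: parallel_leaf_eq drive_all_destinations)

lemma tidy_iff: "set_tree t \<subseteq> signals k \<Longrightarrow> tidy \<rho> k t \<longleftrightarrow> cars_tidy \<rho> k {..<k} t"
  by (cases \<rho>) (simp_all add: parallel_tidy_iff drive_all_tidy_iff atLeast0LessThan)

lemma destination_eq_iff:
  assumes "set_tree s \<subseteq> signals k" "set_tree t \<subseteq> signals k"
  shows "destination \<rho> k s = destination \<rho> k t \<longleftrightarrow> (\<forall>j<k. car_leaf \<rho> s j = car_leaf \<rho> t j)"
  using assms by (auto simp: destination_eq)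

text \<open>A generator of the given span is a difference of trees with equal normal forms or a tree
  with normal form \<open>None\<close>, so it lies in the kernel. Conversely, the kernel is spanned
  by differences of trees and their normal forms. These are generators, since the normal comb is
  tidy with the same destinations and an untidy tree is a generator itself in the tidy case.\<close>

lemma signaletic_relations_eq:
  "signaletic_relations \<phi> \<rho> k n = (signaletic.relations k \<phi> \<rho> n :: (letter list tree \<Rightarrow>\<^sub>0 'a::field) set)"
proof
  let ?I = "signaletic.relations k \<phi> \<rho> n :: (letter list tree \<Rightarrow>\<^sub>0 'a) set"
  have diff: "basis_vec s - basis_vec t \<in> ?I"
    if "s \<in> syntax_trees (signals k) n" "t \<in> syntax_trees (signals k) n"
      "destination \<rho> k s = destination \<rho> k t" "\<phi> = Tidy \<Longrightarrow> tidy \<rho> k s \<and> tidy \<rho> k t" for s t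
  proof -
    have st: "set_tree s \<subseteq> signals k" "set_tree t \<subseteq> signals k" "size1 s = n" "size1 t = n"
      using that(1,2) by (auto simp: in_syntax_trees_iff)
    then have "normal_word \<rho> k s = normal_word \<rho> k t"
      using that(3) by (intro normal_word_cong) (auto simp: destination_eq_iff size1_size)
    then have "signaletic_nf \<phi> \<rho> k s = signaletic_nf \<phi> \<rho> k t"
      using that(4) st by (auto simp: signaletic_nf_def tidy_iff)
    then show ?thesis
      using st by (auto simp: signaletic.relations_def signaletic.normal_vec_def lin_ext_diff
        intro: free_vs.subspace_diff[OF subspace_free_space])
  qed
  have untidy: "basis_vec s \<in> ?I" if "\<phi> = Tidy" "s \<in> syntax_trees (signals k) n" "\<not> tidy \<rho> k s" for s
    using that by (auto simp: signaletic.relations_def signaletic.normal_vec_def signaletic_nf_def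
      in_syntax_trees_iff tidy_iff)
  show "signaletic_relations \<phi> \<rho> k n \<subseteq> ?I"
  proof (cases \<phi>)
    case Messy
    have "{basis_vec s - basis_vec t | s t. s \<in> syntax_trees (signals k) n \<and> t \<in> syntax_trees (signals k) n \<and>
        destination \<rho> k s = destination \<rho> k t} \<subseteq> ?I"
      using diff Messy by auto
    then have "signaletic_relations Messy \<rho> k n \<subseteq> ?I"
      unfolding signaletic_relations.simps by (rule free_vs.span_minimal) (rule signaletic.subspace_relations)
    then show ?thesis using Messy by simp
  next
    case Tidy
    have "{basis_vec s - basis_vec t | s t. s \<in> syntax_trees (signals k) n \<and> t \<in> syntax_trees (signals k) n \<and>
        tidy \<rho> k s \<and> tidy \<rho> k t \<and> destination \<rho> k s = destination \<rho> k t} \<union>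
        {basis_vec s | s. s \<in> syntax_trees (signals k) n \<and> \<not> tidy \<rho> k s} \<subseteq> ?I"
      using diff untidy[OF Tidy] by auto
    then have "signaletic_relations Tidy \<rho> k n \<subseteq> ?I"
      unfolding signaletic_relations.simps by (rule free_vs.span_minimal) (rule signaletic.subspace_relations)
    then show ?thesis using Tidy by simp
  qed
  show "?I \<subseteq> signaletic_relations \<phi> \<rho> k n"
  proof
    fix x assume "x \<in> ?I"
    then show "x \<in> signaletic_relations \<phi> \<rho> k n"
    proof (rule signaletic.relations_subspaceI)
      show "free_vs.subspace (signaletic_relations \<phi> \<rho> k n :: (letter list tree \<Rightarrow>\<^sub>0 'a) set)"
        by (cases \<phi>) (simp_all add: free_vs.subspace_span)
      fix t assume t: "t \<in> syntax_trees (signals k) n"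
      let ?t = "comb (normal_word \<rho> k t)"
      have tG: "set_tree t \<subseteq> signals k" "size1 t = n" using t by (auto simp: in_syntax_trees_iff)
      have nt: "?t \<in> syntax_trees (signals k) n" "destination \<rho> k t = destination \<rho> k ?t" "tidy \<rho> k ?t"
        using normal_word[of \<rho> k t] tG
        by (auto simp: in_syntax_trees_iff size1_size destination_eq_iff tidy_iff)
      show "basis_vec t - opt_vec (signaletic.normal_tree \<phi> \<rho> k t) \<in> signaletic_relations \<phi> \<rho> k n"
      proof (cases "\<phi> = Tidy \<and> \<not> cars_tidy \<rho> k {..<k} t")
        case True
        then show ?thesis
          using t tG by (auto simp: signaletic.normal_tree_def signaletic_nf_def tidy_iff intro!: free_vs.span_base)
      next
        case False
        then have "signaletic.normal_tree \<phi> \<rho> k t = Some ?t"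
          by (auto simp: signaletic.normal_tree_def signaletic_nf_def)
        then show ?thesis
          using False t nt tidy_iff[OF tG(1), of \<rho>] by (cases \<phi>) (auto intro!: free_vs.span_base)
      qed
    qed
  qed
qed

text \<open>A normal form is a tidy right comb by construction, and a tidy right comb is its own
  normal form by uniqueness. Thus both flavours have the same normal trees.\<close>

lemma right_signaletic_combs_eq:
  "right_signaletic_combs \<rho> k = {t. set_tree t \<subseteq> signals k \<and> signaletic.normal_tree \<phi> \<rho> k t = Some t}"
proof -
  have "right_comb t \<and> tidy \<rho> k t \<longleftrightarrow> signaletic.normal_tree \<phi> \<rho> k t = Some t"
    if t: "set_tree t \<subseteq> signals k" for t
  proof (cases "right_comb t")
    case True
    then obtain ws where ws: "t = comb ws" by (auto simp: right_comb_iff)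
    then have "normal_word \<rho> k t = ws \<longleftrightarrow> tidy \<rho> k t"
      using t normal_word_comb[of ws k \<rho>] by (simp add: tidy_iff)
    then show ?thesis
      using True t ws by (auto simp: signaletic.normal_tree_def signaletic_nf_def tidy_iff)
  next
    case False
    then show ?thesis by (auto simp: signaletic.normal_tree_def right_comb_iff)
  qed
  then show ?thesis by (auto simp: right_signaletic_combs_def)
qed

theorem theorem3p13:
  fixes \<phi> :: flavour and \<rho> :: circulation and k :: nat
  shows "quadratic (signals k) (signaletic_relations \<phi> \<rho> k :: nat \<Rightarrow> (letter list tree \<Rightarrow>\<^sub>0 'a::field) set)
    \<and> koszul (signaletic_operad \<phi> \<rho> k :: ('a, (letter list tree \<Rightarrow>\<^sub>0 'a) set) ns_operad)
    \<and> (\<exists>R :: (letter list, 'a) rules.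
         orients_quadratic_relations (signals k) (signaletic_relations \<phi> \<rho> k) R
         \<and> convergent_rules (signals k) R
         \<and> normal_form_trees (signals k) R = right_signaletic_combs \<rho> k)"
proof -
  have eq: "(signaletic_relations \<phi> \<rho> k :: nat \<Rightarrow> (letter list tree \<Rightarrow>\<^sub>0 'a) set) = signaletic.relations k \<phi> \<rho>"
    by (rule ext) (rule signaletic_relations_eq)
  show ?thesis
    unfolding signaletic_operad_def eq right_signaletic_combs_eq[of \<rho> k \<phi>]
    using signaletic.quadratic_relations signaletic.koszul_quotient
      signaletic.orients_quadratic_relations_comb_rules signaletic.convergent_comb_rules
      signaletic.normal_form_trees_comb_rules
    by blast
qed

end
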